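(* Let $q\in\mathbb{C}$ with $|q|=1$ and $q$ not a root of unity. The Haar state $h$ of the compact quantum group $U_q(2)$ is faithful on the $C^*$-algebra $C(U_q(2))$; that is, if $x\in C(U_q(2))$ and $h(x^*x)=0$, then $x=0$.
   Context: For $q\in\mathbb{C}\setminus\{0\}$, $C(U_q(2))$ is the universal unital $C^*$-algebra generated by $a,b,D$ subject to $$ba=qab,\quad a^*b=qba^*,\quad bb^*=b^*b,\quad aa^*+bb^*=1,\quad aD=Da,\quad bD=q^2|q|^{-2}Db,\quad DD^*=D^*D=1,\quad a^*a+|q|^2b^*b=1.$$ It is a compact quantum group (in the sense of Woronowicz) with comultiplication $\Delta:C(U_q(2))\to C(U_q(2))\otimes C(U_q(2))$, $$\Delta(a)=a\otimes a-\bar q\,b\otimes Db^*,\qquad \Delta(b)=a\otimes b+b\otimes Da^*,\qquad \Delta(D)=D\otimes D.$$ The Haar state $h$ is the unique state on $C(U_q(2))$ with $(h\otimes\mathrm{id})\Delta(x)=h(x)1=(\mathrm{id}\otimes h)\Delta(x)$ for all $x$. *)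

theory Defs
  imports Complex_Main "HOL-Algebra.Module"
begin

section \<open>Unital C*-algebras\<close>

record 'a cstar_algebra = "(complex, 'a) module" +
  star :: "'a \<Rightarrow> 'a"  (\<open>_\<^sup>\<star>\<index>\<close> [1000] 999)
  cnorm :: "'a \<Rightarrow> real"  (\<open>\<parallel>_\<parallel>\<index>\<close>)

definition complex_ring :: "complex ring" where
  "complex_ring = \<lparr>carrier = UNIV, mult = (*), one = 1, zero = 0, add = (+)\<rparr>"

text \<open>\<open>p\<close> is a C*-norm on the *-subalgebra \<open>S\<close> of \<open>A\<close>.
  Nonnegativity of \<open>p\<close> follows from the first three clauses.\<close>

definition cstar_norm_on :: "'a cstar_algebra \<Rightarrow> 'a set \<Rightarrow> ('a \<Rightarrow> real) \<Rightarrow> bool" where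
  "cstar_norm_on A S p \<longleftrightarrow>
     (\<forall>x\<in>S. p x = 0 \<longrightarrow> x = \<zero>\<^bsub>A\<^esub>) \<and>
     (\<forall>x\<in>S. \<forall>y\<in>S. p (x \<oplus>\<^bsub>A\<^esub> y) \<le> p x + p y) \<and>
     (\<forall>c. \<forall>x\<in>S. p (c \<odot>\<^bsub>A\<^esub> x) = cmod c * p x) \<and>
     (\<forall>x\<in>S. \<forall>y\<in>S. p (x \<otimes>\<^bsub>A\<^esub> y) \<le> p x * p y) \<and>
     (\<forall>x\<in>S. p (x\<^sup>\<star>\<^bsub>A\<^esub> \<otimes>\<^bsub>A\<^esub> x) = (p x)\<^sup>2)"

text \<open>The zero algebra is allowed.\<close>

locale unital_cstar_algebra = module complex_ring A + ring A
  for A :: "'a cstar_algebra" (structure) +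
  assumes smult_mult_left:
      "\<And>c x y. \<lbrakk>x \<in> carrier A; y \<in> carrier A\<rbrakk> \<Longrightarrow> (c \<odot> x) \<otimes> y = c \<odot> (x \<otimes> y)"
    and smult_mult_right:
      "\<And>c x y. \<lbrakk>x \<in> carrier A; y \<in> carrier A\<rbrakk> \<Longrightarrow> x \<otimes> (c \<odot> y) = c \<odot> (x \<otimes> y)"
    and star_closed: "\<And>x. x \<in> carrier A \<Longrightarrow> x\<^sup>\<star> \<in> carrier A"
    and star_star: "\<And>x. x \<in> carrier A \<Longrightarrow> (x\<^sup>\<star>)\<^sup>\<star> = x"
    and star_add: "\<And>x y. \<lbrakk>x \<in> carrier A; y \<in> carrier A\<rbrakk> \<Longrightarrow> (x \<oplus> y)\<^sup>\<star> = x\<^sup>\<star> \<oplus> y\<^sup>\<star>"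
    and star_smult: "\<And>c x. x \<in> carrier A \<Longrightarrow> (c \<odot> x)\<^sup>\<star> = cnj c \<odot> x\<^sup>\<star>"
    and star_mult: "\<And>x y. \<lbrakk>x \<in> carrier A; y \<in> carrier A\<rbrakk> \<Longrightarrow> (x \<otimes> y)\<^sup>\<star> = y\<^sup>\<star> \<otimes> x\<^sup>\<star>"
    and cstar_norm: "cstar_norm_on A (carrier A) (cnorm A)"
    and complete:
      "\<And>\<sigma> :: nat \<Rightarrow> 'a. \<lbrakk>range \<sigma> \<subseteq> carrier A;
          \<forall>e>0. \<exists>N. \<forall>m\<ge>N. \<forall>n\<ge>N. \<parallel>\<sigma> m \<ominus> \<sigma> n\<parallel> < e\<rbrakk>
        \<Longrightarrow> \<exists>x\<in>carrier A. (\<lambda>n. \<parallel>\<sigma> n \<ominus> x\<parallel>) \<longlonglongrightarrow> 0"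

definition complex_linear ::
    "'a cstar_algebra \<Rightarrow> 'b cstar_algebra \<Rightarrow> ('a \<Rightarrow> 'b) \<Rightarrow> bool" where
  "complex_linear A B f \<longleftrightarrow>
     f \<in> carrier A \<rightarrow> carrier B \<and>
     (\<forall>x\<in>carrier A. \<forall>y\<in>carrier A. f (x \<oplus>\<^bsub>A\<^esub> y) = f x \<oplus>\<^bsub>B\<^esub> f y) \<and>
     (\<forall>c. \<forall>x\<in>carrier A. f (c \<odot>\<^bsub>A\<^esub> x) = c \<odot>\<^bsub>B\<^esub> f x)"

definition bounded_complex_linear ::
    "'a cstar_algebra \<Rightarrow> 'b cstar_algebra \<Rightarrow> ('a \<Rightarrow> 'b) \<Rightarrow> bool" where
  "bounded_complex_linear A B f \<longleftrightarrow>
     complex_linear A B f \<and> (\<exists>K. \<forall>x\<in>carrier A. \<parallel>f x\<parallel>\<^bsub>B\<^esub> \<le> K * \<parallel>x\<parallel>\<^bsub>A\<^esub>)"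

definition unital_star_hom :: "'a cstar_algebra \<Rightarrow> 'b cstar_algebra \<Rightarrow> ('a \<Rightarrow> 'b) set" where
  "unital_star_hom A B =
     {f \<in> ring_hom A B. complex_linear A B f \<and> (\<forall>x\<in>carrier A. f (x\<^sup>\<star>\<^bsub>A\<^esub>) = (f x)\<^sup>\<star>\<^bsub>B\<^esub>)}"

definition closed_star_subalgebra :: "'a cstar_algebra \<Rightarrow> 'a set \<Rightarrow> bool" where
  "closed_star_subalgebra A S \<longleftrightarrow>
     S \<subseteq> carrier A \<and> \<one>\<^bsub>A\<^esub> \<in> S \<and>
     (\<forall>x\<in>S. \<forall>y\<in>S. x \<oplus>\<^bsub>A\<^esub> y \<in> S) \<and>
     (\<forall>c. \<forall>x\<in>S. c \<odot>\<^bsub>A\<^esub> x \<in> S) \<and>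
     (\<forall>x\<in>S. \<forall>y\<in>S. x \<otimes>\<^bsub>A\<^esub> y \<in> S) \<and>
     (\<forall>x\<in>S. x\<^sup>\<star>\<^bsub>A\<^esub> \<in> S) \<and>
     (\<forall>\<sigma>. \<forall>x\<in>carrier A. range \<sigma> \<subseteq> S \<longrightarrow>
        (\<lambda>n::nat. \<parallel>\<sigma> n \<ominus>\<^bsub>A\<^esub> x\<parallel>\<^bsub>A\<^esub>) \<longlonglongrightarrow> 0 \<longrightarrow> x \<in> S)"

definition cstar_generates :: "'a cstar_algebra \<Rightarrow> 'a set \<Rightarrow> bool" where
  "cstar_generates A G \<longleftrightarrow>
     G \<subseteq> carrier A \<and> (\<forall>S. closed_star_subalgebra A S \<and> G \<subseteq> S \<longrightarrow> S = carrier A)"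

definition state :: "'a cstar_algebra \<Rightarrow> ('a \<Rightarrow> complex) \<Rightarrow> bool" where
  "state A h \<longleftrightarrow>
     (\<forall>x\<in>carrier A. \<forall>y\<in>carrier A. h (x \<oplus>\<^bsub>A\<^esub> y) = h x + h y) \<and>
     (\<forall>c. \<forall>x\<in>carrier A. h (c \<odot>\<^bsub>A\<^esub> x) = c * h x) \<and>
     (\<forall>x\<in>carrier A. Im (h (x\<^sup>\<star>\<^bsub>A\<^esub> \<otimes>\<^bsub>A\<^esub> x)) = 0 \<and> 0 \<le> Re (h (x\<^sup>\<star>\<^bsub>A\<^esub> \<otimes>\<^bsub>A\<^esub> x))) \<and>
     h \<one>\<^bsub>A\<^esub> = 1"


section \<open>The minimal tensor product\<close>

text \<open>The algebraic tensor product sits in \<open>T\<close> as the set of finite sums of elementary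
  tensors; scalars are absorbed by the first leg.\<close>

definition elementary_span ::
    "'a cstar_algebra \<Rightarrow> 'b cstar_algebra \<Rightarrow> 't cstar_algebra \<Rightarrow> ('a \<Rightarrow> 'b \<Rightarrow> 't) \<Rightarrow> 't set" where
  "elementary_span A B T tens =
     {(\<Oplus>\<^bsub>T\<^esub>i\<in>{..<n}. tens (x i) (y i)) | (n::nat) x y.
        x \<in> {..<n} \<rightarrow> carrier A \<and> y \<in> {..<n} \<rightarrow> carrier B}"

text \<open>\<open>T\<close> with \<open>tens\<close> is the minimal C*-tensor product of \<open>A\<close> and \<open>B\<close>, that is, the
  completion of the algebraic tensor product in its least C*-norm. Assumption
  \<open>tens_injective\<close> says that the algebraic tensor product embeds into \<open>T\<close>.\<close>

locale min_tensor_product =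
  A: unital_cstar_algebra A + B: unital_cstar_algebra B + T: unital_cstar_algebra T
  for A :: "'a cstar_algebra" and B :: "'b cstar_algebra" and T :: "'t cstar_algebra" +
  fixes tens :: "'a \<Rightarrow> 'b \<Rightarrow> 't"
  assumes tens_linear_left: "\<And>y. y \<in> carrier B \<Longrightarrow> complex_linear A T (\<lambda>x. tens x y)"
    and tens_linear_right: "\<And>x. x \<in> carrier A \<Longrightarrow> complex_linear B T (tens x)"
    and tens_mult:
      "\<And>x x' y y'. \<lbrakk>x \<in> carrier A; x' \<in> carrier A; y \<in> carrier B; y' \<in> carrier B\<rbrakk>
        \<Longrightarrow> tens x y \<otimes>\<^bsub>T\<^esub> tens x' y' = tens (x \<otimes>\<^bsub>A\<^esub> x') (y \<otimes>\<^bsub>B\<^esub> y')"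
    and tens_star:
      "\<And>x y. \<lbrakk>x \<in> carrier A; y \<in> carrier B\<rbrakk>
        \<Longrightarrow> (tens x y)\<^sup>\<star>\<^bsub>T\<^esub> = tens (x\<^sup>\<star>\<^bsub>A\<^esub>) (y\<^sup>\<star>\<^bsub>B\<^esub>)"
    and tens_one: "tens \<one>\<^bsub>A\<^esub> \<one>\<^bsub>B\<^esub> = \<one>\<^bsub>T\<^esub>"
    and tens_injective:
      "\<And>(n::nat) x y.
        \<lbrakk>x \<in> {..<n} \<rightarrow> carrier A; y \<in> {..<n} \<rightarrow> carrier B;
         \<And>c. (\<Oplus>\<^bsub>B\<^esub>i\<in>{..<n}. c i \<odot>\<^bsub>B\<^esub> y i) = \<zero>\<^bsub>B\<^esub> \<Longrightarrow> \<forall>i<n. c i = 0;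
         (\<Oplus>\<^bsub>T\<^esub>i\<in>{..<n}. tens (x i) (y i)) = \<zero>\<^bsub>T\<^esub>\<rbrakk>
        \<Longrightarrow> \<forall>i<n. x i = \<zero>\<^bsub>A\<^esub>"
    and tens_dense:
      "\<And>t e. \<lbrakk>t \<in> carrier T; e > 0\<rbrakk> \<Longrightarrow> \<exists>s\<in>elementary_span A B T tens. \<parallel>t \<ominus>\<^bsub>T\<^esub> s\<parallel>\<^bsub>T\<^esub> < e"
    and tens_norm_least:
      "\<And>p t. \<lbrakk>cstar_norm_on T (elementary_span A B T tens) p; t \<in> elementary_span A B T tens\<rbrakk>
        \<Longrightarrow> \<parallel>t\<parallel>\<^bsub>T\<^esub> \<le> p t"

text \<open>\<open>S\<close> is the slice map \<open>h \<otimes> id\<close>, respectively \<open>id \<otimes> h\<close>: the bounded linear extension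
  of \<open>x \<otimes> y \<mapsto> h(x) y\<close>, respectively \<open>x \<otimes> y \<mapsto> h(y) x\<close>; it is unique by density.\<close>

definition slice_left ::
    "'a cstar_algebra \<Rightarrow> 'b cstar_algebra \<Rightarrow> 't cstar_algebra \<Rightarrow> ('a \<Rightarrow> 'b \<Rightarrow> 't) \<Rightarrow>
     ('a \<Rightarrow> complex) \<Rightarrow> ('t \<Rightarrow> 'b) \<Rightarrow> bool" where
  "slice_left A B T tens h S \<longleftrightarrow>
     bounded_complex_linear T B S \<and>
     (\<forall>x\<in>carrier A. \<forall>y\<in>carrier B. S (tens x y) = h x \<odot>\<^bsub>B\<^esub> y)"

definition slice_right ::
    "'a cstar_algebra \<Rightarrow> 'b cstar_algebra \<Rightarrow> 't cstar_algebra \<Rightarrow> ('a \<Rightarrow> 'b \<Rightarrow> 't) \<Rightarrow>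
     ('b \<Rightarrow> complex) \<Rightarrow> ('t \<Rightarrow> 'a) \<Rightarrow> bool" where
  "slice_right A B T tens h S \<longleftrightarrow>
     bounded_complex_linear T A S \<and>
     (\<forall>x\<in>carrier A. \<forall>y\<in>carrier B. S (tens x y) = h y \<odot>\<^bsub>A\<^esub> x)"

definition haar_state ::
    "'a cstar_algebra \<Rightarrow> 't cstar_algebra \<Rightarrow> ('a \<Rightarrow> 'a \<Rightarrow> 't) \<Rightarrow> ('a \<Rightarrow> 't) \<Rightarrow>
     ('a \<Rightarrow> complex) \<Rightarrow> bool" where
  "haar_state A T tens \<Delta> h \<longleftrightarrow>
     state A h \<and>
     (\<exists>S. slice_left A A T tens h S \<and> (\<forall>x\<in>carrier A. S (\<Delta> x) = h x \<odot>\<^bsub>A\<^esub> \<one>\<^bsub>A\<^esub>)) \<and>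
     (\<exists>S. slice_right A A T tens h S \<and> (\<forall>x\<in>carrier A. S (\<Delta> x) = h x \<odot>\<^bsub>A\<^esub> \<one>\<^bsub>A\<^esub>))"


section \<open>The compact quantum group \<open>U\<^sub>q(2)\<close>\<close>

definition Uq2_relations ::
    "complex \<Rightarrow> 'a cstar_algebra \<Rightarrow> 'a \<Rightarrow> 'a \<Rightarrow> 'a \<Rightarrow> bool" where
  "Uq2_relations q A a b D \<longleftrightarrow>
     a \<in> carrier A \<and> b \<in> carrier A \<and> D \<in> carrier A \<and>
     b \<otimes>\<^bsub>A\<^esub> a = q \<odot>\<^bsub>A\<^esub> (a \<otimes>\<^bsub>A\<^esub> b) \<and>
     a\<^sup>\<star>\<^bsub>A\<^esub> \<otimes>\<^bsub>A\<^esub> b = q \<odot>\<^bsub>A\<^esub> (b \<otimes>\<^bsub>A\<^esub> a\<^sup>\<star>\<^bsub>A\<^esub>) \<and>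
     b \<otimes>\<^bsub>A\<^esub> b\<^sup>\<star>\<^bsub>A\<^esub> = b\<^sup>\<star>\<^bsub>A\<^esub> \<otimes>\<^bsub>A\<^esub> b \<and>
     a \<otimes>\<^bsub>A\<^esub> a\<^sup>\<star>\<^bsub>A\<^esub> \<oplus>\<^bsub>A\<^esub> b \<otimes>\<^bsub>A\<^esub> b\<^sup>\<star>\<^bsub>A\<^esub> = \<one>\<^bsub>A\<^esub> \<and>
     a \<otimes>\<^bsub>A\<^esub> D = D \<otimes>\<^bsub>A\<^esub> a \<and>
     b \<otimes>\<^bsub>A\<^esub> D = (q\<^sup>2 / (complex_of_real (cmod q))\<^sup>2) \<odot>\<^bsub>A\<^esub> (D \<otimes>\<^bsub>A\<^esub> b) \<and>
     D \<otimes>\<^bsub>A\<^esub> D\<^sup>\<star>\<^bsub>A\<^esub> = \<one>\<^bsub>A\<^esub> \<and>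
     D\<^sup>\<star>\<^bsub>A\<^esub> \<otimes>\<^bsub>A\<^esub> D = \<one>\<^bsub>A\<^esub> \<and>
     a\<^sup>\<star>\<^bsub>A\<^esub> \<otimes>\<^bsub>A\<^esub> a \<oplus>\<^bsub>A\<^esub> ((complex_of_real (cmod q))\<^sup>2) \<odot>\<^bsub>A\<^esub> (b\<^sup>\<star>\<^bsub>A\<^esub> \<otimes>\<^bsub>A\<^esub> b) = \<one>\<^bsub>A\<^esub>"

text \<open>\<open>A\<close> is the universal unital C*-algebra \<open>C(U\<^sub>q(2))\<close> on the generators \<open>a\<close>, \<open>b\<close>, \<open>D\<close>.
  HOL cannot quantify over the type of the test algebra \<open>B\<close>, so \<open>B\<close> ranges over all unital
  C*-algebras whose carrier is a set of elements of the type underlying \<open>A\<close>. This loses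
  nothing: only the part of \<open>B\<close> generated by the images of \<open>a\<close>, \<open>b\<close>, \<open>D\<close> matters, its
  cardinality is at most that of the continuum, and the type underlying \<open>A\<close> is at least that
  large unless \<open>A\<close> is the zero algebra, hence it carries an isomorphic copy.
  Uniqueness of \<open>f\<close> is a consequence of generation.\<close>

definition is_C_Uq2 ::
    "complex \<Rightarrow> 'a cstar_algebra \<Rightarrow> 'a \<Rightarrow> 'a \<Rightarrow> 'a \<Rightarrow> bool" where
  "is_C_Uq2 q A a b D \<longleftrightarrow>
     unital_cstar_algebra A \<and>
     Uq2_relations q A a b D \<and>
     cstar_generates A {a, b, D} \<and>
     (\<forall>(B :: 'a cstar_algebra) a' b' D'.
        unital_cstar_algebra B \<and> Uq2_relations q B a' b' D' \<longrightarrow>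
        (\<exists>f\<in>unital_star_hom A B. f a = a' \<and> f b = b' \<and> f D = D'))"

definition Uq2_comultiplication ::
    "complex \<Rightarrow> 'a cstar_algebra \<Rightarrow> 'a \<Rightarrow> 'a \<Rightarrow> 'a \<Rightarrow>
     't cstar_algebra \<Rightarrow> ('a \<Rightarrow> 'a \<Rightarrow> 't) \<Rightarrow> ('a \<Rightarrow> 't) \<Rightarrow> bool" where
  "Uq2_comultiplication q A a b D T tens \<Delta> \<longleftrightarrow>
     \<Delta> \<in> unital_star_hom A T \<and>
     \<Delta> a = tens a a \<ominus>\<^bsub>T\<^esub> cnj q \<odot>\<^bsub>T\<^esub> tens b (D \<otimes>\<^bsub>A\<^esub> b\<^sup>\<star>\<^bsub>A\<^esub>) \<and>
     \<Delta> b = tens a b \<oplus>\<^bsub>T\<^esub> tens b (D \<otimes>\<^bsub>A\<^esub> a\<^sup>\<star>\<^bsub>A\<^esub>) \<and>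
     \<Delta> D = tens D D"

end

theory Submission
  imports Defs "HOL-Analysis.Analysis" "HOL-Computational_Algebra.Polynomial" "HOL-Library.Multiset"
    "HOL-Library.Product_Plus"
begin

text \<open>The element \<open>c = bb\<^sup>\<star>\<close> is central and the generators commute up to powers of \<open>q\<close>, so the
  polynomials in the generators are graded by \<open>\<int>\<^sup>3\<close>, and \<open>u\<^sup>\<star>u\<close> is a polynomial in \<open>c\<close> for
  homogeneous \<open>u\<close>. Slicing with the characters \<open>a \<mapsto> s\<close>, \<open>b \<mapsto> 0\<close>, \<open>D \<mapsto> t\<close> shows that \<open>h\<close> vanishes
  in nonzero degree; hence \<open>h\<close> is a trace and the homogeneous components are orthogonal. If
  \<open>ab \<noteq> 0\<close>, invariance of \<open>h\<close> applied to \<open>a\<^sup>nb\<^sup>\<star>\<^sup>n\<close> gives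
  \<open>\<Sum>\<^sub>k (-1)\<^sup>k (n choose k)\<^sup>2 h((1 - c)\<^bsup>n-k\<^esup>c\<^sup>k) = 0\<close>, which forces \<open>h\<close> to be Lebesgue measure on
  \<open>[0, 1]\<close> in the variable \<open>c\<close>; if \<open>ab = 0\<close>, then \<open>c\<close> is a projection. Expanding in Chebyshev
  polynomials of \<open>1 - 2c\<close>, whose norms are controlled by Pell's equation, yields
  \<open>\<parallel>z\<parallel>\<^sup>2 \<le> p(M) h(z\<^sup>\<star>z)\<close> with a polynomial \<open>p\<close> for all \<open>z\<close> in the span of words of length at most
  \<open>M\<close>. Finally, if \<open>h(x\<^sup>\<star>x) = 0\<close> and \<open>z\<close> is such a span element close to \<open>x\<close>, the trace property
  gives \<open>h((z\<^sup>\<star>z)\<^sup>n) = h((e\<^sup>\<star>e)\<^sup>n)\<close> for \<open>e = z - x\<close>. Applying the estimate to \<open>(z\<^sup>\<star>z)\<^sup>m\<close> and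
  letting \<open>m \<rightarrow> \<infinity>\<close> kills the polynomial factor, so \<open>\<parallel>z\<parallel> \<le> \<parallel>e\<parallel>\<close> and \<open>x = 0\<close>.\<close>

section \<open>Chebyshev polynomials and the Lebesgue moments\<close>

text \<open>The given norm dominates the seminorm that \<open>h\<close> induces through
  \<open>h (x\<^sup>\<star> \<otimes> x)\<close>; the task is a converse. On words of bounded length
  the ratio of the two is at most polynomial, and high powers make such a ratio invisible. To
  replace \<open>z\<close> by \<open>z - x\<close> inside these powers, null elements must stay
  invisible between arbitrary factors on both sides. This is what the trace property provides, and
  it rests on |q| = 1: the exponent of \<open>q\<close> is an alternating form in the degrees, so
  words of opposite degree commute exactly. Universality enters only through characters; no concrete
  representation is built. Hence \<open>ab = 0\<close> is not excluded, and the degenerate case is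
  carried along with its own value of \<open>h c\<close>. No spectral theory is used. Norms of
  polynomials in \<open>c\<close> are bounded by identities between squares, the C*-identity and
  square roots obtained by iteration; the normal element \<open>ab\<close>, with
  \<open>(ab)\<^sup>\<star>(ab) = c(1 - c)\<close>, takes the place of the statement that the
  spectrum of \<open>c\<close> lies in [0, 1].\<close>

text \<open>Chebyshev polynomials in the variable \<open>x = 1 - 2 t\<close>: \<open>chebT n = T\<^sub>n(1 - 2 t)\<close> and
  \<open>chebV n = U\<^bsub>n-1\<^esub>(1 - 2 t)\<close>; note \<open>1 - x\<^sup>2 = 4 t - 4 t\<^sup>2\<close>.\<close>

fun chebT :: "nat \<Rightarrow> real poly" and chebV :: "nat \<Rightarrow> real poly" where
  "chebT 0 = 1"
| "chebT (Suc n) = [:1, -2:] * chebT n - [:0, 4, -4:] * chebV n"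
| "chebV 0 = 0"
| "chebV (Suc n) = [:1, -2:] * chebV n + chebT n"

text \<open>Multiplicativity of the form u^2 + s v^2: with w^2 = -s, the product of x + w and u + v
  w is (x u - s v) + (x v + u) w. One step of the Chebyshev recursion is multiplication by x +
  w.\<close>

lemma brahmagupta:
  fixes x s u v :: "'a::comm_ring"
  shows "(x * u - s * v) * (x * u - s * v) + s * ((x * v + u) * (x * v + u)) = (x * x + s) * (u * u + s * (v * v))"
  by (simp add: algebra_simps)

text \<open>Here x + w has form value 1, hence so have its powers. This is cos^2 + sin^2 = 1 as a
  polynomial identity, so it can be evaluated at an algebra element.\<close>

lemma cheb_pell: "chebT n * chebT n + [:0, 4, -4:] * (chebV n * chebV n) = 1"
proof (induction n)
  case (Suc n)
  let ?x = "[:1, -2:] :: real poly" and ?s = "[:0, 4, -4:] :: real poly"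
  have xs: "?x * ?x + ?s = 1" by (simp add: one_pCons)
  have "chebT (Suc n) * chebT (Suc n) + ?s * (chebV (Suc n) * chebV (Suc n))
      = (?x * ?x + ?s) * (chebT n * chebT n + ?s * (chebV n * chebV n))"
    unfolding chebT.simps chebV.simps by (rule brahmagupta)
  then show ?case unfolding xs Suc by simp
qed simp

text \<open>This form of the recursion suits norm estimates: once \<open>chebT\<close> has norm at
  most 1, two steps add at most 2, so \<open>chebV n\<close> is bounded by \<open>n\<close>. The
  three-term recursion below would only give exponential growth.\<close>

lemma chebV_Suc_Suc: "chebV (Suc (Suc n)) = chebV n + chebT (Suc n) + chebT (Suc n)"
proof -
  let ?x = "[:1, -2:] :: real poly" and ?s = "[:0, 4, -4:] :: real poly"
  have xs: "?x * ?x + ?s = 1" by (simp add: one_pCons)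
  have "x * (x * v + u) + (x * u - s * v) = (x * x + s) * v + (x * u - s * v) + (x * u - s * v)"
    for x s u v :: "real poly"
    by (simp add: algebra_simps)
  then have "chebV (Suc (Suc n)) = (?x * ?x + ?s) * chebV n + chebT (Suc n) + chebT (Suc n)"
    unfolding chebT.simps chebV.simps .
  then show ?thesis unfolding xs by simp
qed

lemma chebV_rec: "chebV (Suc (Suc n)) = [:2, -4:] * chebV (Suc n) - chebV n"
proof -
  let ?x = "[:1, -2:] :: real poly"
  have "[:2, -4:] = 2 * ?x" by (simp add: numeral_poly)
  moreover have "w = 2 * x * v - u" if "w = u + t + t" "w = x * v + t" for w u t x v :: "real poly"
    using that by (simp add: algebra_simps)
  ultimately show ?thesis using chebV_Suc_Suc[of n] chebV.simps(2)[of "Suc n"] by metis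
qed

lemma cheb_trig:
  "poly (chebT n) ((1 - cos \<theta>) / 2) = cos (real n * \<theta>)"
  "poly (chebV n) ((1 - cos \<theta>) / 2) * sin \<theta> = sin (real n * \<theta>)"
proof (induction n)
  case (Suc n)
  let ?t = "(1 - cos \<theta>) / 2"
  have x: "poly [:1, -2:] ?t = cos \<theta>" by (simp add: field_simps)
  have s: "poly [:0, 4, -4:] ?t = sin \<theta> * sin \<theta>"
  proof -
    have "sin \<theta> * sin \<theta> = 1 - cos \<theta> * cos \<theta>"
      using sin_squared_eq[of \<theta>] by (simp add: power2_eq_square)
    moreover have "poly [:0, 4, -4:] ?t = 1 - cos \<theta> * cos \<theta>" by (simp add: field_simps)
    ultimately show ?thesis by simp
  qed
  {
    case 1
    have "poly (chebT (Suc n)) ?t = cos \<theta> * poly (chebT n) ?t - sin \<theta> * (poly (chebV n) ?t * sin \<theta>)"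
      unfolding chebT.simps poly_diff poly_mult x s by simp
    then show ?case unfolding Suc by (simp add: cos_add[symmetric] algebra_simps)
  next
    case 2
    have "poly (chebV (Suc n)) ?t * sin \<theta>
        = cos \<theta> * (poly (chebV n) ?t * sin \<theta>) + poly (chebT n) ?t * sin \<theta>"
      unfolding chebV.simps poly_add poly_mult x by (simp add: algebra_simps)
    also have "\<dots> = sin (real (Suc n) * \<theta>)"
      unfolding Suc by (simp add: distrib_right sin_add)
    finally show ?case .
  }
qed simp_all

text \<open>U_n has leading coefficient 2^n in x, and x = 1 - 2 t contributes (-2)^n.\<close>

lemma chebV_coeff: "degree (chebV (Suc n)) \<le> n \<and> coeff (chebV (Suc n)) n = (-4) ^ n"
proof (induction n rule: induct_nat_012)
  case (ge2 n)
  have d0: "degree (chebV (Suc n)) \<le> n" and d1: "degree (chebV (Suc (Suc n))) \<le> Suc n"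
    and c1: "coeff (chebV (Suc (Suc n))) (Suc n) = (-4) ^ Suc n" using ge2 by blast+
  have "degree ([:2, -4:] * chebV (Suc (Suc n))) \<le> Suc (Suc n)"
    using degree_mult_le[of "[:2, -4:]" "chebV (Suc (Suc n))"] d1 by simp
  then have "degree (chebV (Suc (Suc (Suc n)))) \<le> Suc (Suc n)"
    unfolding chebV_rec[of "Suc n"] using d0 by (intro degree_diff_le) auto
  moreover have "coeff (chebV (Suc (Suc (Suc n)))) (Suc (Suc n)) = (-4) ^ Suc (Suc n)"
    unfolding chebV_rec[of "Suc n"] using c1 d0 d1
    by (simp add: coeff_eq_0 mult_pCons_left del: chebV.simps)
  ultimately show ?case by blast
qed simp_all

text \<open>Leading terms are removed one degree at a time, which works because the leading
  coefficients above do not vanish.\<close>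

lemma chebV_span:
  "degree f \<le> N \<Longrightarrow> \<exists>g. f = (\<Sum>j\<le>N. smult (g j) (chebV (Suc j)))"
proof (induction N arbitrary: f)
  case 0
  then obtain a where "f = [:a:]" using degree_eq_zeroE by blast
  then have "f = (\<Sum>j\<le>0. smult ((\<lambda>_. a) j) (chebV (Suc j)))" by (simp add: one_pCons)
  then show ?case by (rule exI[of _ "\<lambda>_. a"])
next
  case (Suc N)
  let ?V = "chebV (Suc (Suc N))"
  define a where "a = coeff f (Suc N) / (-4) ^ Suc N"
  define f' where "f' = f - smult a ?V"
  have "degree f' \<le> N"
  proof (rule degree_le, intro allI impI)
    fix i assume i: "N < i"
    show "coeff f' i = 0"
    proof (cases "i = Suc N")
      case True
      then show ?thesis using chebV_coeff[of "Suc N"] by (simp add: f'_def a_def del: chebV.simps power_Suc)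
    next
      case False
      then have "degree f < i" "degree ?V < i" using i Suc.prems chebV_coeff[of "Suc N"] by linarith+
      then show ?thesis by (simp add: f'_def coeff_eq_0 del: chebV.simps)
    qed
  qed
  then obtain g where g: "f' = (\<Sum>j\<le>N. smult (g j) (chebV (Suc j)))" using Suc.IH by blast
  have "f = f' + smult a ?V" by (simp add: f'_def)
  also have "\<dots> = (\<Sum>j\<le>Suc N. smult ((g(Suc N := a)) j) (chebV (Suc j)))"
    unfolding g by (simp del: chebV.simps)
  finally show ?case by blast
qed

section \<open>Orthogonality of sines and integrals of polynomials over [0, 1]\<close>

lemma integral_sin_sin:
  assumes "m > 0" "n > 0"
  shows "((\<lambda>\<theta>. sin (real m * \<theta>) * sin (real n * \<theta>)) has_integral (if m = n then pi / 2 else 0)) {0..pi}"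
proof (cases "m = n")
  case True
  have "((\<lambda>\<theta>. sin (real n * \<theta>) * sin (real n * \<theta>)) has_integral
      (pi / 2 - sin (2 * real n * pi) / (4 * real n)) - (0 / 2 - sin (2 * real n * 0) / (4 * real n))) {0..pi}"
  proof (rule fundamental_theorem_of_calculus)
    fix x
    have "((\<lambda>\<theta>. \<theta> / 2 - sin (2 * real n * \<theta>) / (4 * real n)) has_real_derivative
        (1 / 2 - cos (2 * real n * x) / 2)) (at x within {0..pi})"
      using assms by (auto intro!: derivative_eq_intros simp: field_simps)
    moreover have "1 / 2 - cos (2 * real n * x) / 2 = sin (real n * x) * sin (real n * x)"
      using cos_double_sin[of "real n * x"] by (simp add: mult.assoc power2_eq_square field_simps)
    ultimately show "((\<lambda>\<theta>. \<theta> / 2 - sin (2 * real n * \<theta>) / (4 * real n)) has_vector_derivative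
        sin (real n * x) * sin (real n * x)) (at x within {0..pi})"
      by (simp add: has_real_derivative_iff_has_vector_derivative)
  qed simp
  moreover have "sin (2 * real n * pi) = 0"
    using sin_npi[of "2 * n"] by simp
  ultimately show ?thesis using True by simp
next
  case False
  define p where "p = real m - real n"
  define s where "s = real m + real n"
  have ps: "p \<noteq> 0" "s \<noteq> 0" using False assms by (auto simp: p_def s_def)
  let ?F = "\<lambda>\<theta>. sin (p * \<theta>) / (2 * p) - sin (s * \<theta>) / (2 * s)"
  have "((\<lambda>\<theta>. sin (real m * \<theta>) * sin (real n * \<theta>)) has_integral ?F pi - ?F 0) {0..pi}"
  proof (rule fundamental_theorem_of_calculus)
    fix x
    have "(?F has_real_derivative (cos (p * x) / 2 - cos (s * x) / 2)) (at x within {0..pi})"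
      using ps by (auto intro!: derivative_eq_intros simp: field_simps)
    moreover have "cos (p * x) / 2 - cos (s * x) / 2 = sin (real m * x) * sin (real n * x)"
      by (simp add: sin_times_sin p_def s_def algebra_simps diff_divide_distrib)
    ultimately show "(?F has_vector_derivative sin (real m * x) * sin (real n * x)) (at x within {0..pi})"
      by (simp add: has_real_derivative_iff_has_vector_derivative)
  qed simp
  moreover have "sin (p * pi) = 0"
    using sin_int_times_real[of "int m - int n"] sin_zero_iff_int2[of "p * pi"] unfolding p_def
    by (metis of_int_diff of_int_of_nat_eq)
  moreover have "sin (s * pi) = 0"
    using sin_npi[of "m + n"] by (simp add: s_def)
  ultimately show ?thesis using False by simp
qed

lemma integral_sine_polynomial_square:
  "((\<lambda>\<theta>. (\<Sum>j\<le>N. g j * sin (real (Suc j) * \<theta>))\<^sup>2) has_integral (pi / 2 * (\<Sum>j\<le>N. (g j)\<^sup>2))) {0..pi}"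
proof -
  have "((\<lambda>\<theta>. \<Sum>j\<le>N. \<Sum>k\<le>N. (g j * g k) * (sin (real (Suc j) * \<theta>) * sin (real (Suc k) * \<theta>))) has_integral
      (\<Sum>j\<le>N. \<Sum>k\<le>N. (g j * g k) * (if Suc j = Suc k then pi / 2 else 0))) {0..pi}"
    by (intro has_integral_sum has_integral_mult_right integral_sin_sin) auto
  moreover have "(\<Sum>j\<le>N. \<Sum>k\<le>N. (g j * g k) * (if Suc j = Suc k then pi / 2 else 0)) = pi / 2 * (\<Sum>j\<le>N. (g j)\<^sup>2)"
    by (simp add: if_distrib sum_distrib_left power2_eq_square mult_ac cong: if_cong)
  moreover have "(\<Sum>j\<le>N. \<Sum>k\<le>N. (g j * g k) * (sin (real (Suc j) * \<theta>) * sin (real (Suc k) * \<theta>)))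
      = (\<Sum>j\<le>N. g j * sin (real (Suc j) * \<theta>))\<^sup>2" for \<theta>
    by (simp add: power2_eq_square sum_product mult_ac)
  ultimately show ?thesis by (simp only:)
qed

text \<open>With t = (1 - cos \<theta>) / 2, the function \<open>chebV (Suc j)\<close> times sin
  \<theta> is sin ((j + 1) \<theta>), so these polynomials are orthogonal for the weight sin^2
  \<theta>. Lebesgue measure has weight sin \<theta> / 2, and sin^2 \<le> sin on [0, pi]; hence it
  dominates half of the Chebyshev weight. The factor 2 remains after using pi / 2 \<ge> 1.\<close>

lemma chebV_coeff_bound:
  assumes f: "f = (\<Sum>j\<le>N. smult (g j) (chebV (Suc j)))"
  shows "(\<Sum>j\<le>N. (g j)\<^sup>2) \<le> 2 * integral {0..1} (poly (f * f))"
proof -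
  let ?t = "\<lambda>\<theta>. (1 - cos \<theta>) / 2 :: real"
  have sine: "poly f (?t \<theta>) * sin \<theta> = (\<Sum>j\<le>N. g j * sin (real (Suc j) * \<theta>))" for \<theta>
    unfolding f poly_sum sum_distrib_right poly_smult mult.assoc cheb_trig(2) ..
  have "((\<lambda>\<theta>. (sin \<theta> / 2) *\<^sub>R poly (f * f) (?t \<theta>)) has_integral
      (integral {?t 0..?t pi} (poly (f * f)))) {0..pi}"
  proof (rule has_integral_substitution)
    have "0 \<le> ?t \<theta>" "?t \<theta> \<le> 1" for \<theta>
      using cos_ge_minus_one[of \<theta>] cos_le_one[of \<theta>] by simp_all
    then show "?t ` {0..pi} \<subseteq> {?t 0..?t pi}" by auto
    show "continuous_on {?t 0..?t pi} (poly (f * f))" by (intro continuous_intros)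
    show "(?t has_real_derivative sin x / 2) (at x within {0..pi})" for x
      by (auto intro!: derivative_eq_intros)
  qed auto
  then have sub: "((\<lambda>\<theta>. (sin \<theta> / 2) * poly (f * f) (?t \<theta>)) has_integral
      (integral {0..1} (poly (f * f)))) {0..pi}" by simp
  have sq: "((\<lambda>\<theta>. (1/2) * (\<Sum>j\<le>N. g j * sin (real (Suc j) * \<theta>))\<^sup>2) has_integral
      ((1/2) * (pi / 2 * (\<Sum>j\<le>N. (g j)\<^sup>2)))) {0..pi}"
    by (intro has_integral_mult_right integral_sine_polynomial_square)
  have "(1/2) * (pi / 2 * (\<Sum>j\<le>N. (g j)\<^sup>2)) \<le> integral {0..1} (poly (f * f))"
  proof (rule has_integral_le[OF sq sub])
    fix \<theta> assume \<theta>: "\<theta> \<in> {0..pi}"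
    then have s: "0 \<le> sin \<theta>" by (auto intro: sin_ge_zero)
    then have "sin \<theta> * sin \<theta> \<le> sin \<theta>" by (simp add: mult_left_le)
    then have "(sin \<theta> * sin \<theta>) * (poly f (?t \<theta>))\<^sup>2 \<le> sin \<theta> * (poly f (?t \<theta>))\<^sup>2"
      by (rule mult_right_mono) simp
    then show "(1/2) * (\<Sum>j\<le>N. g j * sin (real (Suc j) * \<theta>))\<^sup>2 \<le> sin \<theta> / 2 * poly (f * f) (?t \<theta>)"
      unfolding sine[symmetric] by (simp add: power2_eq_square mult_ac)
  qed
  moreover have "(\<Sum>j\<le>N. (g j)\<^sup>2) \<le> pi / 2 * (\<Sum>j\<le>N. (g j)\<^sup>2)"
    using pi_ge_two mult_right_mono[of 1 "pi / 2" "\<Sum>j\<le>N. (g j)\<^sup>2"] by (simp add: sum_nonneg)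
  ultimately show ?thesis by simp
qed

lemma has_integral_monomial:
  "((\<lambda>x::real. x ^ i) has_integral 1 / (real i + 1)) {0..1}"
proof -
  have "((\<lambda>x::real. x ^ i) has_integral 1 ^ Suc i / (real i + 1) - 0 ^ Suc i / (real i + 1)) {0..1}"
  proof (rule fundamental_theorem_of_calculus)
    fix x :: real
    have "((\<lambda>x. x ^ Suc i / (real i + 1)) has_real_derivative (real (Suc i) * x ^ i) / (real i + 1))
        (at x within {0..1})"
      using DERIV_cdivide[OF DERIV_pow[of "Suc i"]] by simp
    moreover have "(real (Suc i) * x ^ i) / (real i + 1) = x ^ i" by (simp add: add.commute)
    ultimately show "((\<lambda>x. x ^ Suc i / (real i + 1)) has_vector_derivative x ^ i) (at x within {0..1})"
      by (simp only: has_real_derivative_iff_has_vector_derivative)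
  qed simp
  then show ?thesis by simp
qed

lemma integral_poly:
  fixes f :: "real poly"
  assumes "degree f \<le> N"
  shows "integral {0..1} (poly f) = (\<Sum>i\<le>N. coeff f i / (real i + 1))"
proof -
  have "((\<lambda>x. \<Sum>i\<le>degree f. coeff f i * x ^ i) has_integral (\<Sum>i\<le>degree f. coeff f i * (1 / (real i + 1)))) {0..1}"
    by (intro has_integral_sum has_integral_mult_right has_integral_monomial) simp
  then have "integral {0..1} (poly f) = (\<Sum>i\<le>degree f. coeff f i / (real i + 1))"
    by (simp add: integral_unique poly_altdef[abs_def])
  also have "\<dots> = (\<Sum>i\<le>N. coeff f i / (real i + 1))"
    using assms by (intro sum.mono_neutral_left) (auto simp: coeff_eq_0)
  finally show ?thesis .
qed

text \<open>The Beta integral. The derivative of (1 - t)^(p+1) t^(k+1) integrates to zero, which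
  trades a factor t for a factor 1 - t. The binomial in the denominator will cancel one of the two
  binomials in the moment relation.\<close>

lemma integral_power_power:
  "integral {0..1} (\<lambda>t::real. (1 - t) ^ p * t ^ k) = 1 / (real (p + k + 1) * real ((p + k) choose k))"
proof (induction p arbitrary: k)
  case 0
  show ?case using integral_unique[OF has_integral_monomial[of k]] by simp
next
  case (Suc p)
  let ?F = "\<lambda>t::real. (1 - t) ^ Suc p * t ^ Suc k"
  have "((\<lambda>t. real (Suc k) * ((1 - t) ^ Suc p * t ^ k) - real (Suc p) * ((1 - t) ^ p * t ^ Suc k)) has_integral ?F 1 - ?F 0) {0..1}"
  proof (rule fundamental_theorem_of_calculus)
    fix x :: real
    have "(?F has_real_derivative real (Suc k) * ((1 - x) ^ Suc p * x ^ k) - real (Suc p) * ((1 - x) ^ p * x ^ Suc k))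
       (at x within {0..1})"
      by (rule derivative_eq_intros refl | simp add: algebra_simps del: of_nat_Suc power_Suc)+
    then show "(?F has_vector_derivative real (Suc k) * ((1 - x) ^ Suc p * x ^ k) - real (Suc p) * ((1 - x) ^ p * x ^ Suc k))
       (at x within {0..1})"
      by (simp add: has_real_derivative_iff_has_vector_derivative)
  qed simp
  moreover have "((\<lambda>t. real (Suc k) * ((1 - t) ^ Suc p * t ^ k) - real (Suc p) * ((1 - t) ^ p * t ^ Suc k)) has_integral
      real (Suc k) * integral {0..1} (\<lambda>t. (1 - t) ^ Suc p * t ^ k)
        - real (Suc p) * integral {0..1} (\<lambda>t. (1 - t) ^ p * t ^ Suc k)) {0..1}"
    by (intro has_integral_diff has_integral_mult_right integrable_integral integrable_continuous_interval continuous_intros)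
  ultimately have "real (Suc k) * integral {0..1} (\<lambda>t. (1 - t) ^ Suc p * t ^ k)
        - real (Suc p) * integral {0..1} (\<lambda>t. (1 - t) ^ p * t ^ Suc k) = ?F 1 - ?F 0"
    by (rule has_integral_unique[rotated])
  then have "real (Suc k) * integral {0..1} (\<lambda>t. (1 - t) ^ Suc p * t ^ k)
        = real (Suc p) * integral {0..1} (\<lambda>t. (1 - t) ^ p * t ^ Suc k)"
    by simp
  also have "\<dots> = real (Suc p) / (real (p + k + 2) * real ((Suc (p + k)) choose Suc k))"
    unfolding Suc by simp
  finally have "integral {0..1} (\<lambda>t. (1 - t) ^ Suc p * t ^ k) = real (Suc p) / (real (p + k + 2) * (real (Suc k) * real (Suc (p + k) choose Suc k)))"
    by (simp add: field_simps del: of_nat_Suc binomial_Suc_Suc)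
  moreover have "real (Suc k) * real (Suc (p + k) choose Suc k) = real (Suc p) * real (Suc (p + k) choose k)"
  proof -
    have "Suc k * (Suc (p + k) choose Suc k) = Suc p * (Suc (p + k) choose k)"
      using binomial_absorb_comp[of "Suc (p + k)" k] Suc_times_binomial[of k "p + k"]
      by (simp del: binomial_Suc_Suc)
    then show ?thesis by (metis of_nat_mult)
  qed
  ultimately show ?case by (simp add: add_ac del: of_nat_Suc)
qed

section \<open>Norms and square roots in unital C*-algebras\<close>

context unital_cstar_algebra
begin

lemma smult_closed' [simp, intro]: "x \<in> carrier A \<Longrightarrow> c \<odot> x \<in> carrier A"
  using smult_closed by (simp add: complex_ring_def)

lemma smult_add_left: "x \<in> carrier A \<Longrightarrow> (c + d) \<odot> x = c \<odot> x \<oplus> d \<odot> x"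
  using smult_l_distr by (simp add: complex_ring_def)

lemma smult_add_right:
  "x \<in> carrier A \<Longrightarrow> y \<in> carrier A \<Longrightarrow> c \<odot> (x \<oplus> y) = c \<odot> x \<oplus> c \<odot> y"
  using smult_r_distr by (simp add: complex_ring_def)

lemma smult_smult [simp]: "x \<in> carrier A \<Longrightarrow> c \<odot> (d \<odot> x) = (c * d) \<odot> x"
  using smult_assoc1 by (simp add: complex_ring_def)

lemma smult_1 [simp]: "x \<in> carrier A \<Longrightarrow> 1 \<odot> x = x"
  using smult_one by (simp add: complex_ring_def)

lemma smult_0 [simp]: "x \<in> carrier A \<Longrightarrow> 0 \<odot> x = \<zero>"
  using smult_l_null by (simp add: complex_ring_def)

lemma smult_zero [simp]: "c \<odot> \<zero> = \<zero>"
  using smult_r_null by (simp add: complex_ring_def)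

lemma minus_smult: "x \<in> carrier A \<Longrightarrow> \<ominus> x = (-1) \<odot> x"
  using smult_add_left[of x 1 "-1"] by (metis add.inv_equality add.inv_closed add.right_inverse
      a_comm complex_ring_def smult_1 smult_0 smult_closed' minus_equality add.inv_comm add_neg_numeral_special(7))

declare smult_mult_left [simp] smult_mult_right [simp] star_closed [simp, intro]
  star_star [simp] star_smult [simp] star_add [simp] star_mult [simp]

lemma star_zero [simp]: "\<zero>\<^sup>\<star> = \<zero>"
  using star_smult[of \<zero> 0] by simp

lemma star_one [simp]: "\<one>\<^sup>\<star> = \<one>"
  by (metis l_one one_closed r_one star_closed star_mult star_star)

lemma star_minus [simp]: "x \<in> carrier A \<Longrightarrow> (\<ominus> x)\<^sup>\<star> = \<ominus> x\<^sup>\<star>"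
  by (simp add: minus_smult)

lemma star_diff [simp]:
  "x \<in> carrier A \<Longrightarrow> y \<in> carrier A \<Longrightarrow> (x \<ominus> y)\<^sup>\<star> = x\<^sup>\<star> \<ominus> y\<^sup>\<star>"
  by (simp add: a_minus_def)

lemma star_pow [simp]: "x \<in> carrier A \<Longrightarrow> (x [^] (n::nat))\<^sup>\<star> = x\<^sup>\<star> [^] n"
  by (induction n) (simp_all add: nat_pow_Suc2[symmetric] del: nat_pow_Suc)

lemma diff_smult: "x \<in> carrier A \<Longrightarrow> y \<in> carrier A \<Longrightarrow> x \<ominus> y = x \<oplus> (-1) \<odot> y"
  by (simp add: a_minus_def minus_smult)

lemma diff_zero_iff: "x \<in> carrier A \<Longrightarrow> y \<in> carrier A \<Longrightarrow> x \<ominus> y = \<zero> \<longleftrightarrow> x = y"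
  by (metis a_minus_def add.inv_closed add.inv_equality minus_minus r_neg)

lemma norm_zero_iff: "x \<in> carrier A \<Longrightarrow> \<parallel>x\<parallel> = 0 \<longleftrightarrow> x = \<zero>"
  using cstar_norm smult_0[of x] unfolding cstar_norm_on_def
  by (metis mult_zero_left norm_zero zero_closed smult_0)

lemma norm_zero' [simp]: "\<parallel>\<zero>\<parallel> = 0"
  using norm_zero_iff by blast

lemma norm_triangle: "x \<in> carrier A \<Longrightarrow> y \<in> carrier A \<Longrightarrow> \<parallel>x \<oplus> y\<parallel> \<le> \<parallel>x\<parallel> + \<parallel>y\<parallel>"
  using cstar_norm unfolding cstar_norm_on_def by blast

lemma norm_smult [simp]: "x \<in> carrier A \<Longrightarrow> \<parallel>c \<odot> x\<parallel> = cmod c * \<parallel>x\<parallel>"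
  using cstar_norm unfolding cstar_norm_on_def by blast

lemma norm_mult_le: "x \<in> carrier A \<Longrightarrow> y \<in> carrier A \<Longrightarrow> \<parallel>x \<otimes> y\<parallel> \<le> \<parallel>x\<parallel> * \<parallel>y\<parallel>"
  using cstar_norm unfolding cstar_norm_on_def by blast

lemma norm_star_mult: "x \<in> carrier A \<Longrightarrow> \<parallel>x\<^sup>\<star> \<otimes> x\<parallel> = \<parallel>x\<parallel>\<^sup>2"
  using cstar_norm unfolding cstar_norm_on_def by blast

lemma norm_minus [simp]: "x \<in> carrier A \<Longrightarrow> \<parallel>\<ominus> x\<parallel> = \<parallel>x\<parallel>"
  by (simp add: minus_smult)

lemma norm_nonneg [simp]: "x \<in> carrier A \<Longrightarrow> 0 \<le> \<parallel>x\<parallel>"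
  using norm_triangle[of x "\<ominus> x"] by (simp add: r_neg)

lemma norm_diff_triangle: "x \<in> carrier A \<Longrightarrow> y \<in> carrier A \<Longrightarrow> \<parallel>x \<ominus> y\<parallel> \<le> \<parallel>x\<parallel> + \<parallel>y\<parallel>"
  using norm_triangle[of x "\<ominus> y"] by (simp add: a_minus_def)

lemma norm_diff_commute: "x \<in> carrier A \<Longrightarrow> y \<in> carrier A \<Longrightarrow> \<parallel>x \<ominus> y\<parallel> = \<parallel>y \<ominus> x\<parallel>"
  using norm_minus[of "x \<ominus> y"] by (simp add: a_minus_def minus_add minus_minus a_comm)

lemma norm_diff_trans:
  assumes "x \<in> carrier A" "y \<in> carrier A" "z \<in> carrier A"
  shows "\<parallel>x \<ominus> z\<parallel> \<le> \<parallel>x \<ominus> y\<parallel> + \<parallel>y \<ominus> z\<parallel>"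
proof -
  have "x \<ominus> z = (x \<ominus> y) \<oplus> (y \<ominus> z)"
    using assms by algebra
  then show ?thesis using norm_triangle[of "x \<ominus> y" "y \<ominus> z"] assms by simp
qed

lemma norm_le_diff:
  assumes "x \<in> carrier A" "y \<in> carrier A"
  shows "\<parallel>x\<parallel> \<le> \<parallel>x \<ominus> y\<parallel> + \<parallel>y\<parallel>"
  using norm_diff_trans[of x y \<zero>] assms by (simp add: a_minus_def)

lemma norm_star [simp]:
  assumes "x \<in> carrier A" shows "\<parallel>x\<^sup>\<star>\<parallel> = \<parallel>x\<parallel>"
proof -
  have le: "\<parallel>y\<parallel> \<le> \<parallel>y\<^sup>\<star>\<parallel>" if "y \<in> carrier A" for y
  proof (cases "\<parallel>y\<parallel> = 0")
    case False
    have "\<parallel>y\<parallel> * \<parallel>y\<parallel> \<le> \<parallel>y\<^sup>\<star>\<parallel> * \<parallel>y\<parallel>"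
      using norm_star_mult[OF that] norm_mult_le[of "y\<^sup>\<star>" y] that by (simp add: power2_eq_square)
    then show ?thesis
      using False norm_nonneg[OF that] by (simp add: less_le)
  qed (use that in simp)
  from le[of x] le[of "x\<^sup>\<star>"] assms show ?thesis by simp
qed

text \<open>Only an inequality, because in the zero algebra the unit has norm 0.\<close>

lemma norm_one_le: "\<parallel>\<one>\<parallel> \<le> 1"
  using norm_star_mult[of \<one>] by (auto simp add: power2_eq_square)

lemma norm_mult_le': 
  "x \<in> carrier A \<Longrightarrow> y \<in> carrier A \<Longrightarrow> \<parallel>x\<parallel> \<le> r \<Longrightarrow> \<parallel>y\<parallel> \<le> s \<Longrightarrow> \<parallel>x \<otimes> y\<parallel> \<le> r * s"
  by (meson mult_mono norm_mult_le norm_nonneg order_trans)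

lemma norm_pow_le: "x \<in> carrier A \<Longrightarrow> \<parallel>x [^] (n::nat)\<parallel> \<le> \<parallel>x\<parallel> ^ n"
proof (induction n)
  case 0 then show ?case using norm_one_le by simp
next
  case (Suc n)
  then show ?case using norm_mult_le'[of "x [^] n" x "\<parallel>x\<parallel> ^ n" "\<parallel>x\<parallel>"] by (simp add: mult.commute)
qed

lemma norm_selfadjoint_square:
  "x \<in> carrier A \<Longrightarrow> x\<^sup>\<star> = x \<Longrightarrow> \<parallel>x \<otimes> x\<parallel> = \<parallel>x\<parallel>\<^sup>2"
  using norm_star_mult[of x] by simp

text \<open>Repeated squaring with the C*-identity reaches exactly the exponents 2^n; later
  arguments with large powers choose exponents of this form.\<close>

lemma norm_selfadjoint_pow:
  assumes "x \<in> carrier A" "x\<^sup>\<star> = x"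
  shows "\<parallel>x [^] ((2::nat) ^ n)\<parallel> = \<parallel>x\<parallel> ^ (2 ^ n)"
proof (induction n)
  case (Suc n)
  have "x [^] ((2::nat) ^ Suc n) = x [^] ((2::nat) ^ n) \<otimes> x [^] ((2::nat) ^ n)"
    using assms by (simp add: nat_pow_mult mult_2)
  then show ?case
    using Suc assms norm_selfadjoint_square[of "x [^] ((2::nat) ^ n)"]
    by (simp add: power_mult[symmetric] mult.commute)
qed (use assms in simp)

text \<open>The fixed point \<open>w\<close> of \<open>w \<mapsto> (y + w\<^sup>2) / 2\<close> satisfies \<open>(1 - w)\<^sup>2 = 1 - y\<close>, so
  square roots need no functional calculus.\<close>

lemma sqrt_one_minus:
  assumes y: "y \<in> carrier A" "y\<^sup>\<star> = y" "\<parallel>y\<parallel> < 1"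
  obtains k where "k \<in> carrier A" "k\<^sup>\<star> = k" "k \<otimes> k = \<one> \<ominus> y"
    "\<And>g. g \<in> carrier A \<Longrightarrow> g \<otimes> y = y \<otimes> g \<Longrightarrow> g \<otimes> k = k \<otimes> g"
proof -
  define \<rho> where "\<rho> = \<parallel>y\<parallel>"
  have \<rho>: "0 \<le> \<rho>" "\<rho> < 1" using y by (simp_all add: \<rho>_def)
  define F where "F = (\<lambda>w. (1/2) \<odot> (y \<oplus> w \<otimes> w))"
  define s where "s = (\<lambda>n::nat. (F ^^ n) \<zero>)"
  have s_Suc: "s (Suc n) = F (s n)" for n by (simp add: s_def)
  have F_closed: "w \<in> carrier A \<Longrightarrow> F w \<in> carrier A" for w
    using y by (simp add: F_def)
  have s_closed [simp]: "s n \<in> carrier A" for n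
    by (induction n) (use F_closed in \<open>auto simp: s_Suc\<close>, simp add: s_def)
  have s_star: "(s n)\<^sup>\<star> = s n" for n
    by (induction n) (use y in \<open>auto simp: s_Suc F_def\<close>, simp add: s_def)
  have s_norm: "\<parallel>s n\<parallel> \<le> \<rho>" for n
  proof (induction n)
    case (Suc n)
    have "\<parallel>y \<oplus> s n \<otimes> s n\<parallel> \<le> \<rho> + \<rho> * \<rho>"
      using norm_triangle[of y "s n \<otimes> s n"] norm_mult_le'[of "s n" "s n" \<rho> \<rho>] Suc y
      by (simp add: \<rho>_def)
    also have "\<rho> * \<rho> \<le> \<rho>" using \<rho> by (simp add: mult_left_le)
    finally show ?case using y by (simp add: s_Suc F_def norm_divide)
  qed (simp add: s_def \<rho>)
  \<comment> \<open>The difference of squares is split as v (v - w) + (v - w) w, which needs no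
    commutation; on the ball of radius \<rho> < 1 the map is then a contraction with constant
    \<rho>.\<close>
  have F_lip: "\<parallel>F v \<ominus> F w\<parallel> \<le> \<rho> * \<parallel>v \<ominus> w\<parallel>"
    if "v \<in> carrier A" "w \<in> carrier A" "\<parallel>v\<parallel> \<le> \<rho>" "\<parallel>w\<parallel> \<le> \<rho>" for v w
  proof -
    have "F v \<ominus> F w = (1/2) \<odot> ((y \<oplus> v \<otimes> v) \<ominus> (y \<oplus> w \<otimes> w))"
      using y that by (simp add: F_def diff_smult smult_add_right)
    also have "(y \<oplus> v \<otimes> v) \<ominus> (y \<oplus> w \<otimes> w) = v \<otimes> (v \<ominus> w) \<oplus> (v \<ominus> w) \<otimes> w"
      using y that by algebra
    finally have "\<parallel>F v \<ominus> F w\<parallel> = \<parallel>v \<otimes> (v \<ominus> w) \<oplus> (v \<ominus> w) \<otimes> w\<parallel> / 2"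
      using that by (simp add: norm_divide)
    also have "\<dots> \<le> (\<rho> * \<parallel>v \<ominus> w\<parallel> + \<parallel>v \<ominus> w\<parallel> * \<rho>) / 2"
      using norm_triangle[of "v \<otimes> (v \<ominus> w)" "(v \<ominus> w) \<otimes> w"]
        norm_mult_le'[of v "v \<ominus> w" \<rho> "\<parallel>v \<ominus> w\<parallel>"]
        norm_mult_le'[of "v \<ominus> w" w "\<parallel>v \<ominus> w\<parallel>" \<rho>] that
      by (simp add: mult.commute)
    finally show ?thesis by (simp add: mult.commute)
  qed
  \<comment> \<open>At n = 0 both points lie in the ball of radius \<rho>, and each application of
    \<open>F\<close> to the pair gains a factor \<rho>; this gives the Cauchy property without
    summing a geometric series.\<close>
  have step: "\<parallel>s n \<ominus> s (n + k)\<parallel> \<le> 2 * \<rho> ^ Suc n" for n k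
  proof (induction n)
    case 0
    show ?case using norm_diff_triangle[of "s 0" "s k"] s_norm[of 0] s_norm[of k] by simp
  next
    case (Suc n)
    have "\<parallel>s (Suc n) \<ominus> s (Suc n + k)\<parallel> \<le> \<rho> * \<parallel>s n \<ominus> s (n + k)\<parallel>"
      using F_lip[OF s_closed s_closed s_norm s_norm] by (simp add: s_Suc)
    also have "\<dots> \<le> \<rho> * (2 * \<rho> ^ Suc n)" using Suc \<rho> by (intro mult_left_mono) auto
    finally show ?case by simp
  qed
  have lim0: "(\<lambda>n. 2 * \<rho> ^ Suc n) \<longlonglongrightarrow> 0"
    using LIMSEQ_power_zero[of \<rho>] \<rho> by (auto intro!: tendsto_mult_right_zero LIMSEQ_Suc)
  have cauchy: "\<forall>e>0. \<exists>N. \<forall>m\<ge>N. \<forall>n\<ge>N. \<parallel>s m \<ominus> s n\<parallel> < e"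
  proof (intro allI impI)
    fix e :: real assume "e > 0"
    then obtain N where N: "\<And>n. n \<ge> N \<Longrightarrow> norm (2 * \<rho> ^ Suc n - 0) < e"
      using LIMSEQ_D[OF lim0] by blast
    have "\<parallel>s m \<ominus> s (m + k)\<parallel> < e" if "m \<ge> N" for m k
      using step[of m k] N[OF that] by (simp add: \<rho>(1))
    then have "\<parallel>s m \<ominus> s n\<parallel> < e" if "m \<ge> N" "n \<ge> N" for m n
      using that norm_diff_commute[of "s m" "s n"] by (metis le_add_diff_inverse nat_le_linear s_closed)
    then show "\<exists>N. \<forall>m\<ge>N. \<forall>n\<ge>N. \<parallel>s m \<ominus> s n\<parallel> < e" by blast
  qed
  have "range s \<subseteq> carrier A" by auto
  from complete[OF this cauchy]
  obtain w where w: "w \<in> carrier A" and lim: "(\<lambda>n. \<parallel>s n \<ominus> w\<parallel>) \<longlonglongrightarrow> 0"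
    by blast
  \<comment> \<open>The shift \<open>m\<close> serves two uses: m = 0 shows that the adjoint of
    \<open>w\<close> is also the limit, m = 1 that \<open>F w\<close> is.\<close>
  have lim_unique: "v = w" if "v \<in> carrier A" "\<And>n. \<parallel>s (n + m) \<ominus> v\<parallel> \<le> K * \<parallel>s n \<ominus> w\<parallel>" for v K m
  proof -
    have "\<parallel>v \<ominus> w\<parallel> \<le> K * \<parallel>s n \<ominus> w\<parallel> + \<parallel>s (n + m) \<ominus> w\<parallel>" for n
      using norm_diff_trans[of v "s (n + m)" w] that(2)[of n] that(1) w norm_diff_commute[of v "s (n + m)"]
      by simp
    moreover have "(\<lambda>n. K * \<parallel>s n \<ominus> w\<parallel> + \<parallel>s (n + m) \<ominus> w\<parallel>) \<longlonglongrightarrow> K * 0 + 0"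
      by (intro tendsto_intros lim LIMSEQ_ignore_initial_segment)
    ultimately have "\<parallel>v \<ominus> w\<parallel> \<le> 0"
      by (intro LIMSEQ_le_const[of "\<lambda>n. K * \<parallel>s n \<ominus> w\<parallel> + \<parallel>s (n + m) \<ominus> w\<parallel>"]) auto
    then show "v = w"
      using norm_zero_iff[of "v \<ominus> w"] that(1) w norm_nonneg[of "v \<ominus> w"]
      by (metis minus_closed order_antisym diff_zero_iff)
  qed
  have w_star: "w\<^sup>\<star> = w"
  proof (rule lim_unique[of _ 0 1])
    fix n
    have "\<parallel>s n \<ominus> w\<^sup>\<star>\<parallel> = \<parallel>(s n \<ominus> w)\<^sup>\<star>\<parallel>" using w by (simp add: s_star del: norm_star)
    also have "\<dots> = \<parallel>s n \<ominus> w\<parallel>" using w by (intro norm_star) simp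
    finally show "\<parallel>s (n + 0) \<ominus> w\<^sup>\<star>\<parallel> \<le> 1 * \<parallel>s n \<ominus> w\<parallel>" by simp
  qed (use w in simp)
  have w_norm: "\<parallel>w\<parallel> \<le> \<rho>"
  proof (rule LIMSEQ_le_const)
    show "(\<lambda>n. \<rho> + \<parallel>s n \<ominus> w\<parallel>) \<longlonglongrightarrow> \<rho>" using tendsto_add[OF tendsto_const lim, of \<rho>] by simp
    show "\<exists>N. \<forall>n\<ge>N. \<parallel>w\<parallel> \<le> \<rho> + \<parallel>s n \<ominus> w\<parallel>"
    proof (intro exI allI impI)
      fix n
      show "\<parallel>w\<parallel> \<le> \<rho> + \<parallel>s n \<ominus> w\<parallel>"
        using norm_le_diff[of w "s n"] s_norm[of n] w norm_diff_commute[of w "s n"] by simp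
    qed
  qed
  have fixp: "F w = w"
  proof (rule lim_unique[of _ 1 \<rho>])
    fix n show "\<parallel>s (n + 1) \<ominus> F w\<parallel> \<le> \<rho> * \<parallel>s n \<ominus> w\<parallel>"
      using F_lip[OF s_closed w s_norm w_norm, of n] by (simp add: s_Suc)
  qed (use w F_closed in simp)
  have sq: "(\<one> \<ominus> w) \<otimes> (\<one> \<ominus> w) = \<one> \<ominus> y"
  proof -
    have "w \<oplus> w = 2 \<odot> w" using w smult_add_left[of w 1 1] by simp
    also have "\<dots> = 2 \<odot> F w" using fixp by simp
    also have "\<dots> = y \<oplus> w \<otimes> w" using w y by (simp add: F_def)
    finally have "\<one> \<ominus> (w \<oplus> w) \<oplus> w \<otimes> w = \<one> \<ominus> y" using w y by algebra
    moreover have "(\<one> \<ominus> w) \<otimes> (\<one> \<ominus> w) = \<one> \<ominus> (w \<oplus> w) \<oplus> w \<otimes> w" using w by (algebra, simp)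
    ultimately show ?thesis by simp
  qed
  have comm: "g \<otimes> w = w \<otimes> g" if g: "g \<in> carrier A" "g \<otimes> y = y \<otimes> g" for g
  proof -
    have sg: "g \<otimes> s n = s n \<otimes> g" for n
    proof (induction n)
      case (Suc n)
      have "g \<otimes> (s n \<otimes> s n) = (s n \<otimes> s n) \<otimes> g"
        using Suc g by (metis m_assoc s_closed)
      then show ?case using g y by (simp add: s_Suc F_def r_distr l_distr)
    qed (use g in \<open>simp add: s_def\<close>)
    have "\<parallel>g \<otimes> w \<ominus> w \<otimes> g\<parallel> \<le> 2 * (\<parallel>g\<parallel> * \<parallel>s n \<ominus> w\<parallel>)" for n
    proof -
      \<comment> \<open>Since \<open>g\<close> commutes with every iterate, the commutator with
        \<open>w\<close> can be written through \<open>s n \<ominus> w\<close>, which tends to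
        zero.\<close>
      have "g \<otimes> w \<ominus> w \<otimes> g = (s n \<ominus> w) \<otimes> g \<ominus> g \<otimes> (s n \<ominus> w)"
      proof -
        have "(s n \<ominus> w) \<otimes> g \<ominus> g \<otimes> (s n \<ominus> w) = (s n \<otimes> g \<ominus> g \<otimes> s n) \<oplus> (g \<otimes> w \<ominus> w \<otimes> g)"
          using g w s_closed[of n] by algebra
        then show ?thesis using g w by (simp add: sg diff_zero_iff)
      qed
      then show ?thesis
        using norm_diff_triangle[of "(s n \<ominus> w) \<otimes> g" "g \<otimes> (s n \<ominus> w)"]
          norm_mult_le[of "s n \<ominus> w" g] norm_mult_le[of g "s n \<ominus> w"] g w
        by (simp add: mult.commute)
    qed
    moreover have "(\<lambda>n. 2 * (\<parallel>g\<parallel> * \<parallel>s n \<ominus> w\<parallel>)) \<longlonglongrightarrow> 2 * (\<parallel>g\<parallel> * 0)"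
      by (intro tendsto_intros lim)
    ultimately have "\<parallel>g \<otimes> w \<ominus> w \<otimes> g\<parallel> \<le> 0"
      by (intro LIMSEQ_le_const[of "\<lambda>n. 2 * (\<parallel>g\<parallel> * \<parallel>s n \<ominus> w\<parallel>)"]) auto
    then show ?thesis
      using norm_zero_iff[of "g \<otimes> w \<ominus> w \<otimes> g"] g w norm_nonneg[of "g \<otimes> w \<ominus> w \<otimes> g"]
      by (metis m_closed minus_closed order_antisym diff_zero_iff)
  qed
  show ?thesis
  proof (rule that[of "\<one> \<ominus> w"])
    show "g \<otimes> (\<one> \<ominus> w) = (\<one> \<ominus> w) \<otimes> g" if "g \<in> carrier A" "g \<otimes> y = y \<otimes> g" for g
    proof -
      have "g \<otimes> (\<one> \<ominus> w) = g \<ominus> g \<otimes> w" "(\<one> \<ominus> w) \<otimes> g = g \<ominus> w \<otimes> g"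
        using that w by (simp_all add: a_minus_def r_distr l_distr r_minus l_minus)
      then show ?thesis using comm[OF that] by simp
    qed
  qed (use w sq w_star in auto)
qed

lemma add_eq_imp_diff:
  assumes "u \<in> carrier A" "v \<in> carrier A" "u \<oplus> v = w" shows "u = w \<ominus> v"
  unfolding assms(3)[symmetric] using assms(1,2) by algebra

text \<open>The element w = x + i k satisfies \<open>w\<^sup>\<star> \<otimes> w = t\<close>, so its
  norm is at most the square root of t, and x is its real part.\<close>

lemma norm_le_of_sum_squares:
  assumes x: "x \<in> carrier A" "x\<^sup>\<star> = x" and k: "k \<in> carrier A" "k\<^sup>\<star> = k"
    and comm: "x \<otimes> k = k \<otimes> x" and sum: "x \<otimes> x \<oplus> k \<otimes> k = of_real t \<odot> \<one>" and t: "t \<ge> 0"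
  shows "\<parallel>x\<parallel>\<^sup>2 \<le> t"
proof -
  define w where "w = x \<oplus> \<i> \<odot> k"
  have w [simp]: "w \<in> carrier A" using x k by (simp add: w_def)
  have ws: "w\<^sup>\<star> = x \<oplus> (- \<i>) \<odot> k" using x k by (simp add: w_def)
  have "w\<^sup>\<star> \<otimes> w = x \<otimes> x \<oplus> k \<otimes> k \<oplus> (\<i> \<odot> (x \<otimes> k) \<oplus> (-\<i>) \<odot> (x \<otimes> k))"
    unfolding ws unfolding w_def using x k comm by (simp add: r_distr l_distr a_ac smult_add_right)
  also have "\<i> \<odot> (x \<otimes> k) \<oplus> (-\<i>) \<odot> (x \<otimes> k) = \<zero>"
    using x k by (simp flip: smult_add_left)
  finally have "w\<^sup>\<star> \<otimes> w = of_real t \<odot> \<one>" using x k sum by simp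
  then have "\<parallel>w\<parallel>\<^sup>2 = t * \<parallel>\<one>\<parallel>" using norm_star_mult[OF w] t by simp
  also have "\<dots> \<le> t * 1" using norm_one_le t by (intro mult_left_mono) auto
  finally have wt: "\<parallel>w\<parallel>\<^sup>2 \<le> t" by simp
  have "w \<oplus> w\<^sup>\<star> = (x \<oplus> x) \<oplus> (\<i> \<odot> k \<oplus> (-\<i>) \<odot> k)"
    unfolding ws unfolding w_def using x k by (simp add: a_ac)
  also have "\<i> \<odot> k \<oplus> (-\<i>) \<odot> k = \<zero>" using k by (simp flip: smult_add_left)
  also have "x \<oplus> x = 2 \<odot> x" using x smult_add_left[of x 1 1] by simp
  finally have "\<parallel>2 \<odot> x\<parallel> \<le> 2 * \<parallel>w\<parallel>" using norm_triangle[of w "w\<^sup>\<star>"] x by simp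
  then have "\<parallel>x\<parallel> \<le> \<parallel>w\<parallel>" using x by simp
  then have "\<parallel>x\<parallel>\<^sup>2 \<le> \<parallel>w\<parallel>\<^sup>2" using x by (simp add: power_mono)
  with wt show ?thesis by simp
qed

lemma sqrt_const_minus:
  assumes y: "y \<in> carrier A" "y\<^sup>\<star> = y" "\<parallel>y\<parallel> < t"
  obtains k where "k \<in> carrier A" "k\<^sup>\<star> = k" "k \<otimes> k = of_real t \<odot> \<one> \<ominus> y"
    "\<And>g. g \<in> carrier A \<Longrightarrow> g \<otimes> y = y \<otimes> g \<Longrightarrow> g \<otimes> k = k \<otimes> g"
proof -
  have t: "t > 0" using y norm_nonneg[of y] by linarith
  define y' where "y' = of_real (1/t) \<odot> y"
  have y': "y' \<in> carrier A" "y'\<^sup>\<star> = y'" "\<parallel>y'\<parallel> < 1" "y = of_real t \<odot> y'"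
    using y t by (simp_all add: y'_def norm_divide)
  obtain k where k: "k \<in> carrier A" "k\<^sup>\<star> = k" "k \<otimes> k = \<one> \<ominus> y'"
    "\<And>g. g \<in> carrier A \<Longrightarrow> g \<otimes> y' = y' \<otimes> g \<Longrightarrow> g \<otimes> k = k \<otimes> g"
    using sqrt_one_minus[OF y'(1-3)] by metis
  show ?thesis
  proof (rule that[of "of_real (sqrt t) \<odot> k"])
    have "complex_of_real (sqrt t) * complex_of_real (sqrt t) = complex_of_real t"
      using t by (simp flip: of_real_mult)
    then show "of_real (sqrt t) \<odot> k \<otimes> (of_real (sqrt t) \<odot> k) = of_real t \<odot> \<one> \<ominus> y"
      unfolding y'(4) using k(1,3) y'(1) by (simp add: diff_smult smult_add_right)
    show "g \<otimes> (of_real (sqrt t) \<odot> k) = of_real (sqrt t) \<odot> k \<otimes> g"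
      if "g \<in> carrier A" "g \<otimes> y = y \<otimes> g" for g
      using that k(4)[OF that(1)] k(1) y(1) by (simp add: y'_def)
  qed (use k(1,2) in auto)
qed

text \<open>The difference is k^2 for a self-adjoint k commuting with z, and k^2 + z^2 = t bounds k
  by the preceding estimate.\<close>

lemma norm_const_minus_square:
  assumes z: "z \<in> carrier A" "z\<^sup>\<star> = z" "\<parallel>z\<parallel>\<^sup>2 < t"
  shows "\<parallel>of_real t \<odot> \<one> \<ominus> z \<otimes> z\<parallel> \<le> t"
proof -
  have t: "t > 0" using z by (meson not_le order_le_less_trans zero_le_power2)
  have "\<parallel>z \<otimes> z\<parallel> < t" using z norm_selfadjoint_square by simp
  then obtain k where k: "k \<in> carrier A" "k\<^sup>\<star> = k" "k \<otimes> k = of_real t \<odot> \<one> \<ominus> z \<otimes> z"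
    "\<And>g. g \<in> carrier A \<Longrightarrow> g \<otimes> (z \<otimes> z) = (z \<otimes> z) \<otimes> g \<Longrightarrow> g \<otimes> k = k \<otimes> g"
    using sqrt_const_minus[of "z \<otimes> z" t] z by (metis m_closed star_mult)
  have comm: "k \<otimes> z = z \<otimes> k" using k(4)[of z] z by (simp add: m_assoc)
  have sum: "k \<otimes> k \<oplus> z \<otimes> z = of_real t \<odot> \<one>"
  proof -
    have "of_real t \<odot> \<one> \<in> carrier A" by simp
    then show ?thesis unfolding k(3) using z(1) by algebra
  qed
  have "\<parallel>k\<parallel>\<^sup>2 \<le> t"
    by (rule norm_le_of_sum_squares[OF k(1,2) z(1,2) comm sum]) (use t in simp)
  then show ?thesis using norm_selfadjoint_square[OF k(1,2)] k(3) by simp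
qed

text \<open>Here x is not assumed to commute with y, so x + i y cannot be used. Normality gives 1 -
  x^2 = y1^2 + y2^2 with the real and imaginary parts of y. For large \<tau>, the element X = 2
  \<tau> - 1 + x^2 is the sum of \<tau> - y1^2 and \<tau> - y2^2 and has norm at most 2 \<tau>.
  Therefore 2 \<tau> + e - X = 1 + e - x^2 is the square of an element that commutes with x, and the
  commuting case applies. In effect this proves that a sum of two squares is positive.\<close>

lemma norm_le_one_of_sum_squares:
  assumes x: "x \<in> carrier A" "x\<^sup>\<star> = x" and y: "y \<in> carrier A" "y \<otimes> y\<^sup>\<star> = y\<^sup>\<star> \<otimes> y"
    and sum: "x \<otimes> x \<oplus> y\<^sup>\<star> \<otimes> y = \<one>"
  shows "\<parallel>x\<parallel> \<le> 1"
proof -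
  define y1 where "y1 = (1/2) \<odot> (y \<oplus> y\<^sup>\<star>)"
  define y2 where "y2 = (-\<i>/2) \<odot> (y \<ominus> y\<^sup>\<star>)"
  have y12 [simp]: "y1 \<in> carrier A" "y2 \<in> carrier A" using y by (simp_all add: y1_def y2_def)
  have y1s: "y1\<^sup>\<star> = y1" using y by (simp add: y1_def a_ac)
  have y2s: "y2\<^sup>\<star> = y2" using y by (simp add: y2_def diff_smult smult_add_right a_ac)
  have "y1 \<otimes> y1 \<oplus> y2 \<otimes> y2 = (1/4) \<odot> ((y \<oplus> y\<^sup>\<star>) \<otimes> (y \<oplus> y\<^sup>\<star>) \<ominus> (y \<ominus> y\<^sup>\<star>) \<otimes> (y \<ominus> y\<^sup>\<star>))"
  proof -
    have "y1 \<otimes> y1 = (1/4) \<odot> ((y \<oplus> y\<^sup>\<star>) \<otimes> (y \<oplus> y\<^sup>\<star>))"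
      unfolding y1_def using y by simp
    moreover have "y2 \<otimes> y2 = (-1/4) \<odot> ((y \<ominus> y\<^sup>\<star>) \<otimes> (y \<ominus> y\<^sup>\<star>))"
      unfolding y2_def using y by simp
    ultimately show ?thesis using y
      by (simp add: diff_smult[of "(y \<oplus> y\<^sup>\<star>) \<otimes> (y \<oplus> y\<^sup>\<star>)"] smult_add_right)
  qed
  also have "(y \<oplus> y\<^sup>\<star>) \<otimes> (y \<oplus> y\<^sup>\<star>) \<ominus> (y \<ominus> y\<^sup>\<star>) \<otimes> (y \<ominus> y\<^sup>\<star>)
      = (y \<otimes> y\<^sup>\<star> \<oplus> y\<^sup>\<star> \<otimes> y) \<oplus> (y \<otimes> y\<^sup>\<star> \<oplus> y\<^sup>\<star> \<otimes> y)"
    using y(1) star_closed[OF y(1)] by algebra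
  also have "\<dots> = 4 \<odot> (y\<^sup>\<star> \<otimes> y)"
    using y smult_add_left[of "y\<^sup>\<star> \<otimes> y" 1 1] smult_add_left[of "y\<^sup>\<star> \<otimes> y" 2 2] by simp
  finally have yy: "y\<^sup>\<star> \<otimes> y = y1 \<otimes> y1 \<oplus> y2 \<otimes> y2" using y by simp
  \<comment> \<open>Any number above both squared norms will do; \<tau> cancels in the end.\<close>
  define \<tau> where "\<tau> = \<parallel>y1\<parallel>\<^sup>2 + \<parallel>y2\<parallel>\<^sup>2 + 1"
  have \<tau>: "\<parallel>y1\<parallel>\<^sup>2 < \<tau>" "\<parallel>y2\<parallel>\<^sup>2 < \<tau>" by (simp_all add: \<tau>_def add_pos_nonneg add_nonneg_pos)
  let ?X = "of_real (2*\<tau> - 1) \<odot> \<one> \<oplus> x \<otimes> x"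
  have X_eq: "?X = (of_real \<tau> \<odot> \<one> \<ominus> y1 \<otimes> y1) \<oplus> (of_real \<tau> \<odot> \<one> \<ominus> y2 \<otimes> y2)"
  proof -
    define s where "s = of_real \<tau> \<odot> \<one>"
    have s: "s \<in> carrier A" by (simp add: s_def)
    have "of_real (2*\<tau> - 1) \<odot> \<one> = s \<oplus> s \<ominus> \<one>"
      using smult_add_left[of \<one> "complex_of_real \<tau>" "complex_of_real \<tau>"]
        smult_add_left[of \<one> "2 * complex_of_real \<tau>" "-1"] by (simp add: s_def diff_smult)
    moreover have "x \<otimes> x = \<one> \<ominus> (y1 \<otimes> y1 \<oplus> y2 \<otimes> y2)"
    proof -
      show ?thesis unfolding yy[symmetric] using sum x(1) y(1) by (intro add_eq_imp_diff) auto
    qed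
    ultimately show ?thesis using s y12 unfolding s_def[symmetric] by algebra
  qed
  have "\<parallel>?X\<parallel> \<le> 2 * \<tau>"
    unfolding X_eq
    using norm_triangle[of "of_real \<tau> \<odot> \<one> \<ominus> y1 \<otimes> y1" "of_real \<tau> \<odot> \<one> \<ominus> y2 \<otimes> y2"]
      norm_const_minus_square[OF _ y1s \<tau>(1)] norm_const_minus_square[OF _ y2s \<tau>(2)] by simp
  then have "\<parallel>x\<parallel>\<^sup>2 \<le> 1 + e" if e: "e > 0" for e
  proof -
    have "\<parallel>?X\<parallel> < 2 * \<tau> + e" using \<open>\<parallel>?X\<parallel> \<le> 2 * \<tau>\<close> e by simp
    moreover have "?X \<in> carrier A" "?X\<^sup>\<star> = ?X" using x by simp_all
    ultimately obtain k where k: "k \<in> carrier A" "k\<^sup>\<star> = k"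
      "k \<otimes> k = of_real (2 * \<tau> + e) \<odot> \<one> \<ominus> ?X"
      "\<And>g. g \<in> carrier A \<Longrightarrow> g \<otimes> ?X = ?X \<otimes> g \<Longrightarrow> g \<otimes> k = k \<otimes> g"
      using sqrt_const_minus[of ?X "2 * \<tau> + e"] by metis
    have "x \<otimes> ?X = ?X \<otimes> x" using x by (simp add: r_distr l_distr m_assoc)
    then have comm: "x \<otimes> k = k \<otimes> x" using k(4) x by simp
    have sum': "x \<otimes> x \<oplus> k \<otimes> k = of_real (1 + e) \<odot> \<one>"
    proof -
      define s where "s = of_real (2 * \<tau> - 1) \<odot> \<one>"
      define s' where "s' = of_real (1 + e) \<odot> \<one>"
      have s: "s \<in> carrier A" "s' \<in> carrier A" by (simp_all add: s_def s'_def)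
      have "of_real (2 * \<tau> + e) \<odot> \<one> = s \<oplus> s'"
        unfolding s_def s'_def by (simp flip: smult_add_left)
      then show ?thesis unfolding k(3) s_def[symmetric] s'_def[symmetric] using s x(1) by algebra
    qed
    show ?thesis by (rule norm_le_of_sum_squares[OF x k(1,2) comm sum']) (use e in simp)
  qed
  then have "\<parallel>x\<parallel>\<^sup>2 \<le> 1" by (rule field_le_epsilon)
  then show ?thesis using power2_le_imp_le[of "\<parallel>x\<parallel>" 1] by simp
qed

end

section \<open>States: hermitian symmetry, null elements and boundedness\<close>

locale cstar_state = unital_cstar_algebra +
  fixes h :: "'a \<Rightarrow> complex"
  assumes state: "state A h"
begin

lemma h_add [simp]: "x \<in> carrier A \<Longrightarrow> y \<in> carrier A \<Longrightarrow> h (x \<oplus> y) = h x + h y"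
  using state unfolding state_def by blast

lemma h_smult [simp]: "x \<in> carrier A \<Longrightarrow> h (c \<odot> x) = c * h x"
  using state unfolding state_def by blast

lemma h_one [simp]: "h \<one> = 1"
  using state unfolding state_def by blast

lemma h_zero [simp]: "h \<zero> = 0"
  using h_smult[of \<zero> 0] by simp

lemma h_minus [simp]: "x \<in> carrier A \<Longrightarrow> h (\<ominus> x) = - h x"
  by (simp add: minus_smult)

lemma h_diff [simp]: "x \<in> carrier A \<Longrightarrow> y \<in> carrier A \<Longrightarrow> h (x \<ominus> y) = h x - h y"
  by (simp add: a_minus_def)

lemma h_pos: "x \<in> carrier A \<Longrightarrow> 0 \<le> Re (h (x\<^sup>\<star> \<otimes> x))"
  and h_real: "x \<in> carrier A \<Longrightarrow> Im (h (x\<^sup>\<star> \<otimes> x)) = 0"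
  using state unfolding state_def by blast+

lemma one_neq_zero: "\<one> \<noteq> \<zero>"
  using h_one h_zero by force

lemma norm_unit [simp]: "\<parallel>\<one>\<parallel> = 1"
  using norm_star_mult[of \<one>] one_neq_zero norm_zero_iff[of \<one>] by (auto simp: power2_eq_square)

lemma smult_one_eq_iff: "c \<odot> \<one> = d \<odot> \<one> \<longleftrightarrow> c = d"
proof
  assume "c \<odot> \<one> = d \<odot> \<one>"
  then have "h (c \<odot> \<one>) = h (d \<odot> \<one>)" by simp
  then show "c = d" by simp
qed simp

text \<open>Polarization: \<open>h\<close> is real on squares, so the imaginary parts for 1 + x and
  1 + i x determine h of the adjoint.\<close>

lemma h_star: assumes "x \<in> carrier A" shows "h (x\<^sup>\<star>) = cnj (h x)"
proof -
  have *: "(\<one> \<oplus> c \<odot> x)\<^sup>\<star> \<otimes> (\<one> \<oplus> c \<odot> x)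
      = (\<one> \<oplus> c \<odot> x) \<oplus> (cnj c \<odot> x\<^sup>\<star> \<oplus> (cnj c * c) \<odot> (x\<^sup>\<star> \<otimes> x))" for c
    using assms by (simp add: r_distr l_distr a_ac smult_add_right mult.commute)
  have "Im (c * h x + cnj c * h (x\<^sup>\<star>)) = 0" for c
  proof -
    have "Im (h ((\<one> \<oplus> c \<odot> x)\<^sup>\<star> \<otimes> (\<one> \<oplus> c \<odot> x))) = 0" using assms by (intro h_real) simp
    then show ?thesis using h_real[OF assms] assms unfolding * by (simp add: cmod_power2)
  qed
  from this[of 1] this[of \<i>] show ?thesis by (simp add: complex_eq_iff)
qed

lemma h_sesquilinear_nonneg:
  assumes "x \<in> carrier A" "y \<in> carrier A"
  shows "0 \<le> Re (h (x\<^sup>\<star> \<otimes> x)) - 2 * Re (cnj c * h (y\<^sup>\<star> \<otimes> x)) + (cmod c)\<^sup>2 * Re (h (y\<^sup>\<star> \<otimes> y))"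
proof -
  have eq: "h ((x \<oplus> (- c) \<odot> y)\<^sup>\<star> \<otimes> (x \<oplus> (- c) \<odot> y))
    = h (x\<^sup>\<star> \<otimes> x) - c * h (x\<^sup>\<star> \<otimes> y) - cnj c * h (y\<^sup>\<star> \<otimes> x) + cnj c * c * h (y\<^sup>\<star> \<otimes> y)"
    using assms by (simp add: r_distr l_distr algebra_simps)
  have eq2: "h (x\<^sup>\<star> \<otimes> y) = cnj (h (y\<^sup>\<star> \<otimes> x))"
    using h_star[of "y\<^sup>\<star> \<otimes> x"] assms by simp
  have "Re (h ((x \<oplus> (- c) \<odot> y)\<^sup>\<star> \<otimes> (x \<oplus> (- c) \<odot> y)))
     = Re (h (x\<^sup>\<star> \<otimes> x)) - 2 * Re (cnj c * h (y\<^sup>\<star> \<otimes> x)) + (cmod c)\<^sup>2 * Re (h (y\<^sup>\<star> \<otimes> y))"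
    unfolding eq eq2 cmod_power2 using h_real[OF assms(2)] by (simp add: algebra_simps power2_eq_square)
  then show ?thesis using h_pos[of "x \<oplus> (- c) \<odot> y"] assms by simp
qed

lemma h_null:
  assumes "x \<in> carrier A" "y \<in> carrier A" "h (x\<^sup>\<star> \<otimes> x) = 0"
  shows "h (y \<otimes> x) = 0"
proof (rule ccontr)
  define g where "g = h (y \<otimes> x)"
  define Y where "Y = Re (h (y \<otimes> y\<^sup>\<star>))"
  have Y: "Y \<ge> 0" using h_pos[of "y\<^sup>\<star>"] assms by (simp add: Y_def)
  \<comment> \<open>Testing positivity at c = s g, the gain is 2 s and the loss s^2 Y, both times
    |g|^2; this s makes s Y < 1 even when Y = 0.\<close>
  define s where "s = 1 / (1 + Y)"
  assume "h (y \<otimes> x) \<noteq> 0"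
  then have G: "(cmod g)\<^sup>2 > 0" by (simp add: g_def)
  have "0 \<le> - 2 * Re (cnj (of_real s * g) * g) + (cmod (of_real s * g))\<^sup>2 * Y"
    using h_sesquilinear_nonneg[of x "y\<^sup>\<star>" "of_real s * g"] assms by (simp add: Y_def g_def)
  also have "Re (cnj (of_real s * g) * g) = s * (cmod g)\<^sup>2"
    unfolding cmod_power2 by (simp add: power2_eq_square algebra_simps)
  also have "(cmod (of_real s * g))\<^sup>2 = s\<^sup>2 * (cmod g)\<^sup>2"
    by (simp add: norm_mult power_mult_distrib)
  finally have "0 \<le> (cmod g)\<^sup>2 * (s * (s * Y - 2))" by (simp add: algebra_simps power2_eq_square)
  then have "0 \<le> s * (s * Y - 2)" using G by (simp add: zero_le_mult_iff)
  moreover have "s > 0" "s * Y < 1" using Y by (simp_all add: s_def)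
  ultimately show False by (simp add: zero_le_mult_iff)
qed

text \<open>For t above the squared norm of x, the element \<open>t - x\<^sup>\<star>x\<close> is a
  square k^2, and positivity of \<open>h\<close> at k u gives the bound with t. Then t decreases to
  the squared norm.\<close>

lemma h_conj_le:
  assumes "x \<in> carrier A" "u \<in> carrier A"
  shows "Re (h (u\<^sup>\<star> \<otimes> (x\<^sup>\<star> \<otimes> x) \<otimes> u)) \<le> \<parallel>x\<parallel>\<^sup>2 * Re (h (u\<^sup>\<star> \<otimes> u))"
proof -
  let ?H = "Re (h (u\<^sup>\<star> \<otimes> u))"
  have le: "Re (h (u\<^sup>\<star> \<otimes> (x\<^sup>\<star> \<otimes> x) \<otimes> u)) \<le> t * ?H" if t: "\<parallel>x\<parallel>\<^sup>2 < t" for t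
  proof -
    have "\<parallel>x\<^sup>\<star> \<otimes> x\<parallel> < t" using t norm_star_mult assms by simp
    then obtain k where k: "k \<in> carrier A" "k\<^sup>\<star> = k" "k \<otimes> k = of_real t \<odot> \<one> \<ominus> x\<^sup>\<star> \<otimes> x"
      using sqrt_const_minus[of "x\<^sup>\<star> \<otimes> x" t] assms by (metis m_closed star_closed star_mult star_star)
    have "(k \<otimes> u)\<^sup>\<star> \<otimes> (k \<otimes> u) = u\<^sup>\<star> \<otimes> (k \<otimes> k) \<otimes> u"
      using assms k(1,2) by (simp add: m_assoc)
    also have "\<dots> = of_real t \<odot> (u\<^sup>\<star> \<otimes> u) \<ominus> u\<^sup>\<star> \<otimes> (x\<^sup>\<star> \<otimes> x) \<otimes> u"
      using assms unfolding k(3) by (simp add: diff_smult r_distr l_distr)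
    finally have "(k \<otimes> u)\<^sup>\<star> \<otimes> (k \<otimes> u) = of_real t \<odot> (u\<^sup>\<star> \<otimes> u) \<ominus> u\<^sup>\<star> \<otimes> (x\<^sup>\<star> \<otimes> x) \<otimes> u" .
    then show ?thesis using h_pos[of "k \<otimes> u"] assms k by simp
  qed
  have "Re (h (u\<^sup>\<star> \<otimes> (x\<^sup>\<star> \<otimes> x) \<otimes> u)) \<le> \<parallel>x\<parallel>\<^sup>2 * ?H + e" if "e > 0" for e
  proof -
    have H: "?H \<ge> 0" using h_pos assms by simp
    \<comment> \<open>The \<open>+ 1\<close> in the denominator covers the case
      \<open>?H = 0\<close>.\<close>
    have "Re (h (u\<^sup>\<star> \<otimes> (x\<^sup>\<star> \<otimes> x) \<otimes> u)) \<le> (\<parallel>x\<parallel>\<^sup>2 + e / (?H + 1)) * ?H"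
      using le[of "\<parallel>x\<parallel>\<^sup>2 + e / (?H + 1)"] that H by simp
    also have "\<dots> \<le> \<parallel>x\<parallel>\<^sup>2 * ?H + e"
      using that H by (simp add: field_simps)
    finally show ?thesis .
  qed
  then show ?thesis by (rule field_le_epsilon)
qed

lemma h_star_mult_le: "x \<in> carrier A \<Longrightarrow> Re (h (x\<^sup>\<star> \<otimes> x)) \<le> \<parallel>x\<parallel>\<^sup>2"
  using h_conj_le[of x \<one>] by simp

lemma h_bounded: assumes "x \<in> carrier A" shows "cmod (h x) \<le> \<parallel>x\<parallel>"
proof -
  have "Re (cnj (h x) * h x) = (cmod (h x))\<^sup>2"
    by (metis complex_norm_square mult.commute Re_complex_of_real of_real_power)
  then have "(cmod (h x))\<^sup>2 \<le> Re (h (x\<^sup>\<star> \<otimes> x))"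
    using h_sesquilinear_nonneg[of x \<one> "h x"] assms by simp
  also have "\<dots> \<le> \<parallel>x\<parallel>\<^sup>2" using h_star_mult_le assms .
  finally have "(cmod (h x))\<^sup>2 \<le> \<parallel>x\<parallel>\<^sup>2" .
  then show ?thesis using norm_nonneg[OF assms] by (rule power2_le_imp_le)
qed

end

text \<open>Writing x as the square of its root leaves one geometric factor for the new m and one
  for the induction hypothesis.\<close>

lemma power_times_power_tendsto_0:
  fixes x :: real
  assumes "0 \<le> x" "x < 1"
  shows "(\<lambda>m. real m ^ k * x ^ m) \<longlonglongrightarrow> 0"
  using assms
proof (induction k arbitrary: x)
  case 0
  then show ?case using LIMSEQ_power_zero[of x] by simp
next
  case (Suc k)
  have s: "0 \<le> sqrt x" "sqrt x < 1" using Suc.prems by simp_all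
  have "(\<lambda>m. (real m * sqrt x ^ m) * (real m ^ k * sqrt x ^ m)) \<longlonglongrightarrow> 0 * 0"
    using powser_times_n_limit_0[of "sqrt x"] s by (intro tendsto_mult Suc.IH) simp_all
  moreover have "(real m * sqrt x ^ m) * (real m ^ k * sqrt x ^ m) = real m ^ Suc k * x ^ m" for m
    using Suc.prems by (simp add: mult_ac flip: power_mult_distrib)
  ultimately show ?case by simp
qed

lemma exponential_beats_polynomial:
  fixes K Q :: real
  assumes "Q > 1" "K \<ge> 0" "c \<ge> 0"
  obtains m0 where "\<And>m. m \<ge> m0 \<Longrightarrow> K * (1 + real m * c) ^ k < Q ^ m"
proof -
  have "(\<lambda>m. K * (1 + c) ^ k * (real m ^ k * (1/Q) ^ m)) \<longlonglongrightarrow> K * (1 + c) ^ k * 0"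
    using assms by (intro tendsto_mult tendsto_const power_times_power_tendsto_0) auto
  then have "\<forall>\<^sub>F m in sequentially. K * (1 + c) ^ k * (real m ^ k * (1/Q) ^ m) < 1"
    by (rule order_tendstoD(2)) simp
  then obtain m0 where m0: "\<And>m. m \<ge> m0 \<Longrightarrow> K * (1 + c) ^ k * (real m ^ k * (1/Q) ^ m) < 1"
    by (auto simp: eventually_sequentially)
  \<comment> \<open>From m = 1 on, 1 + m c is at most (1 + c) m, which reduces the claim to a pure
    power of m.\<close>
  show ?thesis
  proof (rule that[of "max 1 m0"])
    fix m assume m: "m \<ge> max 1 m0"
    have "(1 + real m * c) ^ k \<le> ((1 + c) * real m) ^ k"
      using m assms by (intro power_mono) (simp_all add: algebra_simps)
    then have "K * (1 + real m * c) ^ k \<le> K * (1 + c) ^ k * real m ^ k"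
      using assms by (simp add: mult_left_mono power_mult_distrib mult.assoc)
    also have "\<dots> < Q ^ m"
      using m0[of m] m assms by (simp add: power_one_over divide_simps)
    finally show "K * (1 + real m * c) ^ k < Q ^ m" .
  qed
qed

section \<open>Rapid decay implies faithfulness\<close>

text \<open>An abstract form of the rapid decay property known from group C*-algebras:
  \<open>P M\<close> plays the role of the elements supported on words of length at most
  \<open>M\<close>, and \<open>decay\<close> bounds the norm by the L2-norm with a polynomial
  factor.\<close>

locale rapid_decay_state = cstar_state +
  fixes P :: "nat \<Rightarrow> 'a set" and K :: real and d :: nat
  assumes P_carrier: "P M \<subseteq> carrier A"
    and P_mult: "x \<in> P M \<Longrightarrow> y \<in> P N \<Longrightarrow> x \<otimes> y \<in> P (M + N)"
    and P_star: "x \<in> P M \<Longrightarrow> x\<^sup>\<star> \<in> P M"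
    and P_one: "\<one> \<in> P 0"
    and P_dense: "x \<in> carrier A \<Longrightarrow> e > 0 \<Longrightarrow> \<exists>M. \<exists>z\<in>P M. \<parallel>x \<ominus> z\<parallel> < e"
    and trace: "x \<in> carrier A \<Longrightarrow> y \<in> carrier A \<Longrightarrow> h (x \<otimes> y) = h (y \<otimes> x)"
    and K: "K \<ge> 0"
    and decay: "z \<in> P M \<Longrightarrow> \<parallel>z\<parallel>\<^sup>2 \<le> K * (1 + real M) ^ d * Re (h (z\<^sup>\<star> \<otimes> z))"
begin

lemma P_pow: "x \<in> P M \<Longrightarrow> x [^] (n::nat) \<in> P (n * M)"
proof (induction n)
  case 0 then show ?case using P_one by simp
next
  case (Suc n) then show ?case using P_mult[of "x [^] n" "n * M" x M] by (simp add: add.commute)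
qed

lemma h_null_two_sided:
  assumes "x \<in> carrier A" "u \<in> carrier A" "v \<in> carrier A" "h (x\<^sup>\<star> \<otimes> x) = 0"
  shows "h (u \<otimes> x \<otimes> v) = 0"
proof -
  have "h (u \<otimes> x \<otimes> v) = h (v \<otimes> (u \<otimes> x))" using assms by (intro trace) auto
  also have "\<dots> = h ((v \<otimes> u) \<otimes> x)" using assms by (simp add: m_assoc)
  also have "\<dots> = 0" using assms h_null[of x "v \<otimes> u"] by simp
  finally show ?thesis .
qed

lemma h_null_star_two_sided:
  assumes "x \<in> carrier A" "u \<in> carrier A" "v \<in> carrier A" "h (x\<^sup>\<star> \<otimes> x) = 0"
  shows "h (u \<otimes> x\<^sup>\<star> \<otimes> v) = 0"
proof -
  have "h (u \<otimes> x\<^sup>\<star> \<otimes> v) = cnj (h (v\<^sup>\<star> \<otimes> x \<otimes> u\<^sup>\<star>))"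
    using assms h_star[of "v\<^sup>\<star> \<otimes> x \<otimes> u\<^sup>\<star>"] by (simp add: m_assoc)
  then show ?thesis using h_null_two_sided[of x "v\<^sup>\<star>" "u\<^sup>\<star>"] assms by simp
qed

text \<open>One factor \<open>z\<close> or \<open>z\<^sup>\<star>\<close> is replaced at a time, the
  difference being killed by the two lemmas above. The prefix \<open>u\<close> is arbitrary so that
  the induction hypothesis can treat the last n factors while the first one, still unchanged, is
  absorbed into \<open>u\<close>.\<close>

lemma h_pow_perturb:
  assumes x: "x \<in> carrier A" "h (x\<^sup>\<star> \<otimes> x) = 0" and z: "z \<in> carrier A"
    and u: "u \<in> carrier A"
  shows "h (u \<otimes> (z\<^sup>\<star> \<otimes> z) [^] (n::nat)) = h (u \<otimes> ((z \<ominus> x)\<^sup>\<star> \<otimes> (z \<ominus> x)) [^] n)"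
  using u
proof (induction n arbitrary: u)
  case 0 then show ?case by simp
next
  case (Suc n)
  let ?e = "z \<ominus> x"
  let ?v = "(?e\<^sup>\<star> \<otimes> ?e) [^] n"
  have c [simp]: "?v \<in> carrier A" "(z\<^sup>\<star> \<otimes> z) [^] n \<in> carrier A" using x z by simp_all
  have pow_Suc: "y [^] Suc n = y \<otimes> y [^] n" if "y \<in> carrier A" for y
    using that by (rule nat_pow_Suc2)
  have split: "z = ?e \<oplus> x" using x z by algebra
  have "h (u \<otimes> (z\<^sup>\<star> \<otimes> z) [^] Suc n) = h ((u \<otimes> (z\<^sup>\<star> \<otimes> z)) \<otimes> (z\<^sup>\<star> \<otimes> z) [^] n)"
    using Suc.prems x z by (subst pow_Suc) (simp_all add: m_assoc)
  also have "\<dots> = h ((u \<otimes> (z\<^sup>\<star> \<otimes> z)) \<otimes> ?v)"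
    using Suc z by simp
  also have "(u \<otimes> (z\<^sup>\<star> \<otimes> z)) \<otimes> ?v = (u \<otimes> z\<^sup>\<star>) \<otimes> z \<otimes> ?v"
    using Suc.prems z by (simp add: m_assoc)
  also have "\<dots> = (u \<otimes> z\<^sup>\<star>) \<otimes> ?e \<otimes> ?v \<oplus> (u \<otimes> z\<^sup>\<star>) \<otimes> x \<otimes> ?v"
  proof -
    have "(u \<otimes> z\<^sup>\<star>) \<otimes> z \<otimes> ?v = (u \<otimes> z\<^sup>\<star>) \<otimes> (?e \<oplus> x) \<otimes> ?v" using split by simp
    then show ?thesis using Suc.prems x z by (simp add: l_distr r_distr)
  qed
  also have "h \<dots> = h ((u \<otimes> z\<^sup>\<star>) \<otimes> ?e \<otimes> ?v)"
    using Suc.prems x z h_null_two_sided[of x "u \<otimes> z\<^sup>\<star>" ?v] by simp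
  also have "(u \<otimes> z\<^sup>\<star>) \<otimes> ?e \<otimes> ?v = u \<otimes> z\<^sup>\<star> \<otimes> (?e \<otimes> ?v)"
    using Suc.prems x z by (simp add: m_assoc)
  also have "\<dots> = u \<otimes> ?e\<^sup>\<star> \<otimes> (?e \<otimes> ?v) \<oplus> u \<otimes> x\<^sup>\<star> \<otimes> (?e \<otimes> ?v)"
  proof -
    have "z\<^sup>\<star> = ?e\<^sup>\<star> \<oplus> x\<^sup>\<star>" using split x z by (metis minus_closed star_add)
    then have "u \<otimes> z\<^sup>\<star> \<otimes> (?e \<otimes> ?v) = u \<otimes> (?e\<^sup>\<star> \<oplus> x\<^sup>\<star>) \<otimes> (?e \<otimes> ?v)" by simp
    then show ?thesis using Suc.prems x z by (simp add: l_distr r_distr del: star_diff)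
  qed
  also have "h \<dots> = h (u \<otimes> ?e\<^sup>\<star> \<otimes> (?e \<otimes> ?v))"
    using Suc.prems x z h_null_star_two_sided[of x u "?e \<otimes> ?v"] by (simp del: star_diff)
  also have "u \<otimes> ?e\<^sup>\<star> \<otimes> (?e \<otimes> ?v) = u \<otimes> (?e\<^sup>\<star> \<otimes> ?e) [^] Suc n"
    using Suc.prems x z by (subst pow_Suc) (simp_all add: m_assoc del: star_diff)
  finally show ?case .
qed

lemma norm_approximant_le:
  assumes x: "x \<in> carrier A" "h (x\<^sup>\<star> \<otimes> x) = 0" and z: "z \<in> P M"
  shows "\<parallel>z\<parallel> \<le> \<parallel>z \<ominus> x\<parallel>"
proof (rule ccontr)
  assume "\<not> ?thesis"
  then have lt: "\<parallel>z \<ominus> x\<parallel> < \<parallel>z\<parallel>" by simp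
  have zc [simp]: "z \<in> carrier A" using z P_carrier by blast
  \<comment> \<open>The midpoint is positive even if \<open>z = x\<close>, so that it may be divided
    by, and it is still strictly below the norm of \<open>z\<close>.\<close>
  define \<epsilon> where "\<epsilon> = (\<parallel>z \<ominus> x\<parallel> + \<parallel>z\<parallel>) / 2"
  have \<epsilon>: "0 < \<epsilon>" "\<parallel>z \<ominus> x\<parallel> \<le> \<epsilon>" "\<epsilon> < \<parallel>z\<parallel>"
    using lt norm_nonneg[of "z \<ominus> x"] x unfolding \<epsilon>_def by (auto simp del: norm_nonneg)
  define Q where "Q = (\<parallel>z\<parallel> / \<epsilon>) ^ 4"
  have Q: "Q > 1" using \<epsilon> unfolding Q_def by (intro one_less_power) auto
  define w where "w = z\<^sup>\<star> \<otimes> z"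
  have w [simp]: "w \<in> carrier A" "w\<^sup>\<star> = w" and wP: "w \<in> P (2 * M)"
    using P_mult[OF P_star[OF z] z] by (simp_all add: w_def mult_2)
  define e where "e = z \<ominus> x"
  have e [simp]: "e \<in> carrier A" using x by (simp add: e_def)
  obtain m0 where m0: "\<And>m. m \<ge> m0 \<Longrightarrow> K * (1 + real m * real (2 * M)) ^ d < Q ^ m"
    using exponential_beats_polynomial[OF Q K, of "real (2 * M)" d] by auto
  \<comment> \<open>A power of two, as the norm formula for powers requires, and large enough for
    the exponential to win.\<close>
  define m where "m = (2::nat) ^ m0"
  have "m \<ge> m0" unfolding m_def by (simp add: less_imp_le)
  have "\<parallel>z\<parallel> ^ (4 * m) = (\<parallel>w\<parallel> ^ m)\<^sup>2"
    using norm_star_mult[of z] by (simp add: w_def flip: power_mult)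
  also have "\<parallel>w\<parallel> ^ m = \<parallel>w [^] m\<parallel>"
    unfolding m_def by (rule norm_selfadjoint_pow[symmetric]) simp_all
  also have "\<parallel>w [^] m\<parallel>\<^sup>2 \<le> K * (1 + real (m * (2 * M))) ^ d * Re (h ((w [^] m)\<^sup>\<star> \<otimes> w [^] m))"
    using decay[OF P_pow[OF wP]] .
  also have "(w [^] m)\<^sup>\<star> \<otimes> w [^] m = \<one> \<otimes> w [^] (2 * m)"
    by (simp add: nat_pow_mult mult_2)
  also have "h (\<one> \<otimes> w [^] (2 * m)) = h (\<one> \<otimes> (e\<^sup>\<star> \<otimes> e) [^] (2 * m))"
    unfolding w_def e_def by (rule h_pow_perturb[OF x]) simp_all
  also have "Re (h (\<one> \<otimes> (e\<^sup>\<star> \<otimes> e) [^] (2 * m))) \<le> \<epsilon> ^ (4 * m)"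
  proof -
    have "Re (h ((e\<^sup>\<star> \<otimes> e) [^] (2 * m))) \<le> cmod (h ((e\<^sup>\<star> \<otimes> e) [^] (2 * m)))"
      by (rule complex_Re_le_cmod)
    also have "\<dots> \<le> \<parallel>(e\<^sup>\<star> \<otimes> e) [^] (2 * m)\<parallel>" by (intro h_bounded) simp
    also have "\<dots> \<le> \<parallel>e\<^sup>\<star> \<otimes> e\<parallel> ^ (2 * m)" by (intro norm_pow_le) simp
    also have "\<dots> = \<parallel>e\<parallel> ^ (4 * m)" using norm_star_mult[of e] by (simp flip: power_mult)
    also have "\<dots> \<le> \<epsilon> ^ (4 * m)" using \<epsilon> x(1) by (intro power_mono) (simp_all add: e_def)
    finally show ?thesis by simp
  qed
  finally have "\<parallel>z\<parallel> ^ (4 * m) \<le> K * (1 + real (m * (2 * M))) ^ d * \<epsilon> ^ (4 * m)"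
    using K by (simp add: mult_left_mono)
  also have "\<dots> < Q ^ m * \<epsilon> ^ (4 * m)"
    using m0[OF \<open>m \<ge> m0\<close>] \<epsilon> by (intro mult_strict_right_mono) auto
  also have "\<dots> = \<parallel>z\<parallel> ^ (4 * m)"
    using \<epsilon> by (simp add: Q_def power_mult power_divide)
  finally show False by simp
qed

theorem faithful:
  assumes x: "x \<in> carrier A" "h (x\<^sup>\<star> \<otimes> x) = 0"
  shows "x = \<zero>"
proof -
  have "\<parallel>x\<parallel> \<le> 0 + e" if e: "e > 0" for e
  proof -
    obtain M z where z: "z \<in> P M" "\<parallel>x \<ominus> z\<parallel> < e / 2"
      using P_dense[OF x(1), of "e / 2"] e by auto
    then have zc: "z \<in> carrier A" using P_carrier by blast
    show ?thesis
      using norm_approximant_le[OF x z(1)] norm_le_diff[OF x(1) zc] z(2) norm_diff_commute[OF x(1) zc]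
      by simp
  qed
  then have "\<parallel>x\<parallel> \<le> 0" by (rule field_le_epsilon)
  then show ?thesis using norm_zero_iff[OF x(1)] norm_nonneg[OF x(1)] by simp
qed

end

section \<open>Polynomials in a self-adjoint element and their norms\<close>

context unital_cstar_algebra
begin

text \<open>Horner's scheme. Real coefficients keep the values self-adjoint when \<open>c\<close>
  is, and let the integral estimates for real polynomials be applied directly.\<close>

definition peval :: "'a \<Rightarrow> real poly \<Rightarrow> 'a" where
  "peval c f = fold_coeffs (\<lambda>r y. of_real r \<odot> \<one> \<oplus> c \<otimes> y) f \<zero>"

lemma peval_0 [simp]: "peval c 0 = \<zero>"
  by (simp add: peval_def)

context
  fixes c
  assumes c [simp]: "c \<in> carrier A"
begin

lemma peval_pCons [simp]: "peval c (pCons r f) = of_real r \<odot> \<one> \<oplus> c \<otimes> peval c f"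
  by (cases "r = 0 \<and> f = 0") (auto simp: peval_def)

lemma peval_closed [simp, intro]: "peval c f \<in> carrier A"
  by (induction f) simp_all

lemma peval_1 [simp]: "peval c 1 = \<one>"
  by (simp add: one_pCons)

lemma peval_add [simp]: "peval c (f + g) = peval c f \<oplus> peval c g"
proof (induction f g rule: poly_induct2)
  case (pCons r f s g)
  then show ?case by (simp add: smult_add_left r_distr a_ac)
qed simp

lemma peval_smult [simp]: "peval c (Polynomial.smult r f) = of_real r \<odot> peval c f"
  by (induction f) (simp_all add: smult_add_right)

lemma peval_uminus [simp]: "peval c (- f) = \<ominus> peval c f"
  using peval_smult[of "-1" f] by (simp add: minus_smult)

lemma peval_diff [simp]: "peval c (f - g) = peval c f \<ominus> peval c g"
  using peval_add[of f "- g"] by (simp add: a_minus_def)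

lemma peval_commute:
  "g \<in> carrier A \<Longrightarrow> g \<otimes> c = c \<otimes> g \<Longrightarrow> g \<otimes> peval c f = peval c f \<otimes> g"
proof (induction f)
  case (pCons r f)
  have "g \<otimes> (c \<otimes> peval c f) = (g \<otimes> c) \<otimes> peval c f" using pCons.prems(1) by (simp add: m_assoc)
  also have "\<dots> = c \<otimes> (g \<otimes> peval c f)" unfolding pCons.prems(2) using pCons.prems(1) by (simp add: m_assoc)
  also have "\<dots> = c \<otimes> peval c f \<otimes> g"
    using pCons.prems(1) pCons.IH[OF pCons.prems] by (simp add: m_assoc)
  finally show ?case using pCons.prems(1) by (simp add: r_distr l_distr)
qed simp

lemma peval_mult [simp]: "peval c (f * g) = peval c f \<otimes> peval c g"
  by (induction f) (simp_all add: l_distr m_assoc)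

lemma peval_star: "c\<^sup>\<star> = c \<Longrightarrow> (peval c f)\<^sup>\<star> = peval c f"
  by (induction f) (simp_all add: peval_commute[symmetric])

lemma peval_power [simp]: "peval c (f ^ n) = peval c f [^] n"
  by (induction n) (simp_all only: power_Suc2 power_0 peval_mult peval_1 nat_pow_Suc nat_pow_0 c)

end

text \<open>The element Y = 2 V y, with V the value of \<open>chebV n\<close>, is normal and
  commutes well enough that \<open>Y\<^sup>\<star> \<otimes> Y\<close> equals 4 c (1 - c) V^2.
  Pell's identity then reads T^2 + \<open>Y\<^sup>\<star> \<otimes> Y\<close> = 1, so
  \<open>norm_le_one_of_sum_squares\<close> bounds T. The bound on V follows from
  \<open>chebV_Suc_Suc\<close>.\<close>

lemma
  assumes c: "c \<in> carrier A" "c\<^sup>\<star> = c" and y: "y \<in> carrier A" "y \<otimes> y\<^sup>\<star> = y\<^sup>\<star> \<otimes> y"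
    and yc: "y \<otimes> c = c \<otimes> y" and yy: "y\<^sup>\<star> \<otimes> y = c \<otimes> (\<one> \<ominus> c)"
  shows norm_peval_chebT: "\<parallel>peval c (chebT n)\<parallel> \<le> 1"
    and norm_peval_chebV: "\<parallel>peval c (chebV n)\<parallel> \<le> real n"
proof -
  note [simp] = c(1) y(1)
  show T: "\<parallel>peval c (chebT n)\<parallel> \<le> 1" for n
  proof -
    define T where "T = peval c (chebT n)"
    define V where "V = peval c (chebV n)"
    have [simp]: "T \<in> carrier A" "V \<in> carrier A" by (simp_all add: T_def V_def)
    have Vs: "V\<^sup>\<star> = V" by (simp add: V_def peval_star c)
    have Vy: "y \<otimes> V = V \<otimes> y" unfolding V_def by (rule peval_commute) (use yc in simp_all)
    then have "(y \<otimes> V)\<^sup>\<star> = (V \<otimes> y)\<^sup>\<star>" by simp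
    then have Vy': "V \<otimes> y\<^sup>\<star> = y\<^sup>\<star> \<otimes> V" by (simp add: Vs)
    define Y where "Y = 2 \<odot> (V \<otimes> y)"
    have Y [simp]: "Y \<in> carrier A" by (simp add: Y_def)
    have Ys: "Y\<^sup>\<star> = 2 \<odot> (y\<^sup>\<star> \<otimes> V)" by (simp add: Y_def Vs)
    have "Y \<otimes> Y\<^sup>\<star> = 4 \<odot> (V \<otimes> ((y \<otimes> y\<^sup>\<star>) \<otimes> V))"
      unfolding Ys unfolding Y_def by (simp add: m_assoc)
    also have "(y \<otimes> y\<^sup>\<star>) \<otimes> V = V \<otimes> (y \<otimes> y\<^sup>\<star>)"
      using Vy Vy' by (metis m_assoc \<open>V \<in> carrier A\<close> star_closed y(1))
    also have "V \<otimes> (V \<otimes> (y \<otimes> y\<^sup>\<star>)) = (V \<otimes> V) \<otimes> (y\<^sup>\<star> \<otimes> y)" by (simp add: m_assoc y(2))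
    finally have YYs: "Y \<otimes> Y\<^sup>\<star> = 4 \<odot> ((V \<otimes> V) \<otimes> (y\<^sup>\<star> \<otimes> y))" .
    have "Y\<^sup>\<star> \<otimes> Y = 4 \<odot> ((y\<^sup>\<star> \<otimes> V) \<otimes> (V \<otimes> y))"
      unfolding Ys unfolding Y_def by simp
    also have "(y\<^sup>\<star> \<otimes> V) \<otimes> (V \<otimes> y) = (V \<otimes> V) \<otimes> (y\<^sup>\<star> \<otimes> y)"
    proof -
      have "(y\<^sup>\<star> \<otimes> V) \<otimes> (V \<otimes> y) = (y\<^sup>\<star> \<otimes> (V \<otimes> V)) \<otimes> y" by (simp add: m_assoc)
      also have "y\<^sup>\<star> \<otimes> (V \<otimes> V) = (V \<otimes> V) \<otimes> y\<^sup>\<star>"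
        using Vy' by (metis m_assoc \<open>V \<in> carrier A\<close> star_closed y(1))
      also have "(V \<otimes> V) \<otimes> y\<^sup>\<star> \<otimes> y = V \<otimes> V \<otimes> (y\<^sup>\<star> \<otimes> y)" by (simp add: m_assoc)
      finally show ?thesis .
    qed
    finally have YsY: "Y\<^sup>\<star> \<otimes> Y = 4 \<odot> ((V \<otimes> V) \<otimes> (y\<^sup>\<star> \<otimes> y))" .
    have "Y\<^sup>\<star> \<otimes> Y = peval c ([:0, 4, -4:] * (chebV n * chebV n))"
    proof -
      have "4 \<odot> (c \<otimes> (\<one> \<ominus> c)) = peval c [:0, 4, -4:]"
        by (simp add: diff_smult r_distr smult_add_right)
      then have "4 \<odot> (V \<otimes> V \<otimes> (c \<otimes> (\<one> \<ominus> c))) = V \<otimes> V \<otimes> peval c [:0, 4, -4:]"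
        by (metis (no_types, lifting) \<open>V \<in> carrier A\<close> c(1) m_closed minus_closed one_closed smult_mult_right)
      also have "\<dots> = peval c ((chebV n * chebV n) * [:0, 4, -4:])"
        unfolding V_def by (simp only: peval_mult c)
      finally show ?thesis unfolding YsY yy by (simp only: mult.commute)
    qed
    moreover have "T \<otimes> T = peval c (chebT n * chebT n)" by (simp add: T_def)
    ultimately have "T \<otimes> T \<oplus> Y\<^sup>\<star> \<otimes> Y = peval c (chebT n * chebT n + [:0, 4, -4:] * (chebV n * chebV n))"
      by (simp only: peval_add c)
    then have "T \<otimes> T \<oplus> Y\<^sup>\<star> \<otimes> Y = \<one>" by (simp only: cheb_pell peval_1 c)
    then show ?thesis
      using norm_le_one_of_sum_squares[of T Y] YYs YsY by (simp add: T_def peval_star c)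
  qed
  show "\<parallel>peval c (chebV n)\<parallel> \<le> real n"
  proof (induction n rule: induct_nat_012)
    case (ge2 n)
    have "\<parallel>peval c (chebV (Suc (Suc n)))\<parallel>
        \<le> \<parallel>peval c (chebV n)\<parallel> + \<parallel>peval c (chebT (Suc n))\<parallel> + \<parallel>peval c (chebT (Suc n))\<parallel>"
      unfolding chebV_Suc_Suc peval_add[OF c(1)]
      using norm_triangle[of "peval c (chebV n) \<oplus> peval c (chebT (Suc n))" "peval c (chebT (Suc n))"]
        norm_triangle[of "peval c (chebV n)" "peval c (chebT (Suc n))"]
      by (simp del: chebV.simps chebT.simps peval_mult peval_diff)
    then show ?case using ge2(1) T[of "Suc n"] by (simp del: chebV.simps chebT.simps)
  qed (use norm_one_le in simp_all)
qed

text \<open>In the expansion by \<open>chebV (Suc j)\<close> the terms have norm at most |g j| (j +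
  1). Cauchy-Schwarz separates the sum of squared coefficients, at most twice the integral, from the
  sum of (j + 1)^2, at most (N + 1)^3.\<close>

lemma norm_peval_le:
  assumes c: "c \<in> carrier A" "c\<^sup>\<star> = c" and y: "y \<in> carrier A" "y \<otimes> y\<^sup>\<star> = y\<^sup>\<star> \<otimes> y"
    and yc: "y \<otimes> c = c \<otimes> y" and yy: "y\<^sup>\<star> \<otimes> y = c \<otimes> (\<one> \<ominus> c)"
    and deg: "degree f \<le> N"
  shows "\<parallel>peval c f\<parallel>\<^sup>2 \<le> 2 * (1 + real N) ^ 3 * integral {0..1} (poly (f * f))"
proof -
  obtain g where f: "f = (\<Sum>j\<le>N. Polynomial.smult (g j) (chebV (Suc j)))"
    using chebV_span[OF deg] by blast
  have "\<parallel>peval c (\<Sum>j\<le>n. Polynomial.smult (g j) (chebV (Suc j)))\<parallel> \<le> (\<Sum>j\<le>n. \<bar>g j\<bar> * real (Suc j))" for n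
  proof -
    have summand: "\<parallel>peval c (Polynomial.smult (g j) (chebV (Suc j)))\<parallel> \<le> \<bar>g j\<bar> * real (Suc j)" for j
      using norm_peval_chebV[OF c y yc yy, of "Suc j"] c
      by (simp add: mult_left_mono del: chebV.simps of_nat_Suc)
    show ?thesis
    proof (induction n)
      case 0
      show ?case using summand[of 0] by (simp del: chebV.simps peval_smult)
    next
      case (Suc n)
      let ?s = "\<Sum>j\<le>n. Polynomial.smult (g j) (chebV (Suc j))"
      let ?t = "Polynomial.smult (g (Suc n)) (chebV (Suc (Suc n)))"
      have "\<parallel>peval c (?s + ?t)\<parallel> \<le> \<parallel>peval c ?s\<parallel> + \<parallel>peval c ?t\<parallel>"
        unfolding peval_add[OF c(1)] using c by (intro norm_triangle peval_closed)
      also have "\<dots> \<le> (\<Sum>j\<le>n. \<bar>g j\<bar> * real (Suc j)) + \<bar>g (Suc n)\<bar> * real (Suc (Suc n))"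
        by (intro add_mono Suc summand)
      finally show ?case by (simp only: sum.atMost_Suc)
    qed
  qed
  then have "\<parallel>peval c f\<parallel> \<le> (\<Sum>j\<le>N. \<bar>g j\<bar> * real (Suc j))" unfolding f .
  then have "\<parallel>peval c f\<parallel>\<^sup>2 \<le> (\<Sum>j\<le>N. \<bar>g j\<bar> * real (Suc j))\<^sup>2"
    using c by (intro power_mono) auto
  also have "\<dots> \<le> (\<Sum>j\<le>N. \<bar>g j\<bar>\<^sup>2) * (\<Sum>j\<le>N. (real (Suc j))\<^sup>2)"
    by (rule Cauchy_Schwarz_ineq_sum)
  also have "\<dots> \<le> (2 * integral {0..1} (poly (f * f))) * (1 + real N) ^ 3"
  proof (intro mult_mono)
    show "(\<Sum>j\<le>N. \<bar>g j\<bar>\<^sup>2) \<le> 2 * integral {0..1} (poly (f * f))"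
      using chebV_coeff_bound[OF f] by simp
    have "(\<Sum>j\<le>N. (real (Suc j))\<^sup>2) \<le> real (card {..N}) * (1 + real N)\<^sup>2"
      by (rule sum_bounded_above) (auto intro!: power_mono)
    then show "(\<Sum>j\<le>N. (real (Suc j))\<^sup>2) \<le> (1 + real N) ^ 3"
      by (simp add: power2_eq_square power3_eq_cube)
    show "0 \<le> 2 * integral {0..1} (poly (f * f))"
      by (intro mult_nonneg_nonneg integral_nonneg integrable_continuous_interval continuous_intros) auto
  qed (auto intro: sum_nonneg)
  finally show ?thesis by (simp only: mult_ac)
qed

end

context cstar_state
begin

text \<open>The prefix \<open>c [^] k\<close> is what the induction needs: peeling off a coefficient
  leaves a factor \<open>c\<close>, which raises k.\<close>

lemma h_pow_peval:
  assumes c: "c \<in> carrier A" and "degree f \<le> N"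
  shows "h (c [^] k \<otimes> peval c f) = (\<Sum>i\<le>N. complex_of_real (coeff f i) * h (c [^] (k + i)))"
  using assms(2)
proof (induction f arbitrary: k N)
  case 0
  then show ?case using c by simp
next
  case (pCons r f)
  have "h (c [^] k \<otimes> peval c (pCons r f)) = of_real r * h (c [^] k) + h (c [^] Suc k \<otimes> peval c f)"
    using c by (simp add: r_distr m_assoc)
  also have "\<dots> = (\<Sum>i\<le>N. complex_of_real (coeff (pCons r f) i) * h (c [^] (k + i)))"
  proof (cases N)
    case 0
    then have "f = 0" using pCons.prems by (cases "f = 0") auto
    then show ?thesis using c 0 by simp
  next
    case (Suc M)
    then have "degree f \<le> M" using pCons.prems by (cases "f = 0") auto
    then show ?thesis unfolding Suc sum.atMost_Suc_shift
      using pCons.IH[of M "Suc k"] by (simp del: nat_pow_Suc)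
  qed
  finally show ?case .
qed

lemma h_peval:
  assumes "c \<in> carrier A" "degree f \<le> N"
  shows "h (peval c f) = (\<Sum>i\<le>N. complex_of_real (coeff f i) * h (c [^] i))"
  using h_pow_peval[OF assms, of 0] assms(1) by simp

end

section \<open>Words in the generators\<close>

datatype letter = La | La' | Lb | Lb' | LD | LD'

fun letter_star :: "letter \<Rightarrow> letter" where
  "letter_star La = La'" | "letter_star La' = La" | "letter_star Lb = Lb'"
| "letter_star Lb' = Lb" | "letter_star LD = LD'" | "letter_star LD' = LD"

fun letter_deg :: "letter \<Rightarrow> int \<times> int \<times> int" where
  "letter_deg La = (1, 0, 0)" | "letter_deg La' = (-1, 0, 0)"
| "letter_deg Lb = (0, 1, 0)" | "letter_deg Lb' = (0, -1, 0)"
| "letter_deg LD = (0, 0, 1)" | "letter_deg LD' = (0, 0, -1)"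

definition word_deg :: "letter list \<Rightarrow> int \<times> int \<times> int" where
  "word_deg w = sum_list (map letter_deg w)"

definition word_star :: "letter list \<Rightarrow> letter list" where
  "word_star w = rev (map letter_star w)"

text \<open>The generators \<open>a\<close>, \<open>b\<close>, \<open>D\<close> and their adjoints commute up to powers of \<open>q\<close>;
  the exponent is an alternating bilinear form in the degrees.\<close>

fun omega :: "int \<times> int \<times> int \<Rightarrow> int \<times> int \<times> int \<Rightarrow> int" where
  "omega (i, j, l) (i', j', l') = (j * i' - i * j') + 2 * (j * l' - l * j')"

lemma omega_add_right: "omega x (y + z) = omega x y + omega x z"
  by (cases x; cases y; cases z) (simp add: algebra_simps)

lemma omega_zero [simp]: "omega 0 x = 0" "omega x 0 = 0"
  by (cases x, simp add: zero_prod_def)+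

lemma omega_zero_prod [simp]: "omega (0, 0, 0) x = 0"
  by (cases x) simp

lemma omega_minus_self [simp]: "omega x (- x) = 0"
  by (cases x) simp

lemma word_deg_simps [simp]:
  "word_deg [] = 0" "word_deg (x # w) = letter_deg x + word_deg w"
  "word_deg (v @ w) = word_deg v + word_deg w"
  by (simp_all add: word_deg_def)

lemma word_star_simps [simp]:
  "word_star [] = []" "word_star (x # w) = word_star w @ [letter_star x]"
  "length (word_star w) = length w"
  by (simp_all add: word_star_def)

lemma word_deg_star [simp]: "word_deg (word_star w) = - word_deg w"
proof (induction w)
  case (Cons x w)
  have "letter_deg (letter_star x) = - letter_deg x" by (cases x) simp_all
  then show ?case using Cons by simp
qed simp

lemma word_deg_replicate: "word_deg (replicate n x) = (case letter_deg x of (i, j, l) \<Rightarrow> (int n * i, int n * j, int n * l))"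
  by (induction n) (auto simp: zero_prod_def algebra_simps split: prod.splits)

lemma word_deg_count:
  "word_deg w = (int (count_list w La) - int (count_list w La'),
     int (count_list w Lb) - int (count_list w Lb'), int (count_list w LD) - int (count_list w LD'))"
proof (induction w)
  case (Cons x w)
  then show ?case by (cases x) simp_all
qed (simp add: zero_prod_def)

section \<open>Complex linear spans\<close>

context unital_cstar_algebra
begin

text \<open>Appending one scaled generator at a time makes every statement about products or
  adjoints of span elements a rule induction.\<close>

inductive_set cspan :: "'a set \<Rightarrow> 'a set" for G where
  zero: "\<zero> \<in> cspan G"
| step: "x \<in> cspan G \<Longrightarrow> g \<in> G \<Longrightarrow> x \<oplus> c \<odot> g \<in> cspan G"

definition csubspace :: "'a set \<Rightarrow> bool" where
  "csubspace X \<longleftrightarrow> X \<subseteq> carrier A \<and> \<zero> \<in> X \<and> (\<forall>x\<in>X. \<forall>y\<in>X. x \<oplus> y \<in> X) \<and> (\<forall>c. \<forall>x\<in>X. c \<odot> x \<in> X)"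

lemma csubspaceD:
  assumes "csubspace X"
  shows "x \<in> X \<Longrightarrow> x \<in> carrier A" "\<zero> \<in> X" "x \<in> X \<Longrightarrow> y \<in> X \<Longrightarrow> x \<oplus> y \<in> X" "x \<in> X \<Longrightarrow> c \<odot> x \<in> X"
  using assms by (auto simp: csubspace_def)

lemma cspan_least:
  assumes "csubspace X" "G \<subseteq> X" "x \<in> cspan G"
  shows "x \<in> X"
  using assms(3) by induction (use assms(1,2) csubspaceD[OF assms(1)] in auto)

lemma cspan_carrier: "G \<subseteq> carrier A \<Longrightarrow> x \<in> cspan G \<Longrightarrow> x \<in> carrier A"
  by (rule cspan_least[of "carrier A"]) (auto simp: csubspace_def)

lemma cspan_base: "G \<subseteq> carrier A \<Longrightarrow> g \<in> G \<Longrightarrow> g \<in> cspan G"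
  using cspan.step[OF cspan.zero, of g G 1] by (auto simp: subset_iff)

lemma csubspace_cspan:
  assumes G: "G \<subseteq> carrier A" shows "csubspace (cspan G)"
proof -
  note cl = cspan_carrier[OF G]
  have add: "x \<oplus> y \<in> cspan G" if "x \<in> cspan G" "y \<in> cspan G" for x y
    using that(2)
  proof induction
    case zero then show ?case using that(1) cl by simp
  next
    case (step y g c)
    have "x \<oplus> (y \<oplus> c \<odot> g) = (x \<oplus> y) \<oplus> c \<odot> g"
      using step that(1) cl G by (intro a_assoc[symmetric]) auto
    then show ?case using cspan.step step by simp
  qed
  have "c \<odot> x \<in> cspan G" if "x \<in> cspan G" for c x
    using that
  proof induction
    case zero then show ?case by (simp add: cspan.zero)
  next
    case (step x g c')
    have "c \<odot> (x \<oplus> c' \<odot> g) = c \<odot> x \<oplus> (c * c') \<odot> g"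
      using step cl[OF step(1)] G by (auto simp: smult_add_right subset_iff)
    then show ?case using cspan.step step by simp
  qed
  then show ?thesis using add cl by (auto simp: csubspace_def cspan.zero)
qed

lemma cspan_mult:
  assumes X: "csubspace X" and G: "G \<subseteq> carrier A" "G' \<subseteq> carrier A"
    and GG: "\<And>g g'. g \<in> G \<Longrightarrow> g' \<in> G' \<Longrightarrow> g \<otimes> g' \<in> X" and "x \<in> cspan G" "y \<in> cspan G'"
  shows "x \<otimes> y \<in> X"
proof -
  have *: "g \<otimes> y \<in> X" if g: "g \<in> G" for g
    using \<open>y \<in> cspan G'\<close>
  proof induction
    case zero then show ?case using g G csubspaceD[OF X] by auto
  next
    case (step y g' c)
    have "g \<otimes> (y \<oplus> c \<odot> g') = g \<otimes> y \<oplus> c \<odot> (g \<otimes> g')"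
      using step g G cspan_carrier[OF G(2)] by (auto simp: r_distr subset_iff)
    then show ?case using step g GG csubspaceD[OF X] by simp
  qed
  have y: "y \<in> carrier A" using cspan_carrier[OF G(2)] assms by blast
  show ?thesis
    using \<open>x \<in> cspan G\<close>
  proof induction
    case zero then show ?case using y csubspaceD[OF X] by auto
  next
    case (step x g c)
    have "(x \<oplus> c \<odot> g) \<otimes> y = x \<otimes> y \<oplus> c \<odot> (g \<otimes> y)"
      using step y G cspan_carrier[OF G(1)] by (auto simp: l_distr subset_iff)
    then show ?case using step * csubspaceD[OF X] by simp
  qed
qed

lemma cspan_star:
  assumes X: "csubspace X" and G: "G \<subseteq> carrier A"
    and GG: "\<And>g. g \<in> G \<Longrightarrow> g\<^sup>\<star> \<in> X" and "x \<in> cspan G"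
  shows "x\<^sup>\<star> \<in> X"
  using assms(4)
proof induction
  case zero then show ?case using csubspaceD[OF X] by simp
next
  case (step x g c)
  have "(x \<oplus> c \<odot> g)\<^sup>\<star> = x\<^sup>\<star> \<oplus> cnj c \<odot> g\<^sup>\<star>"
    using step G cspan_carrier[OF G] by (auto simp: subset_iff)
  then show ?case using step GG csubspaceD[OF X] by simp
qed

end

section \<open>The relations for |q| = 1: commutation up to powers of q and the grading\<close>

locale Uq2_algebra = unital_cstar_algebra +
  fixes q :: complex and a b D :: 'a
  assumes cmod_q: "cmod q = 1" and relations: "Uq2_relations q A a b D"
begin

lemma gen_closed [simp, intro]: "a \<in> carrier A" "b \<in> carrier A" "D \<in> carrier A"
  using relations unfolding Uq2_relations_def by blast+

definition c :: 'a where "c = b \<otimes> b\<^sup>\<star>"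

lemma c_closed [simp, intro]: "c \<in> carrier A"
  by (simp add: c_def)

lemma c_star [simp]: "c\<^sup>\<star> = c"
  by (simp add: c_def)

lemma rel:
  "b \<otimes> a = q \<odot> (a \<otimes> b)" "a\<^sup>\<star> \<otimes> b = q \<odot> (b \<otimes> a\<^sup>\<star>)" "b\<^sup>\<star> \<otimes> b = c"
  "a \<otimes> D = D \<otimes> a" "b \<otimes> D = q\<^sup>2 \<odot> (D \<otimes> b)" "D \<otimes> D\<^sup>\<star> = \<one>" "D\<^sup>\<star> \<otimes> D = \<one>"
  using relations unfolding Uq2_relations_def cmod_q of_real_1 power_one div_by_1 c_def
  by (metis (no_types))+

lemma aa_star: "a \<otimes> a\<^sup>\<star> = \<one> \<ominus> c" "a\<^sup>\<star> \<otimes> a = \<one> \<ominus> c"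
proof -
  have "a \<otimes> a\<^sup>\<star> \<oplus> c = \<one>" "a\<^sup>\<star> \<otimes> a \<oplus> 1 \<odot> (b\<^sup>\<star> \<otimes> b) = \<one>"
    using relations unfolding Uq2_relations_def cmod_q of_real_1 power_one c_def by blast+
  then have "a \<otimes> a\<^sup>\<star> \<oplus> c = \<one>" "a\<^sup>\<star> \<otimes> a \<oplus> c = \<one>" by (simp_all add: rel(3))
  then show "a \<otimes> a\<^sup>\<star> = \<one> \<ominus> c" "a\<^sup>\<star> \<otimes> a = \<one> \<ominus> c"
    by (auto intro!: add_eq_imp_diff)
qed

lemma q_nonzero [simp]: "q \<noteq> 0"
  using cmod_q by auto

lemma cnj_q: "cnj q = inverse q"
  using complex_div_cnj[of 1 q] cmod_q by (simp add: divide_inverse)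

lemma cnj_q_powi: "cnj q powi n = q powi (- n)"
  by (simp add: cnj_q power_int_inverse power_int_minus)

definition qcomm :: "int \<Rightarrow> 'a \<Rightarrow> 'a \<Rightarrow> bool" where
  "qcomm n x y \<longleftrightarrow> x \<in> carrier A \<and> y \<in> carrier A \<and> x \<otimes> y = (q powi n) \<odot> (y \<otimes> x)"

lemma qcomm_sym: "qcomm n x y \<Longrightarrow> qcomm (- n) y x"
  by (auto simp: qcomm_def simp flip: power_int_add)

text \<open>The exponent keeps its sign: reversing the order inverts it, and conjugating a number of
  modulus one inverts it again.\<close>

lemma qcomm_star: assumes "qcomm n x y" shows "qcomm n (x\<^sup>\<star>) (y\<^sup>\<star>)"
proof -
  have xy: "x \<in> carrier A" "y \<in> carrier A" and "(x \<otimes> y)\<^sup>\<star> = ((q powi n) \<odot> (y \<otimes> x))\<^sup>\<star>"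
    using assms by (auto simp: qcomm_def)
  then have "y\<^sup>\<star> \<otimes> x\<^sup>\<star> = (q powi (- n)) \<odot> (x\<^sup>\<star> \<otimes> y\<^sup>\<star>)"
    by (simp add: cnj_q_powi)
  then have "qcomm (- n) (y\<^sup>\<star>) (x\<^sup>\<star>)" using xy by (simp add: qcomm_def)
  from qcomm_sym[OF this] show ?thesis by simp
qed

text \<open>Since \<open>D\<close> is unitary, its adjoint is its inverse, and multiplying the
  relation by it on both sides inverts the phase.\<close>

lemma qcomm_D: assumes "qcomm n x D" shows "qcomm (- n) x (D\<^sup>\<star>)"
proof -
  have x: "x \<in> carrier A" and xD: "x \<otimes> D = (q powi n) \<odot> (D \<otimes> x)" using assms by (auto simp: qcomm_def)
  have "D\<^sup>\<star> \<otimes> x = D\<^sup>\<star> \<otimes> (x \<otimes> (D \<otimes> D\<^sup>\<star>))" using x by (simp add: rel)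
  also have "\<dots> = D\<^sup>\<star> \<otimes> (x \<otimes> D) \<otimes> D\<^sup>\<star>" using x by (simp add: m_assoc)
  also have "\<dots> = (q powi n) \<odot> ((D\<^sup>\<star> \<otimes> D) \<otimes> (x \<otimes> D\<^sup>\<star>))"
    unfolding xD using x by (simp add: m_assoc)
  finally have "qcomm n (D\<^sup>\<star>) x" using x by (simp add: qcomm_def rel)
  then show ?thesis by (rule qcomm_sym)
qed

lemma qcomm_gens:
  "qcomm 1 b a" "qcomm 1 (a\<^sup>\<star>) b" "qcomm 0 b (b\<^sup>\<star>)" "qcomm 0 a (a\<^sup>\<star>)" "qcomm 0 a D" "qcomm 2 b D" "qcomm 0 D (D\<^sup>\<star>)"
  by (simp_all add: qcomm_def rel aa_star c_def[symmetric])

fun letter_val :: "letter \<Rightarrow> 'a" where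
  "letter_val La = a" | "letter_val La' = a\<^sup>\<star>" | "letter_val Lb = b"
| "letter_val Lb' = b\<^sup>\<star>" | "letter_val LD = D" | "letter_val LD' = D\<^sup>\<star>"

lemma letter_val_closed [simp, intro]: "letter_val x \<in> carrier A"
  by (cases x) simp_all

lemma letter_val_star [simp]: "letter_val (letter_star x) = (letter_val x)\<^sup>\<star>"
  by (cases x) simp_all

lemma qcomm_letters: "qcomm (omega (letter_deg x) (letter_deg y)) (letter_val x) (letter_val y)"
proof -
  have refl: "qcomm 0 z z" if "z \<in> carrier A" for z using that by (simp add: qcomm_def)
  note ba = qcomm_gens(1) and asb = qcomm_gens(2) and bD = qcomm_gens(6)
  have abs: "qcomm 1 a (b\<^sup>\<star>)" using qcomm_star[OF asb] by simp
  have bsas: "qcomm 1 (b\<^sup>\<star>) (a\<^sup>\<star>)" using qcomm_star[OF ba] by simp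
  have aDs: "qcomm 0 a (D\<^sup>\<star>)" using qcomm_D[OF qcomm_gens(5)] by simp
  have asD: "qcomm 0 (a\<^sup>\<star>) D" using qcomm_star[OF aDs] by simp
  have asDs: "qcomm 0 (a\<^sup>\<star>) (D\<^sup>\<star>)" using qcomm_star[OF qcomm_gens(5)] by simp
  have bDs: "qcomm (-2) b (D\<^sup>\<star>)" using qcomm_D[OF bD] by simp
  have bsD: "qcomm (-2) (b\<^sup>\<star>) D" using qcomm_star[OF bDs] by simp
  have bsDs: "qcomm 2 (b\<^sup>\<star>) (D\<^sup>\<star>)" using qcomm_star[OF bD] by simp
  note base = qcomm_gens abs bsas aDs asD asDs bDs bsD bsDs refl
  note sym = base[THEN qcomm_sym]
  show ?thesis by (cases x; cases y) (use base sym in simp_all)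
qed

fun word_val :: "letter list \<Rightarrow> 'a" where
  "word_val [] = \<one>" | "word_val (x # w) = letter_val x \<otimes> word_val w"

lemma word_val_closed [simp, intro]: "word_val w \<in> carrier A"
  by (induction w) simp_all

lemma word_val_append [simp]: "word_val (v @ w) = word_val v \<otimes> word_val w"
  by (induction v) (simp_all add: m_assoc)

lemma word_val_star: "(word_val w)\<^sup>\<star> = word_val (word_star w)"
  by (induction w) simp_all

lemma word_val_replicate [simp]: "word_val (replicate n x) = letter_val x [^] n"
proof (induction n)
  case (Suc n)
  then have "word_val (replicate (Suc n) x) = letter_val x \<otimes> letter_val x [^] n" by simp
  then show ?case using nat_pow_Suc2[of "letter_val x" n] by simp
qed simp

lemma qcomm_mult_right:
  assumes "qcomm m x y" "qcomm n x z" shows "qcomm (m + n) x (y \<otimes> z)"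
proof -
  have cl: "x \<in> carrier A" "y \<in> carrier A" "z \<in> carrier A"
    and xy: "x \<otimes> y = (q powi m) \<odot> (y \<otimes> x)" and xz: "x \<otimes> z = (q powi n) \<odot> (z \<otimes> x)"
    using assms by (auto simp: qcomm_def)
  have "x \<otimes> (y \<otimes> z) = (x \<otimes> y) \<otimes> z" using cl by (simp add: m_assoc)
  also have "\<dots> = (q powi m) \<odot> (y \<otimes> (x \<otimes> z))" unfolding xy using cl by (simp add: m_assoc)
  also have "\<dots> = (q powi (m + n)) \<odot> (y \<otimes> z \<otimes> x)" unfolding xz using cl by (simp add: m_assoc power_int_add)
  finally show ?thesis using cl by (simp add: qcomm_def)
qed

lemma qcomm_one: "x \<in> carrier A \<Longrightarrow> qcomm 0 x \<one>"
  by (simp add: qcomm_def)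

lemma qcomm_words: "qcomm (omega (word_deg v) (word_deg w)) (word_val v) (word_val w)"
proof -
  have letter: "qcomm (omega (letter_deg x) (word_deg w)) (letter_val x) (word_val w)" for x w
  proof (induction w)
    case Nil show ?case by (simp add: qcomm_one)
  next
    case (Cons y w)
    show ?case using qcomm_mult_right[OF qcomm_letters Cons, of y] by (simp add: omega_add_right)
  qed
  have flip: "omega y x = - omega x y" for x y by (cases x; cases y) simp
  have "qcomm (omega (word_deg w) (word_deg v)) (word_val w) (word_val v)"
  proof (induction v)
    case Nil show ?case by (simp add: qcomm_one)
  next
    case (Cons x v)
    have "qcomm (omega (word_deg w) (letter_deg x)) (word_val w) (letter_val x)"
      using qcomm_sym[OF letter[of x w]] by (simp add: flip[of "word_deg w" "letter_deg x"])
    from qcomm_mult_right[OF this Cons] show ?case by (simp add: omega_add_right)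
  qed
  from qcomm_sym[OF this] show ?thesis by (simp add: flip[of "word_deg v" "word_deg w"])
qed

lemma word_val_commute:
  "word_val v \<otimes> word_val w = (q powi omega (word_deg v) (word_deg w)) \<odot> (word_val w \<otimes> word_val v)"
  using qcomm_words[of v w] unfolding qcomm_def by blast

text \<open>The phase is left unspecified: for the reduction of degree-zero words and for the
  transfer of vanishing, the existence of a scalar is enough.\<close>

lemma word_val_perm: "mset v = mset w \<Longrightarrow> \<exists>z. word_val v = z \<odot> word_val w"
proof (induction v arbitrary: w)
  case Nil
  then show ?case by (intro exI[of _ 1]) simp
next
  case (Cons x v)
  then have "x \<in> set w" by (metis list.set_intros(1) set_mset_mset)
  then obtain w1 w2 where w: "w = w1 @ x # w2" by (meson split_list)
  then have "mset v = mset (w1 @ w2)" using Cons.prems by simp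
  then obtain z where z: "word_val v = z \<odot> word_val (w1 @ w2)" using Cons.IH by blast
  have "word_val (x # v) = z \<odot> (word_val [x] \<otimes> word_val w1 \<otimes> word_val w2)"
    by (simp add: z m_assoc)
  also have "\<dots> = (z * q powi omega (word_deg [x]) (word_deg w1)) \<odot> word_val w"
    by (simp only: word_val_commute[of "[x]" w1]) (simp add: w m_assoc)
  finally show ?case by blast
qed

text \<open>In degree zero each letter occurs as often as its adjoint, so the word can be rearranged
  into powers of \<open>aa\<^sup>\<star> = 1 - c\<close>, \<open>bb\<^sup>\<star> = c\<close> and
  \<open>DD\<^sup>\<star> = 1\<close>.\<close>

lemma word_val_deg_zero:
  assumes "word_deg w = 0" "length w \<le> N"
  obtains z p r where "p + r \<le> N" "word_val w = z \<odot> ((\<one> \<ominus> c) [^] (p::nat) \<otimes> c [^] (r::nat))"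
proof -
  define p where "p = count_list w La"
  define r where "r = count_list w Lb"
  define s where "s = count_list w LD"
  have eq: "count_list w La' = p" "count_list w Lb' = r" "count_list w LD' = s"
    using assms(1) unfolding word_deg_count by (auto simp: zero_prod_def p_def r_def s_def)
  let ?w = "concat (replicate p [La, La']) @ concat (replicate r [Lb, Lb']) @ concat (replicate s [LD, LD'])"
  have m: "mset (concat (replicate n [x, y])) = replicate_mset n x + replicate_mset n y" for n and x y :: letter
    by (induction n) simp_all
  have "mset w = mset ?w"
  proof (rule multiset_eqI)
    fix x show "count (mset w) x = count (mset ?w) x"
      using eq p_def r_def s_def unfolding mset_append m
      by (cases x) (simp_all add: count_mset)
  qed
  then obtain z where z: "word_val w = z \<odot> word_val ?w" using word_val_perm by blast
  have v: "word_val (concat (replicate n [x, y])) = (letter_val x \<otimes> letter_val y) [^] n" for n x y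
    by (induction n) (simp_all add: nat_pow_Suc2[symmetric] m_assoc[symmetric] del: nat_pow_Suc)
  have "length w = length ?w" using \<open>mset w = mset ?w\<close> by (metis size_mset)
  then have "p + r \<le> N" using assms(2) by (simp add: length_concat sum_list_replicate)
  moreover have "word_val ?w = (\<one> \<ominus> c) [^] p \<otimes> c [^] r"
    unfolding word_val_append v by (simp add: rel aa_star c_def[symmetric])
  ultimately show ?thesis using that z by metis
qed

lemma c_central: "c \<otimes> word_val w = word_val w \<otimes> c"
proof -
  have "c = word_val [Lb, Lb']" by (simp add: c_def)
  then show ?thesis using word_val_commute[of "[Lb, Lb']" w] by simp
qed

lemma c_commute_letter: "c \<otimes> letter_val x = letter_val x \<otimes> c"
  using c_central[of "[x]"] by simp

lemma c_commute_gens: "c \<otimes> a = a \<otimes> c" "c \<otimes> b = b \<otimes> c" "c \<otimes> D = D \<otimes> c"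
  "c \<otimes> a\<^sup>\<star> = a\<^sup>\<star> \<otimes> c" "c \<otimes> b\<^sup>\<star> = b\<^sup>\<star> \<otimes> c" "c \<otimes> D\<^sup>\<star> = D\<^sup>\<star> \<otimes> c"
  by (rule c_commute_letter[of La, unfolded letter_val.simps] c_commute_letter[of Lb, unfolded letter_val.simps]
      c_commute_letter[of LD, unfolded letter_val.simps] c_commute_letter[of La', unfolded letter_val.simps]
      c_commute_letter[of Lb', unfolded letter_val.simps] c_commute_letter[of LD', unfolded letter_val.simps])+

text \<open>The polynomials in \<open>c\<close> of degree at most N with complex coefficients, split
  into real and imaginary parts because \<open>peval\<close> takes real ones.\<close>

definition cpoly :: "nat \<Rightarrow> 'a set" where
  "cpoly N = {peval c f \<oplus> \<i> \<odot> peval c g | f g. degree f \<le> N \<and> degree g \<le> N}"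

lemma csubspace_cpoly: "csubspace (cpoly N)"
proof -
  have "x \<oplus> y \<in> cpoly N" if xy: "x \<in> cpoly N" "y \<in> cpoly N" for x y
  proof -
    obtain f g f' g' where "x = peval c f \<oplus> \<i> \<odot> peval c g" "y = peval c f' \<oplus> \<i> \<odot> peval c g'"
      "degree f \<le> N" "degree g \<le> N" "degree f' \<le> N" "degree g' \<le> N" using xy by (auto simp: cpoly_def)
    then have "x \<oplus> y = peval c (f + f') \<oplus> \<i> \<odot> peval c (g + g') \<and> degree (f + f') \<le> N \<and> degree (g + g') \<le> N"
      by (simp add: degree_add_le smult_add_right a_ac)
    then show ?thesis unfolding cpoly_def by blast
  qed
  moreover have "z \<odot> x \<in> cpoly N" if x: "x \<in> cpoly N" for z x
  proof -
    obtain f g where x: "x = peval c f \<oplus> \<i> \<odot> peval c g" "degree f \<le> N" "degree g \<le> N"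
      using x by (auto simp: cpoly_def)
    let ?f = "Polynomial.smult (Re z) f + Polynomial.smult (- Im z) g"
    let ?g = "Polynomial.smult (Im z) f + Polynomial.smult (Re z) g"
    have "peval c ?f \<oplus> \<i> \<odot> peval c ?g = (of_real (Re z) \<odot> peval c f \<oplus> (\<i> * complex_of_real (Im z)) \<odot> peval c f)
       \<oplus> (of_real (- Im z) \<odot> peval c g \<oplus> (\<i> * complex_of_real (Re z)) \<odot> peval c g)"
      by (simp add: smult_add_right diff_smult a_ac)
    also have "\<dots> = z \<odot> peval c f \<oplus> (z * \<i>) \<odot> peval c g"
    proof -
      have "complex_of_real (Re z) + \<i> * complex_of_real (Im z) = z"
        "complex_of_real (- Im z) + \<i> * complex_of_real (Re z) = z * \<i>" by (auto simp: complex_eq_iff)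
      then show ?thesis by (simp flip: smult_add_left)
    qed
    also have "\<dots> = z \<odot> x" unfolding x by (simp add: smult_add_right)
    finally have "z \<odot> x = peval c ?f \<oplus> \<i> \<odot> peval c ?g" by (rule sym)
    moreover have "degree ?f \<le> N" "degree ?g \<le> N"
      using x(2,3) by (auto intro: degree_add_le degree_diff_le degree_smult_le[THEN order_trans])
    ultimately have "z \<odot> x = peval c ?f \<oplus> \<i> \<odot> peval c ?g \<and> degree ?f \<le> N \<and> degree ?g \<le> N"
      by blast
    then show ?thesis unfolding cpoly_def by blast
  qed
  moreover have "\<zero> \<in> cpoly N"
  proof -
    have "\<zero> = peval c 0 \<oplus> \<i> \<odot> peval c 0 \<and> degree (0::real poly) \<le> N \<and> degree (0::real poly) \<le> N" by simp
    then show ?thesis unfolding cpoly_def by blast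
  qed
  moreover have "cpoly N \<subseteq> carrier A" by (auto simp: cpoly_def)
  ultimately show ?thesis unfolding csubspace_def by blast
qed

lemma word_val_cpoly: assumes "word_deg w = 0" "length w \<le> N" shows "word_val w \<in> cpoly N"
proof -
  obtain z p r where pr: "p + r \<le> N" and w: "word_val w = z \<odot> ((\<one> \<ominus> c) [^] (p::nat) \<otimes> c [^] (r::nat))"
    using word_val_deg_zero[OF assms] .
  let ?f = "[:1, -1:] ^ p * [:0, 1:] ^ r :: real poly"
  have "peval c ?f = (\<one> \<ominus> c) [^] p \<otimes> c [^] r" by (simp add: diff_smult)
  moreover have "degree ?f \<le> N"
  proof -
    have "degree ?f \<le> degree ([:1, -1:] ^ p :: real poly) + degree ([:0, 1:] ^ r :: real poly)" by (rule degree_mult_le)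
    also have "\<dots> = p + r" by (simp add: degree_power_eq)
    finally show ?thesis using pr by simp
  qed
  ultimately have "(\<one> \<ominus> c) [^] p \<otimes> c [^] r = peval c ?f \<oplus> \<i> \<odot> peval c 0 \<and> degree ?f \<le> N \<and> degree (0::real poly) \<le> N"
    by simp
  then have "(\<one> \<ominus> c) [^] p \<otimes> c [^] r \<in> cpoly N" unfolding cpoly_def by blast
  then show ?thesis unfolding w by (rule csubspaceD[OF csubspace_cpoly])
qed

text \<open>Averaging with the adjoint removes the imaginary part \<open>g\<close>.\<close>

lemma cpoly_selfadjoint:
  assumes "x \<in> cpoly N" "x\<^sup>\<star> = x"
  obtains f where "x = peval c f" "degree f \<le> N"
proof -
  obtain f g where x: "x = peval c f \<oplus> \<i> \<odot> peval c g" "degree f \<le> N"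
    using assms(1) by (auto simp: cpoly_def)
  have xs: "x\<^sup>\<star> = peval c f \<oplus> (- \<i>) \<odot> peval c g" unfolding x by (simp add: peval_star)
  have "2 \<odot> x = x \<oplus> x\<^sup>\<star>" using assms(2) x smult_add_left[of x 1 1] by simp
  also have "\<dots> = (peval c f \<oplus> peval c f) \<oplus> (\<i> \<odot> peval c g \<oplus> (- \<i>) \<odot> peval c g)"
    unfolding xs unfolding x by (simp add: a_ac)
  also have "\<i> \<odot> peval c g \<oplus> (- \<i>) \<odot> peval c g = \<zero>" by (simp flip: smult_add_left)
  also have "peval c f \<oplus> peval c f = 2 \<odot> peval c f" using smult_add_left[of "peval c f" 1 1] by simp
  finally have "(1/2) \<odot> (2 \<odot> x) = (1/2) \<odot> (2 \<odot> peval c f)" by simp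
  then have "x = peval c f" using x(1) by simp
  then show ?thesis using that x(2) by blast
qed

definition hom_words :: "int \<times> int \<times> int \<Rightarrow> nat \<Rightarrow> 'a set" where
  "hom_words d M = cspan {word_val w | w. word_deg w = d \<and> length w \<le> M}"

definition words_span :: "nat \<Rightarrow> 'a set" where
  "words_span M = cspan {word_val w | w. length w \<le> M}"

lemma hom_words_carrier: "x \<in> hom_words d M \<Longrightarrow> x \<in> carrier A"
  unfolding hom_words_def by (erule cspan_carrier[rotated]) auto

lemma words_span_carrier: "x \<in> words_span M \<Longrightarrow> x \<in> carrier A"
  unfolding words_span_def by (erule cspan_carrier[rotated]) auto

lemma csubspace_hom_words: "csubspace (hom_words d M)"
  unfolding hom_words_def by (rule csubspace_cspan) auto

lemma csubspace_words_span: "csubspace (words_span M)"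
  unfolding words_span_def by (rule csubspace_cspan) auto

lemma word_val_in_words_span: "length w \<le> M \<Longrightarrow> word_val w \<in> words_span M"
  unfolding words_span_def by (rule cspan_base) auto

lemma words_span_mult:
  assumes "x \<in> words_span M" "y \<in> words_span N" shows "x \<otimes> y \<in> words_span (M + N)"
proof (rule cspan_mult[OF csubspace_words_span])
  show "x \<in> cspan {word_val w | w. length w \<le> M}" "y \<in> cspan {word_val w | w. length w \<le> N}"
    using assms by (simp_all add: words_span_def)
  fix g g' assume "g \<in> {word_val w | w. length w \<le> M}" "g' \<in> {word_val w | w. length w \<le> N}"
  then obtain v w where "g = word_val v" "length v \<le> M" "g' = word_val w" "length w \<le> N" by blast
  then show "g \<otimes> g' \<in> words_span (M + N)"
    using word_val_in_words_span[of "v @ w" "M + N"] by simp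
qed auto

lemma words_span_star:
  assumes "x \<in> words_span M" shows "x\<^sup>\<star> \<in> words_span M"
proof (rule cspan_star[OF csubspace_words_span])
  show "x \<in> cspan {word_val w | w. length w \<le> M}" using assms by (simp add: words_span_def)
  fix g assume "g \<in> {word_val w | w. length w \<le> M}"
  then obtain w where "g = word_val w" "length w \<le> M" by blast
  then show "g\<^sup>\<star> \<in> words_span M"
    using word_val_in_words_span[of "word_star w" M] by (simp add: word_val_star)
qed auto

lemma words_span_mono:
  assumes "M \<le> N" "x \<in> words_span M" shows "x \<in> words_span N"
proof (rule cspan_least[OF csubspace_words_span])
  show "x \<in> cspan {word_val w | w. length w \<le> M}" using assms(2) by (simp add: words_span_def)
  show "{word_val w | w. length w \<le> M} \<subseteq> words_span N"
    using assms(1) by (auto intro: word_val_in_words_span)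
qed

text \<open>Degrees \<open>- d\<close> and \<open>d\<close> add up to zero, so the product is
  spanned by words of degree zero and length at most 2 M, hence lies in \<open>cpoly\<close>; being
  self-adjoint, it is a real polynomial.\<close>

lemma hom_words_star_mult:
  assumes "u \<in> hom_words d M" obtains f where "u\<^sup>\<star> \<otimes> u = peval c f" "degree f \<le> 2 * M"
proof -
  let ?G = "{word_val w | w. word_deg w = d \<and> length w \<le> M}"
  let ?G' = "{word_val w | w. word_deg w = - d \<and> length w \<le> M}"
  have "u\<^sup>\<star> \<in> cspan ?G'"
  proof (rule cspan_star[of _ ?G])
    show "csubspace (cspan ?G')" by (rule csubspace_cspan) auto
    show "u \<in> cspan ?G" using assms by (simp add: hom_words_def)
    fix g assume "g \<in> ?G"
    then obtain w where "g = word_val w" "word_deg w = d" "length w \<le> M" by blast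
    then have "g\<^sup>\<star> = word_val (word_star w)" "word_deg (word_star w) = - d" "length (word_star w) \<le> M"
      by (simp_all add: word_val_star)
    then have "g\<^sup>\<star> \<in> ?G'" by blast
    then show "g\<^sup>\<star> \<in> cspan ?G'" by (rule cspan_base[rotated]) auto
  qed auto
  moreover have "u \<in> cspan ?G" using assms by (simp add: hom_words_def)
  ultimately have "u\<^sup>\<star> \<otimes> u \<in> cpoly (2 * M)"
    by (rule cspan_mult[OF csubspace_cpoly, rotated 3])
       (auto simp flip: word_val_append intro!: word_val_cpoly)
  moreover have "u \<in> carrier A" using assms hom_words_carrier by blast
  ultimately show ?thesis using cpoly_selfadjoint[of "u\<^sup>\<star> \<otimes> u" "2 * M"] that by auto
qed

end

section \<open>Slices and vanishing of non-invariant words\<close>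

lemma unital_star_homD:
  assumes "f \<in> unital_star_hom A B"
  shows "x \<in> carrier A \<Longrightarrow> f x \<in> carrier B"
    and "x \<in> carrier A \<Longrightarrow> y \<in> carrier A \<Longrightarrow> f (x \<otimes>\<^bsub>A\<^esub> y) = f x \<otimes>\<^bsub>B\<^esub> f y"
    and "x \<in> carrier A \<Longrightarrow> y \<in> carrier A \<Longrightarrow> f (x \<oplus>\<^bsub>A\<^esub> y) = f x \<oplus>\<^bsub>B\<^esub> f y"
    and "f \<one>\<^bsub>A\<^esub> = \<one>\<^bsub>B\<^esub>"
    and "x \<in> carrier A \<Longrightarrow> f (z \<odot>\<^bsub>A\<^esub> x) = z \<odot>\<^bsub>B\<^esub> f x"
    and "x \<in> carrier A \<Longrightarrow> f (x\<^sup>\<star>\<^bsub>A\<^esub>) = (f x)\<^sup>\<star>\<^bsub>B\<^esub>"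
  using assms by (auto simp: unital_star_hom_def ring_hom_def complex_linear_def)

text \<open>\<open>S\<close> stands for the slice map \<open>h \<otimes> id\<close> when \<open>tn = tens\<close> and for \<open>id \<otimes> h\<close> when
  \<open>tn x y = tens y x\<close>. The endomorphism \<open>\<phi>\<close> will be a character (with values in the
  multiples of the identity) on the elements that matter.\<close>

locale slice_map = cstar_state A h + T: unital_cstar_algebra T
  for A :: "'a cstar_algebra" (structure) and h :: "'a \<Rightarrow> complex" and T :: "'t cstar_algebra" +
  fixes tn :: "'a \<Rightarrow> 'a \<Rightarrow> 't" and S :: "'t \<Rightarrow> 'a" and \<Delta> :: "'a \<Rightarrow> 't" and \<phi> :: "'a \<Rightarrow> 'a"
  assumes tn_closed [simp, intro]: "x \<in> carrier A \<Longrightarrow> y \<in> carrier A \<Longrightarrow> tn x y \<in> carrier T"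
    and tn_smult: "x \<in> carrier A \<Longrightarrow> y \<in> carrier A \<Longrightarrow> z \<odot>\<^bsub>T\<^esub> tn x y = tn (z \<odot> x) y"
    and tn_mult: "\<lbrakk>x \<in> carrier A; x' \<in> carrier A; y \<in> carrier A; y' \<in> carrier A\<rbrakk>
      \<Longrightarrow> tn x y \<otimes>\<^bsub>T\<^esub> tn x' y' = tn (x \<otimes> x') (y \<otimes> y')"
    and tn_star: "x \<in> carrier A \<Longrightarrow> y \<in> carrier A \<Longrightarrow> (tn x y)\<^sup>\<star>\<^bsub>T\<^esub> = tn (x\<^sup>\<star>) (y\<^sup>\<star>)"
    and tn_one: "tn \<one> \<one> = \<one>\<^bsub>T\<^esub>"
    and S_linear: "complex_linear T A S"
    and S_tn: "x \<in> carrier A \<Longrightarrow> y \<in> carrier A \<Longrightarrow> S (tn x y) = h x \<odot> y"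
    and \<Delta>_hom: "\<Delta> \<in> unital_star_hom A T"
    and S_\<Delta>: "x \<in> carrier A \<Longrightarrow> S (\<Delta> x) = h x \<odot> \<one>"
    and \<phi>_hom: "\<phi> \<in> unital_star_hom A A"
begin

lemmas \<phi>_simps = unital_star_homD[OF \<phi>_hom]
lemmas \<Delta>_simps = unital_star_homD[OF \<Delta>_hom]

lemma S_simps:
  "t \<in> carrier T \<Longrightarrow> S t \<in> carrier A"
  "t \<in> carrier T \<Longrightarrow> t' \<in> carrier T \<Longrightarrow> S (t \<oplus>\<^bsub>T\<^esub> t') = S t \<oplus> S t'"
  "t \<in> carrier T \<Longrightarrow> S (z \<odot>\<^bsub>T\<^esub> t) = z \<odot> S t"
  using S_linear by (auto simp: complex_linear_def)

lemma S_zero: "S \<zero>\<^bsub>T\<^esub> = \<zero>"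
  using S_simps(3)[of "\<zero>\<^bsub>T\<^esub>" 0] S_simps(1)[of "\<zero>\<^bsub>T\<^esub>"] by simp

text \<open>\<open>slices t x\<close> expresses \<open>(id \<otimes> \<phi>)(t) = x\<close> for elements \<open>t\<close> of the algebraic tensor
  product, which sidesteps the construction of the slice map of \<open>\<phi>\<close>.\<close>

inductive slices :: "'t \<Rightarrow> 'a \<Rightarrow> bool" where
  zero: "slices \<zero>\<^bsub>T\<^esub> \<zero>"
| step: "slices t x \<Longrightarrow> u \<in> carrier A \<Longrightarrow> v \<in> carrier A \<Longrightarrow> \<phi> v = z \<odot> \<one> \<Longrightarrow>
    slices (t \<oplus>\<^bsub>T\<^esub> tn u v) (x \<oplus> z \<odot> u)"

lemma slices_closed: assumes "slices t x" shows "t \<in> carrier T" "x \<in> carrier A"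
  using assms by (induction, simp_all)

text \<open>A Fubini statement: both sides are the product functional of \<open>h\<close> and
  \<open>\<phi>\<close> at \<open>t\<close>, evaluated in the two possible orders.\<close>

lemma slices_value: "slices t x \<Longrightarrow> \<phi> (S t) = h x \<odot> \<one>"
proof (induction rule: slices.induct)
  case zero
  then show ?case using \<phi>_simps(5)[of \<zero> 0] \<phi>_simps(1)[of \<zero>] by (simp add: S_zero)
next
  case (step t x u v z)
  then show ?case
    using slices_closed[OF step(1)]
    by (simp add: S_simps S_tn \<phi>_simps smult_add_left mult.commute)
qed

lemma slices_elem:
  assumes "u \<in> carrier A" "v \<in> carrier A" "\<phi> v = z \<odot> \<one>"
  shows "slices (tn u v) (z \<odot> u)"
  using slices.step[OF slices.zero assms] assms by simp

lemma slices_one: "slices \<one>\<^bsub>T\<^esub> \<one>"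
  using slices_elem[of \<one> \<one> 1] by (simp add: tn_one \<phi>_simps)

lemma slices_add:
  assumes "slices t x" "slices t' x'"
  shows "slices (t \<oplus>\<^bsub>T\<^esub> t') (x \<oplus> x')"
  using assms(2)
proof induction
  case zero
  then show ?case using assms(1) slices_closed[OF assms(1)] by simp
next
  case (step t' x' u v z)
  note cl = slices_closed[OF assms(1)] slices_closed[OF step(1)] step(2,3)
  have "t \<oplus>\<^bsub>T\<^esub> (t' \<oplus>\<^bsub>T\<^esub> tn u v) = (t \<oplus>\<^bsub>T\<^esub> t') \<oplus>\<^bsub>T\<^esub> tn u v"
    using cl by (simp add: T.a_assoc)
  moreover have "x \<oplus> (x' \<oplus> z \<odot> u) = (x \<oplus> x') \<oplus> z \<odot> u" using cl by (simp add: a_assoc)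
  ultimately show ?case using slices.step[OF step(5) step(2-4)] by simp
qed

lemma slices_mult:
  assumes "slices t x" "slices t' x'"
  shows "slices (t \<otimes>\<^bsub>T\<^esub> t') (x \<otimes> x')"
  using assms(2)
proof induction
  case zero
  then show ?case using slices_closed[OF assms(1)] by (simp add: slices.zero)
next
  case (step t' x' u v z)
  have *: "slices (t \<otimes>\<^bsub>T\<^esub> tn u v) (x \<otimes> (z \<odot> u))"
    using assms(1)
  proof induction
    case zero
    then show ?case using step by (simp add: slices.zero)
  next
    case (step s y u' v' z')
    note cl = slices_closed[OF step(1)] step(2,3) \<open>u \<in> carrier A\<close> \<open>v \<in> carrier A\<close>
    have "slices (tn (u' \<otimes> u) (v' \<otimes> v)) ((z' * z) \<odot> (u' \<otimes> u))"
      using cl step(4) \<open>\<phi> v = z \<odot> \<one>\<close> by (intro slices_elem) (simp_all add: \<phi>_simps mult.commute)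
    from slices_add[OF step(5) this] show ?case
      using cl by (simp add: T.l_distr l_distr tn_mult mult.commute smult_add_right)
  qed
  note cl = slices_closed[OF assms(1)] slices_closed[OF step(1)] step(2,3)
  from slices_add[OF step(5) *] show ?case
    using cl by (simp add: T.r_distr r_distr)
qed

lemma slices_star:
  assumes "slices t x" shows "slices (t\<^sup>\<star>\<^bsub>T\<^esub>) (x\<^sup>\<star>)"
  using assms
proof induction
  case zero then show ?case by (simp add: slices.zero)
next
  case (step t x u v z)
  note cl = slices_closed[OF step(1)] step(2,3)
  have "slices (tn (u\<^sup>\<star>) (v\<^sup>\<star>)) (cnj z \<odot> u\<^sup>\<star>)"
    using cl step(4) by (intro slices_elem) (simp_all add: \<phi>_simps)
  from slices_add[OF step(5) this] show ?case using cl by (simp add: tn_star)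
qed

text \<open>Invariance under translation by the character: an eigenvector with eigenvalue z
  satisfies h(x) = z h(x).\<close>

lemma h_eigenvalue:
  assumes "x \<in> carrier A" "slices (\<Delta> x) (z \<odot> x)" "z \<noteq> 1"
  shows "h x = 0"
proof -
  have "h x \<odot> \<one> = \<phi> (S (\<Delta> x))" using assms(1) by (simp add: S_\<Delta> \<phi>_simps)
  also have "\<dots> = h (z \<odot> x) \<odot> \<one>" by (rule slices_value[OF assms(2)])
  finally have "h x = z * h x" using assms(1) by (simp add: smult_one_eq_iff)
  then show ?thesis using assms(3) by simp
qed

end

text \<open>Translation by \<open>\<phi>\<close> multiplies each generator by a power of
  \<open>q\<close>, hence every word by \<open>q\<close> to its weight. As \<open>q\<close> is not a
  root of unity, only weight zero has eigenvalue 1.\<close>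

locale Uq2_slice_map = slice_map A h T tn S \<Delta> \<phi> + Uq2_algebra A q a b D
  for A :: "'a cstar_algebra" (structure) and h and T :: "'t cstar_algebra" and tn S \<Delta> \<phi> q a b D +
  fixes k1 k2 k3 :: int
  assumes slices_gens: "slices (\<Delta> a) (q powi k1 \<odot> a)" "slices (\<Delta> b) (q powi k2 \<odot> b)"
      "slices (\<Delta> D) (q powi k3 \<odot> D)"
    and not_root: "n > 0 \<Longrightarrow> q ^ (n::nat) \<noteq> 1"
begin

fun weight :: "int \<times> int \<times> int \<Rightarrow> int" where
  "weight (i, j, l) = k1 * i + k2 * j + k3 * l"

lemma weight_add: "weight (x + y) = weight x + weight y"
  by (cases x; cases y) (simp add: algebra_simps)

lemma slices_letter:
  "slices (\<Delta> (letter_val x)) (q powi weight (letter_deg x) \<odot> letter_val x)"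
proof -
  have st: "slices (\<Delta> (y\<^sup>\<star>)) (q powi (- k) \<odot> y\<^sup>\<star>)" if "slices (\<Delta> y) (q powi k \<odot> y)" "y \<in> carrier A" for y k
    using slices_star[OF that(1)] that(2) by (simp add: \<Delta>_simps cnj_q_powi)
  show ?thesis
    using slices_gens slices_gens[THEN st] by (cases x) simp_all
qed

lemma slices_word:
  "slices (\<Delta> (word_val w)) (q powi weight (word_deg w) \<odot> word_val w)"
proof (induction w)
  case Nil
  show ?case using slices_one by (simp add: \<Delta>_simps zero_prod_def)
next
  case (Cons x w)
  from slices_mult[OF slices_letter Cons, of x] show ?case
    by (simp add: \<Delta>_simps weight_add power_int_add mult.commute)
qed

lemma q_powi_eq_1: "q powi n = 1 \<longleftrightarrow> n = 0"
proof
  assume "q powi n = 1"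
  then have "q ^ nat \<bar>n\<bar> = 1"
    by (cases "n \<ge> 0") (auto simp: power_int_def power_inverse)
  then show "n = 0" using not_root[of "nat \<bar>n\<bar>"] by auto
qed simp

lemma h_word_weight: "weight (word_deg w) \<noteq> 0 \<Longrightarrow> h (word_val w) = 0"
  using h_eigenvalue[OF word_val_closed slices_word] by (simp add: q_powi_eq_1)

end

section \<open>The Haar state vanishes in nonzero degree and is a trace\<close>

locale Uq2_haar = Uq2_algebra A q a b D + cstar_state A h + T: unital_cstar_algebra T
  for A :: "'a cstar_algebra" (structure) and q a b D and h :: "'a \<Rightarrow> complex"
    and T :: "'t cstar_algebra" +
  fixes tens :: "'a \<Rightarrow> 'a \<Rightarrow> 't" and \<Delta> :: "'a \<Rightarrow> 't"
  assumes not_root: "n > 0 \<Longrightarrow> q ^ (n::nat) \<noteq> 1"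
    and universal: "is_C_Uq2 q A a b D"
    and tensor: "min_tensor_product A A T tens"
    and comult: "Uq2_comultiplication q A a b D T tens \<Delta>"
    and haar: "haar_state A T tens \<Delta> h"
begin

text \<open>A character is realized as an endomorphism with values in the multiples of the unit, so
  \<open>A\<close> itself serves as the test algebra in the universal property.\<close>

lemma character:
  assumes "cmod s = 1" "cmod t = 1"
  obtains \<phi> where "\<phi> \<in> unital_star_hom A A" "\<phi> a = s \<odot> \<one>" "\<phi> b = 0 \<odot> \<one>" "\<phi> D = t \<odot> \<one>"
proof -
  have "s * cnj s = 1" "t * cnj t = 1"
    using assms by (simp_all add: complex_norm_square[symmetric])
  then have "Uq2_relations q A (s \<odot> \<one>) \<zero> (t \<odot> \<one>)"
    by (simp add: Uq2_relations_def mult.commute)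
  then show ?thesis
    using universal unital_cstar_algebra_axioms that unfolding is_C_Uq2_def by (metis smult_0 one_closed)
qed

lemma tens_linear_left: "y \<in> carrier A \<Longrightarrow> complex_linear A T (\<lambda>x. tens x y)"
  by (rule min_tensor_product.tens_linear_left[OF tensor])

lemma tens_linear_right: "x \<in> carrier A \<Longrightarrow> complex_linear A T (tens x)"
  by (rule min_tensor_product.tens_linear_right[OF tensor])

lemma tens_closed [simp, intro]: "x \<in> carrier A \<Longrightarrow> y \<in> carrier A \<Longrightarrow> tens x y \<in> carrier T"
  using tens_linear_right[of x] by (auto simp: complex_linear_def)

lemma tens_smult:
  "x \<in> carrier A \<Longrightarrow> y \<in> carrier A \<Longrightarrow> z \<odot>\<^bsub>T\<^esub> tens x y = tens (z \<odot> x) y"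
  "x \<in> carrier A \<Longrightarrow> y \<in> carrier A \<Longrightarrow> z \<odot>\<^bsub>T\<^esub> tens x y = tens x (z \<odot> y)"
  using tens_linear_right[of x] tens_linear_left[of y] by (auto simp: complex_linear_def)

lemmas tens_mult = min_tensor_product.tens_mult[OF tensor]
lemmas tens_star = min_tensor_product.tens_star[OF tensor]
lemmas tens_one = min_tensor_product.tens_one[OF tensor]

lemma \<Delta>_hom: "\<Delta> \<in> unital_star_hom A T"
  using comult by (simp add: Uq2_comultiplication_def)

lemma \<Delta>_a: "\<Delta> a = tens a a \<oplus>\<^bsub>T\<^esub> tens ((- cnj q) \<odot> b) (D \<otimes> b\<^sup>\<star>)"
  using comult by (simp add: Uq2_comultiplication_def T.diff_smult tens_smult(1))

lemma \<Delta>_b: "\<Delta> b = tens a b \<oplus>\<^bsub>T\<^esub> tens b (D \<otimes> a\<^sup>\<star>)"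
  using comult by (simp add: Uq2_comultiplication_def)

lemma \<Delta>_D: "\<Delta> D = tens D D"
  using comult by (simp add: Uq2_comultiplication_def)

lemma left_slice:
  obtains S where "complex_linear T A S"
    "\<And>x y. x \<in> carrier A \<Longrightarrow> y \<in> carrier A \<Longrightarrow> S (tens x y) = h x \<odot> y"
    "\<And>x. x \<in> carrier A \<Longrightarrow> S (\<Delta> x) = h x \<odot> \<one>"
proof -
  obtain S where S: "complex_linear T A S"
    "\<forall>x\<in>carrier A. \<forall>y\<in>carrier A. S (tens x y) = h x \<odot> y" "\<forall>x\<in>carrier A. S (\<Delta> x) = h x \<odot> \<one>"
    using haar unfolding haar_state_def slice_left_def bounded_complex_linear_def by blast
  show ?thesis by (rule that[of S]) (use S in blast)+
qed

lemma right_slice: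
  obtains S where "complex_linear T A S"
    "\<And>x y. x \<in> carrier A \<Longrightarrow> y \<in> carrier A \<Longrightarrow> S (tens y x) = h x \<odot> y"
    "\<And>x. x \<in> carrier A \<Longrightarrow> S (\<Delta> x) = h x \<odot> \<one>"
proof -
  obtain S where S: "complex_linear T A S"
    "\<forall>x\<in>carrier A. \<forall>y\<in>carrier A. S (tens x y) = h y \<odot> x" "\<forall>x\<in>carrier A. S (\<Delta> x) = h x \<odot> \<one>"
    using haar unfolding haar_state_def slice_right_def bounded_complex_linear_def by blast
  show ?thesis by (rule that[of S]) (use S in blast)+
qed

text \<open>Three translations suffice. On a word of degree (i, j, l), the character with
  \<open>a\<close> to \<open>q\<close> acts with weight i - j through the second leg
  (\<open>L\<close>) and i + j through the first (\<open>R\<close>); the character with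
  \<open>D\<close> to \<open>q\<close> has weight l (\<open>R'\<close>). All three weights vanish
  only in degree zero.\<close>

lemma h_word:
  assumes "word_deg w \<noteq> 0" shows "h (word_val w) = 0"
proof -
  obtain S where S: "complex_linear T A S"
    "\<And>x y. x \<in> carrier A \<Longrightarrow> y \<in> carrier A \<Longrightarrow> S (tens x y) = h x \<odot> y"
    "\<And>x. x \<in> carrier A \<Longrightarrow> S (\<Delta> x) = h x \<odot> \<one>" using left_slice by blast
  obtain S' where S': "complex_linear T A S'"
    "\<And>x y. x \<in> carrier A \<Longrightarrow> y \<in> carrier A \<Longrightarrow> S' (tens y x) = h x \<odot> y"
    "\<And>x. x \<in> carrier A \<Longrightarrow> S' (\<Delta> x) = h x \<odot> \<one>" using right_slice by blast
  obtain \<phi> where \<phi>: "\<phi> \<in> unital_star_hom A A" "\<phi> a = q \<odot> \<one>" "\<phi> b = 0 \<odot> \<one>" "\<phi> D = 1 \<odot> \<one>"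
    using character[of q 1] cmod_q by auto
  obtain \<psi> where \<psi>: "\<psi> \<in> unital_star_hom A A" "\<psi> a = 1 \<odot> \<one>" "\<psi> b = 0 \<odot> \<one>" "\<psi> D = q \<odot> \<one>"
    using character[of 1 q] cmod_q by auto
  note \<phi>s = unital_star_homD[OF \<phi>(1)] \<phi>(2-4) and \<psi>s = unital_star_homD[OF \<psi>(1)] \<psi>(2-4)
  interpret L: slice_map A h T tens S \<Delta> \<phi>
    by unfold_locales (simp_all add: tens_smult(1) tens_mult tens_star tens_one \<Delta>_hom S \<phi>(1))
  interpret R: slice_map A h T "\<lambda>x y. tens y x" S' \<Delta> \<phi>
    by unfold_locales (simp_all add: tens_smult(2) tens_mult tens_star tens_one \<Delta>_hom S' \<phi>(1))
  interpret R': slice_map A h T "\<lambda>x y. tens y x" S' \<Delta> \<psi>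
    by unfold_locales (simp_all add: tens_smult(2) tens_mult tens_star tens_one \<Delta>_hom S' \<psi>(1))
  have La: "L.slices (\<Delta> a) (q \<odot> a)"
    using L.slices_add[OF L.slices_elem[of a a q] L.slices_elem[of "(- cnj q) \<odot> b" "D \<otimes> b\<^sup>\<star>" 0]]
    by (simp add: \<Delta>_a \<phi>s)
  have Lb: "L.slices (\<Delta> b) (inverse q \<odot> b)"
    using L.slices_add[OF L.slices_elem[of a b 0] L.slices_elem[of b "D \<otimes> a\<^sup>\<star>" "inverse q"]]
    by (simp add: \<Delta>_b \<phi>s cnj_q)
  have LD: "L.slices (\<Delta> D) (1 \<odot> D)"
    using L.slices_elem[of D D 1] by (simp add: \<Delta>_D \<phi>s)
  interpret L: Uq2_slice_map A h T tens S \<Delta> \<phi> q a b D 1 "-1" 0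
    by unfold_locales (use La Lb LD not_root in \<open>simp_all add: power_int_minus\<close>)
  have \<Delta>_a': "\<Delta> a = tens a a \<oplus>\<^bsub>T\<^esub> tens b ((- cnj q) \<odot> (D \<otimes> b\<^sup>\<star>))"
    unfolding \<Delta>_a by (simp flip: tens_smult)
  have Ra: "R.slices (\<Delta> a) (q \<odot> a)"
    using R.slices_add[OF R.slices_elem[of a a q] R.slices_elem[of "(- cnj q) \<odot> (D \<otimes> b\<^sup>\<star>)" b 0]]
    by (simp add: \<Delta>_a' \<phi>s)
  have Rb: "R.slices (\<Delta> b) (q \<odot> b)"
    using R.slices_add[OF R.slices_elem[of b a q] R.slices_elem[of "D \<otimes> a\<^sup>\<star>" b 0]]
    by (simp add: \<Delta>_b \<phi>s)
  have RD: "R.slices (\<Delta> D) (1 \<odot> D)"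
    using R.slices_elem[of D D 1] by (simp add: \<Delta>_D \<phi>s)
  interpret R: Uq2_slice_map A h T "\<lambda>x y. tens y x" S' \<Delta> \<phi> q a b D 1 1 0
    by unfold_locales (use Ra Rb RD not_root in simp_all)
  have Ra': "R'.slices (\<Delta> a) (1 \<odot> a)"
    using R'.slices_add[OF R'.slices_elem[of a a 1] R'.slices_elem[of "(- cnj q) \<odot> (D \<otimes> b\<^sup>\<star>)" b 0]]
    by (simp add: \<Delta>_a' \<psi>s)
  have Rb': "R'.slices (\<Delta> b) (1 \<odot> b)"
    using R'.slices_add[OF R'.slices_elem[of b a 1] R'.slices_elem[of "D \<otimes> a\<^sup>\<star>" b 0]]
    by (simp add: \<Delta>_b \<psi>s)
  have RD': "R'.slices (\<Delta> D) (q \<odot> D)"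
    using R'.slices_elem[of D D q] by (simp add: \<Delta>_D \<psi>s)
  interpret R': Uq2_slice_map A h T "\<lambda>x y. tens y x" S' \<Delta> \<psi> q a b D 0 0 1
    by unfold_locales (use Ra' Rb' RD' not_root in simp_all)
  obtain i j l where d: "word_deg w = (i, j, l)" by (cases "word_deg w")
  have "i - j \<noteq> 0 \<or> i + j \<noteq> 0 \<or> l \<noteq> 0" using assms d by (auto simp: zero_prod_def)
  then show ?thesis
    using L.h_word_weight[of w] R.h_word_weight[of w] R'.h_word_weight[of w] d by auto
qed

text \<open>Generation is stated through closed star subalgebras, so the set of norm limits of word
  combinations is shown to be one.\<close>

lemma words_dense:
  assumes "x \<in> carrier A" "e > 0"
  shows "\<exists>M. \<exists>z\<in>words_span M. \<parallel>x \<ominus> z\<parallel> < e"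
proof -
  define X where "X = {x \<in> carrier A. \<forall>e>0. \<exists>M. \<exists>z\<in>words_span M. \<parallel>x \<ominus> z\<parallel> < e}"
  have XI: "x \<in> X" if "x \<in> carrier A" "\<And>e. e > 0 \<Longrightarrow> \<exists>M z. z \<in> words_span M \<and> \<parallel>x \<ominus> z\<parallel> < e" for x
    using that unfolding X_def by blast
  have XD: "\<exists>M z. z \<in> words_span M \<and> z \<in> carrier A \<and> \<parallel>x \<ominus> z\<parallel> < e" if "x \<in> X" "e > 0" for x e
    using that words_span_carrier unfolding X_def by blast
  have Xc: "x \<in> carrier A" if "x \<in> X" for x using that by (simp add: X_def)
  have word: "word_val w \<in> X" for w
  proof (rule XI)
    fix e :: real assume "e > 0"
    then have "\<parallel>word_val w \<ominus> word_val w\<parallel> < e" by (simp add: a_minus_def r_neg)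
    then show "\<exists>M z. z \<in> words_span M \<and> \<parallel>word_val w \<ominus> z\<parallel> < e"
      using word_val_in_words_span[OF order_refl] by blast
  qed simp
  have "closed_star_subalgebra A X"
    unfolding closed_star_subalgebra_def
  proof (intro conjI ballI allI impI)
    show "X \<subseteq> carrier A" using Xc by blast
    show "\<one> \<in> X" using word[of "[]"] by simp
  next
    fix x y assume x: "x \<in> X" and y: "y \<in> X"
    show "x \<oplus> y \<in> X"
    proof (rule XI)
      fix e :: real assume "e > 0"
      then obtain M z N w where z: "z \<in> words_span M" "z \<in> carrier A" "\<parallel>x \<ominus> z\<parallel> < e / 2"
        and w: "w \<in> words_span N" "w \<in> carrier A" "\<parallel>y \<ominus> w\<parallel> < e / 2"
        using XD[OF x, of "e / 2"] XD[OF y, of "e / 2"] by auto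
      have "(x \<oplus> y) \<ominus> (z \<oplus> w) = (x \<ominus> z) \<oplus> (y \<ominus> w)"
        using Xc[OF x] Xc[OF y] z(2) w(2) by algebra
      then have "\<parallel>(x \<oplus> y) \<ominus> (z \<oplus> w)\<parallel> < e"
        using norm_triangle[of "x \<ominus> z" "y \<ominus> w"] Xc[OF x] Xc[OF y] z w by simp
      moreover have "z \<oplus> w \<in> words_span (max M N)"
        using z(1) w(1) csubspaceD(3)[OF csubspace_words_span] words_span_mono[of M "max M N" z]
          words_span_mono[of N "max M N" w] by simp
      ultimately show "\<exists>M z. z \<in> words_span M \<and> \<parallel>(x \<oplus> y) \<ominus> z\<parallel> < e" by blast
    qed (use Xc x y in simp)
    show "x \<otimes> y \<in> X"
    proof (rule XI)
      fix e :: real assume e: "e > 0"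
      \<comment> \<open>This bounds the norm of \<open>x\<close> and also that of \<open>w\<close>,
        which is chosen within distance 1 of \<open>y\<close>.\<close>
      define K where "K = \<parallel>x\<parallel> + \<parallel>y\<parallel> + 1"
      have K: "K \<ge> 1" "K > 0" using Xc[OF x] Xc[OF y] by (simp_all add: K_def add_nonneg_pos)
      obtain N w where w: "w \<in> words_span N" "w \<in> carrier A" "\<parallel>y \<ominus> w\<parallel> < min 1 (e / (2 * K))"
        using XD[OF y, of "min 1 (e / (2 * K))"] e K by auto
      obtain M z where z: "z \<in> words_span M" "z \<in> carrier A" "\<parallel>x \<ominus> z\<parallel> < e / (2 * K)"
        using XD[OF x, of "e / (2 * K)"] e K by auto
      have wK: "\<parallel>w\<parallel> \<le> K"
        using norm_le_diff[OF w(2) Xc[OF y]] norm_diff_commute[OF w(2) Xc[OF y]] w(3) norm_nonneg[OF Xc[OF x]]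
        unfolding K_def by linarith
      have "x \<otimes> y \<ominus> z \<otimes> w = x \<otimes> (y \<ominus> w) \<oplus> (x \<ominus> z) \<otimes> w"
        using Xc[OF x] Xc[OF y] z(2) w(2) by algebra
      then have "\<parallel>x \<otimes> y \<ominus> z \<otimes> w\<parallel> \<le> \<parallel>x\<parallel> * \<parallel>y \<ominus> w\<parallel> + \<parallel>x \<ominus> z\<parallel> * \<parallel>w\<parallel>"
        using norm_triangle[of "x \<otimes> (y \<ominus> w)" "(x \<ominus> z) \<otimes> w"] norm_mult_le[of x "y \<ominus> w"]
          norm_mult_le[of "x \<ominus> z" w] Xc[OF x] Xc[OF y] z w by simp
      also have "\<dots> \<le> K * \<parallel>y \<ominus> w\<parallel> + \<parallel>x \<ominus> z\<parallel> * K"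
        using wK Xc[OF x] Xc[OF y] z w by (intro add_mono mult_mono) (simp_all add: K_def)
      also have "\<dots> < K * (e / (2 * K)) + e / (2 * K) * K"
        using w z K by (intro add_strict_mono mult_strict_left_mono mult_strict_right_mono) auto
      also have "\<dots> = e" using K by (simp add: field_simps)
      finally show "\<exists>M z. z \<in> words_span M \<and> \<parallel>x \<otimes> y \<ominus> z\<parallel> < e"
        using words_span_mult[OF z(1) w(1)] by blast
    qed (use Xc x y in simp)
  next
    fix k x assume x: "x \<in> X"
    show "k \<odot> x \<in> X"
    proof (rule XI)
      fix e :: real assume e: "e > 0"
      define K where "K = cmod k + 1"
      have K: "K > 0" "cmod k \<le> K" by (simp_all add: K_def add_nonneg_pos)
      obtain M z where z: "z \<in> words_span M" "z \<in> carrier A" "\<parallel>x \<ominus> z\<parallel> < e / K"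
        using XD[OF x, of "e / K"] e K by auto
      have "k \<odot> x \<ominus> k \<odot> z = k \<odot> (x \<ominus> z)"
        using Xc[OF x] z by (simp add: diff_smult smult_add_right mult.commute)
      then have "\<parallel>k \<odot> x \<ominus> k \<odot> z\<parallel> = cmod k * \<parallel>x \<ominus> z\<parallel>" using Xc[OF x] z by simp
      also have "\<dots> \<le> K * \<parallel>x \<ominus> z\<parallel>" using K Xc[OF x] z by (intro mult_right_mono) auto
      also have "\<dots> < e" using z K by (simp add: field_simps)
      finally show "\<exists>M z. z \<in> words_span M \<and> \<parallel>k \<odot> x \<ominus> z\<parallel> < e"
        using csubspaceD(4)[OF csubspace_words_span z(1)] by blast
    qed (use Xc x in simp)
  next
    fix x assume x: "x \<in> X"
    show "x\<^sup>\<star> \<in> X"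
    proof (rule XI)
      fix e :: real assume "e > 0"
      then obtain M z where z: "z \<in> words_span M" "z \<in> carrier A" "\<parallel>x \<ominus> z\<parallel> < e"
        using XD[OF x] by blast
      have "\<parallel>x\<^sup>\<star> \<ominus> z\<^sup>\<star>\<parallel> = \<parallel>(x \<ominus> z)\<^sup>\<star>\<parallel>" using Xc[OF x] z by simp
      also have "\<dots> = \<parallel>x \<ominus> z\<parallel>" using Xc[OF x] z by (intro norm_star) simp
      finally have "\<parallel>x\<^sup>\<star> \<ominus> z\<^sup>\<star>\<parallel> < e" using z(3) by simp
      then show "\<exists>M z. z \<in> words_span M \<and> \<parallel>x\<^sup>\<star> \<ominus> z\<parallel> < e"
        using words_span_star[OF z(1)] by blast
    qed (use Xc x in simp)
  next
    fix \<sigma> :: "nat \<Rightarrow> 'a" and x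
    assume x: "x \<in> carrier A" and \<sigma>: "range \<sigma> \<subseteq> X" and lim: "(\<lambda>n. \<parallel>\<sigma> n \<ominus> x\<parallel>) \<longlonglongrightarrow> 0"
    show "x \<in> X"
    proof (rule XI)
      fix e :: real assume e: "e > 0"
      then have "\<forall>\<^sub>F n in sequentially. \<parallel>\<sigma> n \<ominus> x\<parallel> < e / 2"
        using order_tendstoD(2)[OF lim, of "e / 2"] by simp
      then obtain n where n: "\<parallel>\<sigma> n \<ominus> x\<parallel> < e / 2" by (auto simp: eventually_sequentially)
      have s: "\<sigma> n \<in> X" using \<sigma> by blast
      obtain M z where z: "z \<in> words_span M" "z \<in> carrier A" "\<parallel>\<sigma> n \<ominus> z\<parallel> < e / 2"
        using XD[OF s, of "e / 2"] e by auto
      have "\<parallel>x \<ominus> z\<parallel> < e"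
        using norm_diff_trans[of x "\<sigma> n" z] norm_diff_commute[of x "\<sigma> n"] x Xc[OF s] z n by simp
      then show "\<exists>M z. z \<in> words_span M \<and> \<parallel>x \<ominus> z\<parallel> < e" using z(1) by blast
    qed (use x in simp)
  qed
  moreover have "{a, b, D} \<subseteq> X"
    using word[of "[La]"] word[of "[Lb]"] word[of "[LD]"] by simp
  ultimately have "X = carrier A"
    using universal unfolding is_C_Uq2_def cstar_generates_def by blast
  then show ?thesis using assms unfolding X_def by blast
qed

text \<open>Two words of opposite degree commute because \<open>omega\<close> is alternating;
  otherwise both products have nonzero degree and \<open>h\<close> kills them. The passage to
  limits, \<open>dense\<close>, is used twice: first against a fixed word, then against an arbitrary
  element.\<close>

lemma h_trace:
  assumes "x \<in> carrier A" "y \<in> carrier A"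
  shows "h (x \<otimes> y) = h (y \<otimes> x)"
proof -
  have words: "h (word_val v \<otimes> word_val w) = h (word_val w \<otimes> word_val v)" for v w
  proof (cases "word_deg w = - word_deg v")
    case True
    then show ?thesis by (simp add: word_val_commute[of v w])
  next
    case False
    then have "word_deg v + word_deg w \<noteq> 0" by (metis add_eq_0_iff)
    then show ?thesis
      using h_word[of "v @ w"] h_word[of "w @ v"] by (simp add: add.commute)
  qed
  have sub: "csubspace {x \<in> carrier A. h (x \<otimes> y) = h (y \<otimes> x)}" if "y \<in> carrier A" for y
    using that by (auto simp: csubspace_def l_distr r_distr)
  have span: "h (x \<otimes> y) = h (y \<otimes> x)"
    if "\<And>w. h (word_val w \<otimes> y) = h (y \<otimes> word_val w)" "y \<in> carrier A" "x \<in> words_span M" for x y M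
    using cspan_least[OF sub[OF that(2)] _ that(3)[unfolded words_span_def]] that(1) by auto
  have dense: "h (x \<otimes> y) = h (y \<otimes> x)"
    if w: "\<And>w. h (word_val w \<otimes> y) = h (y \<otimes> word_val w)" and y: "y \<in> carrier A" and x: "x \<in> carrier A" for x y
  proof -
    have "cmod (h (x \<otimes> y) - h (y \<otimes> x)) \<le> 0 + e" if e: "e > 0" for e
    proof -
      define K where "K = 2 * \<parallel>y\<parallel> + 1"
      have K: "K > 0" using y by (simp add: K_def add_nonneg_pos)
      obtain M z where z: "z \<in> words_span M" "\<parallel>x \<ominus> z\<parallel> < e / K"
        using words_dense[OF x, of "e / K"] e K by auto
      then have zc: "z \<in> carrier A" using words_span_carrier by blast
      have xz: "x \<ominus> z \<in> carrier A" using x zc by simp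
      have "h (x \<otimes> y) - h (y \<otimes> x) = h ((x \<ominus> z) \<otimes> y) - h (y \<otimes> (x \<ominus> z))"
        using span[OF w y z(1)] x y zc by (simp add: diff_smult l_distr r_distr)
      also have "cmod \<dots> \<le> \<parallel>x \<ominus> z\<parallel> * \<parallel>y\<parallel> + \<parallel>y\<parallel> * \<parallel>x \<ominus> z\<parallel>"
        using norm_triangle_ineq4[of "h ((x \<ominus> z) \<otimes> y)" "h (y \<otimes> (x \<ominus> z))"]
          h_bounded[OF m_closed[OF xz y]] h_bounded[OF m_closed[OF y xz]]
          norm_mult_le[OF xz y] norm_mult_le[OF y xz] by linarith
      also have "\<dots> = \<parallel>x \<ominus> z\<parallel> * (2 * \<parallel>y\<parallel>)" by simp
      also have "\<dots> \<le> \<parallel>x \<ominus> z\<parallel> * K" using x zc by (intro mult_left_mono) (simp_all add: K_def)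
      also have "\<dots> \<le> e" using z(2) K by (simp add: field_simps)
      finally show ?thesis by simp
    qed
    then have "cmod (h (x \<otimes> y) - h (y \<otimes> x)) \<le> 0" by (rule field_le_epsilon)
    then show ?thesis by simp
  qed
  have "h (word_val w \<otimes> x) = h (x \<otimes> word_val w)" if "x \<in> carrier A" for w x
    using dense[of "word_val w" x] words that by simp
  then show ?thesis using dense assms by metis
qed

end

section \<open>Moments of the central element\<close>

context unital_cstar_algebra
begin

lemma finsum_smult_const:
  assumes "finite K" "x \<in> carrier A"
  shows "(\<Oplus>i\<in>K. f i \<odot> x) = (\<Sum>i\<in>K. f i) \<odot> x"
  using assms(1)
proof induction
  case (insert i K)
  then show ?case using assms(2) by (simp add: smult_add_left)
qed (use assms in simp)

lemma norm_finsum_le: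
  assumes "finite F" "u \<in> F \<rightarrow> carrier A"
  shows "\<parallel>\<Oplus>i\<in>F. u i\<parallel> \<le> (\<Sum>i\<in>F. \<parallel>u i\<parallel>)"
  using assms
proof induction
  case (insert i F)
  have c: "u i \<in> carrier A" "(\<Oplus>j\<in>F. u j) \<in> carrier A" using insert.prems by (auto intro!: finsum_closed)
  have "(\<Oplus>j\<in>insert i F. u j) = u i \<oplus> (\<Oplus>j\<in>F. u j)"
    using insert by (intro finsum_insert) auto
  then show ?case using norm_triangle[OF c] insert by simp
qed simp

lemma smult_pow: "x \<in> carrier A \<Longrightarrow> (z \<odot> x) [^] (k::nat) = z ^ k \<odot> x [^] k"
  by (induction k) (simp_all add: mult.commute)

lemma pow_commute:
  assumes "X \<in> carrier A" "Y \<in> carrier A" "X \<otimes> Y = Y \<otimes> X"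
  shows "Y [^] (k::nat) \<otimes> X = X \<otimes> Y [^] k"
proof (induction k)
  case (Suc k)
  have "Y [^] Suc k \<otimes> X = Y [^] k \<otimes> (Y \<otimes> X)" using assms(1,2) by (simp add: m_assoc)
  also have "\<dots> = (Y [^] k \<otimes> X) \<otimes> Y" unfolding assms(3)[symmetric] using assms(1,2) by (simp add: m_assoc)
  also have "\<dots> = X \<otimes> Y [^] Suc k" unfolding Suc using assms(1,2) by (simp add: m_assoc)
  finally show ?case .
qed (use assms in simp)

lemma binomial_expansion:
  assumes X: "X \<in> carrier A" and Y: "Y \<in> carrier A" and comm: "X \<otimes> Y = Y \<otimes> X"
  shows "(X \<oplus> Y) [^] (n::nat) = (\<Oplus>k\<in>{..n}. of_nat (n choose k) \<odot> (X [^] (n - k) \<otimes> Y [^] k))"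
proof (induction n)
  case 0
  then show ?case using X Y by simp
next
  case (Suc n)
  define M where "M = (\<lambda>k. X [^] (Suc n - k) \<otimes> Y [^] k)"
  have M [simp]: "M k \<in> carrier A" for k using X Y by (simp add: M_def)
  let ?B = "\<lambda>k. of_nat (n choose k) \<odot> (X [^] (n - k) \<otimes> Y [^] k)"
  have B: "?B \<in> {..n} \<rightarrow> carrier A" using X Y by auto
  have 1: "(\<Oplus>k\<in>{..n}. ?B k) \<otimes> X = (\<Oplus>k\<in>{..Suc n}. of_nat (n choose k) \<odot> M k)"
  proof -
    have "(\<Oplus>k\<in>{..n}. ?B k) \<otimes> X = (\<Oplus>k\<in>{..n}. ?B k \<otimes> X)"
      by (rule finsum_ldistr) (use X B in auto)
    also have "\<dots> = (\<Oplus>k\<in>{..n}. of_nat (n choose k) \<odot> M k)"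
    proof (rule finsum_cong')
      fix k assume "k \<in> {..n}"
      then have "X [^] (Suc n - k) = X [^] (n - k) \<otimes> X" by (simp add: Suc_diff_le)
      then show "?B k \<otimes> X = of_nat (n choose k) \<odot> M k"
        using X Y pow_commute[OF X Y comm, of k] by (simp add: M_def m_assoc)
    qed auto
    also have "\<dots> = (\<Oplus>k\<in>{..Suc n}. of_nat (n choose k) \<odot> M k)"
      by (subst finsum_Suc) (auto simp: binomial_eq_0 intro!: finsum_closed)
    finally show ?thesis .
  qed
  \<comment> \<open>The shifted half of Pascal's rule; the value 0 at k = 0 lets both sums run over
    the same range.\<close>
  define g where "g = (\<lambda>k. (if k = 0 then 0 else of_nat (n choose (k - 1)) :: complex) \<odot> M k)"
  have 2: "(\<Oplus>k\<in>{..n}. ?B k) \<otimes> Y = (\<Oplus>k\<in>{..Suc n}. g k)"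
  proof -
    have "(\<Oplus>k\<in>{..n}. ?B k) \<otimes> Y = (\<Oplus>k\<in>{..n}. ?B k \<otimes> Y)"
      by (rule finsum_ldistr) (use Y B in auto)
    also have "\<dots> = (\<Oplus>k\<in>{..n}. g (Suc k))"
      by (rule finsum_cong') (use X Y in \<open>auto simp: g_def M_def m_assoc\<close>)
    also have "\<dots> = (\<Oplus>k\<in>{..Suc n}. g k)"
      by (subst finsum_Suc2) (auto simp: g_def intro!: finsum_closed)
    finally show ?thesis .
  qed
  have "(X \<oplus> Y) [^] Suc n = (\<Oplus>k\<in>{..n}. ?B k) \<otimes> X \<oplus> (\<Oplus>k\<in>{..n}. ?B k) \<otimes> Y"
    using X Y B Suc by (simp add: r_distr)
  also have "\<dots> = (\<Oplus>k\<in>{..Suc n}. of_nat (n choose k) \<odot> M k \<oplus> g k)"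
    unfolding 1 2 by (rule finsum_addf[symmetric]) (auto simp: g_def)
  also have "\<dots> = (\<Oplus>k\<in>{..Suc n}. of_nat (Suc n choose k) \<odot> M k)"
  proof (rule finsum_cong')
    fix k
    show "of_nat (n choose k) \<odot> M k \<oplus> g k = of_nat (Suc n choose k) \<odot> M k"
      by (cases k) (simp_all add: g_def add.commute flip: smult_add_left)
  qed auto
  finally show ?case unfolding M_def .
qed

end

section \<open>The normal element ab and the phases in the coproduct of monomials\<close>

context Uq2_algebra
begin

text \<open>A normal square root of c (1 - c), as the Chebyshev estimates require.\<close>

definition y :: 'a where "y = a \<otimes> b"

lemma y_closed [simp, intro]: "y \<in> carrier A"
  by (simp add: y_def)

lemma y_normal: "y\<^sup>\<star> \<otimes> y = c \<otimes> (\<one> \<ominus> c)" "y \<otimes> y\<^sup>\<star> = y\<^sup>\<star> \<otimes> y"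
proof -
  have cc: "c \<otimes> (\<one> \<ominus> c) = (\<one> \<ominus> c) \<otimes> c" by (simp add: a_minus_def r_distr l_distr r_minus l_minus)
  have "y\<^sup>\<star> \<otimes> y = b\<^sup>\<star> \<otimes> (a\<^sup>\<star> \<otimes> a) \<otimes> b" by (simp add: y_def m_assoc)
  also have "\<dots> = (b\<^sup>\<star> \<otimes> (\<one> \<ominus> c)) \<otimes> b" by (simp only: aa_star)
  also have "b\<^sup>\<star> \<otimes> (\<one> \<ominus> c) = (\<one> \<ominus> c) \<otimes> b\<^sup>\<star>"
    using c_commute_gens(5) by (simp add: a_minus_def r_distr l_distr r_minus l_minus)
  also have "(\<one> \<ominus> c) \<otimes> b\<^sup>\<star> \<otimes> b = (\<one> \<ominus> c) \<otimes> c" by (simp add: m_assoc rel(3))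
  finally show 1: "y\<^sup>\<star> \<otimes> y = c \<otimes> (\<one> \<ominus> c)" by (simp only: cc)
  have "y \<otimes> y\<^sup>\<star> = a \<otimes> (b \<otimes> b\<^sup>\<star>) \<otimes> a\<^sup>\<star>" by (simp add: y_def m_assoc)
  also have "\<dots> = (a \<otimes> c) \<otimes> a\<^sup>\<star>" by (simp only: c_def[symmetric])
  also have "\<dots> = c \<otimes> (a \<otimes> a\<^sup>\<star>)" unfolding c_commute_gens(1)[symmetric] by (simp add: m_assoc)
  finally show "y \<otimes> y\<^sup>\<star> = y\<^sup>\<star> \<otimes> y" unfolding 1 by (simp only: aa_star)
qed

lemma y_c: "y \<otimes> c = c \<otimes> y"
  using c_central[of "[La, Lb]"] by (simp add: y_def)

lemma left_leg:
  "(a [^] m \<otimes> b [^] k) \<otimes> (a\<^sup>\<star> [^] m \<otimes> b\<^sup>\<star> [^] k) = q powi (- (int m * int k)) \<odot> ((\<one> \<ominus> c) [^] (m::nat) \<otimes> c [^] (k::nat))"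
proof -
  have comm: "b [^] k \<otimes> a\<^sup>\<star> [^] m = q powi (- (int m * int k)) \<odot> (a\<^sup>\<star> [^] m \<otimes> b [^] k)"
    using word_val_commute[of "replicate k Lb" "replicate m La'"] by (simp add: word_deg_replicate mult.commute)
  have "(a [^] m \<otimes> b [^] k) \<otimes> (a\<^sup>\<star> [^] m \<otimes> b\<^sup>\<star> [^] k) = a [^] m \<otimes> (b [^] k \<otimes> a\<^sup>\<star> [^] m) \<otimes> b\<^sup>\<star> [^] k"
    by (simp add: m_assoc)
  also have "\<dots> = q powi (- (int m * int k)) \<odot> ((a [^] m \<otimes> a\<^sup>\<star> [^] m) \<otimes> (b [^] k \<otimes> b\<^sup>\<star> [^] k))"
    unfolding comm by (simp add: m_assoc)
  also have "a [^] m \<otimes> a\<^sup>\<star> [^] m = (\<one> \<ominus> c) [^] m"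
    using pow_mult_distrib[of a "a\<^sup>\<star>" m] aa_star by simp
  also have "b [^] k \<otimes> b\<^sup>\<star> [^] k = c [^] k"
    using pow_mult_distrib[of b "b\<^sup>\<star>" k] rel(3) by (simp add: c_def)
  finally show ?thesis .
qed

text \<open>The second tensor leg in the diagonal terms of the moment relation. Its phase exceeds
  the inverse of the phase in \<open>left_leg\<close> by q^k, which will cancel the coefficient of
  the comultiplication up to sign.\<close>

lemma right_leg:
  "(D \<otimes> b\<^sup>\<star>) [^] k \<otimes> b\<^sup>\<star> [^] m \<otimes> (a \<otimes> D\<^sup>\<star>) [^] k
    = q powi (int k * (int m + 1)) \<odot> (a [^] (k::nat) \<otimes> b\<^sup>\<star> [^] ((m::nat) + k))"
proof (induction k)
  case 0
  show ?case by simp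
next
  case (Suc k)
  let ?L = "(D \<otimes> b\<^sup>\<star>) [^] k" and ?R = "(a \<otimes> D\<^sup>\<star>) [^] k"
  let ?V = "Lb' # replicate k La @ replicate (m + k) Lb' @ [La]"
  have "(D \<otimes> b\<^sup>\<star>) [^] Suc k = (D \<otimes> b\<^sup>\<star>) \<otimes> ?L" by (rule nat_pow_Suc2) simp
  then have "(D \<otimes> b\<^sup>\<star>) [^] Suc k \<otimes> b\<^sup>\<star> [^] m \<otimes> (a \<otimes> D\<^sup>\<star>) [^] Suc k
      = (D \<otimes> b\<^sup>\<star>) \<otimes> (?L \<otimes> b\<^sup>\<star> [^] m \<otimes> ?R) \<otimes> (a \<otimes> D\<^sup>\<star>)"
    by (simp add: m_assoc)
  also have "\<dots> = q powi (int k * (int m + 1)) \<odot> ((D \<otimes> word_val ?V) \<otimes> D\<^sup>\<star>)"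
    unfolding Suc by (simp add: m_assoc)
  \<comment> \<open>\<open>?V\<close> contains m + k + 1 letters \<open>Lb'\<close>, each giving
    q^2; the freed \<open>D\<close> then meets its adjoint.\<close>
  also have "D \<otimes> word_val ?V = q powi (2 * (int m + int k + 1)) \<odot> (word_val ?V \<otimes> D)"
    using word_val_commute[of "[LD]" ?V] by (simp add: word_deg_replicate zero_prod_def algebra_simps)
  also have "(q powi (2 * (int m + int k + 1)) \<odot> (word_val ?V \<otimes> D)) \<otimes> D\<^sup>\<star>
      = q powi (2 * (int m + int k + 1)) \<odot> word_val ?V"
    by (simp add: m_assoc rel del: word_val.simps word_val_append)
  also have "word_val ?V = (b\<^sup>\<star> \<otimes> a [^] k) \<otimes> (b\<^sup>\<star> [^] (m + k) \<otimes> a)"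
    by (simp add: m_assoc)
  also have "b\<^sup>\<star> \<otimes> a [^] k = q powi (- int k) \<odot> (a [^] k \<otimes> b\<^sup>\<star>)"
    using word_val_commute[of "[Lb']" "replicate k La"] by (simp add: word_deg_replicate)
  also have "(q powi (- int k) \<odot> (a [^] k \<otimes> b\<^sup>\<star>)) \<otimes> (b\<^sup>\<star> [^] (m + k) \<otimes> a)
      = q powi (- int k) \<odot> (a [^] k \<otimes> ((b\<^sup>\<star> \<otimes> b\<^sup>\<star> [^] (m + k)) \<otimes> a))"
    by (simp add: m_assoc)
  also have "b\<^sup>\<star> \<otimes> b\<^sup>\<star> [^] (m + k) = b\<^sup>\<star> [^] (m + Suc k)"
    using nat_pow_Suc2[of "b\<^sup>\<star>" "m + k"] by simp
  also have "b\<^sup>\<star> [^] (m + Suc k) \<otimes> a = q powi (- (int m + int k + 1)) \<odot> (a \<otimes> b\<^sup>\<star> [^] (m + Suc k))"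
  proof -
    have "omega (word_deg (replicate (m + Suc k) Lb')) (word_deg [La]) = - (int m + int k + 1)"
      by (simp add: word_deg_replicate zero_prod_def del: replicate_Suc add_Suc_right)
    then show ?thesis
      using word_val_commute[of "replicate (m + Suc k) Lb'" "[La]"]
      by (simp only: word_val_replicate letter_val.simps word_val.simps r_one gen_closed)
  qed
  finally have "(D \<otimes> b\<^sup>\<star>) [^] Suc k \<otimes> b\<^sup>\<star> [^] m \<otimes> (a \<otimes> D\<^sup>\<star>) [^] Suc k
    = (q powi (int k * (int m + 1)) * q powi (2 * (int m + int k + 1)) * q powi (- int k) * q powi (- (int m + int k + 1)))
       \<odot> (a [^] Suc k \<otimes> b\<^sup>\<star> [^] (m + Suc k))"
    by (simp add: m_assoc mult.assoc del: add_Suc_right)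
  also have "q powi (int k * (int m + 1)) * q powi (2 * (int m + int k + 1)) * q powi (- int k) * q powi (- (int m + int k + 1))
     = q powi (int (Suc k) * (int m + 1))"
  proof -
    have "int k * (int m + 1) + 2 * (int m + int k + 1) + (- int k) + (- (int m + int k + 1)) = int (Suc k) * (int m + 1)"
      by (simp add: algebra_simps)
    then show ?thesis by (simp only: power_int_add[symmetric] q_nonzero simp_thms)
  qed
  finally show ?case .
qed

end

context Uq2_algebra
begin

text \<open>If the monomial vanished, reordering letters would give
  \<open>(y\<^sup>\<star>y)^n = 0\<close>. The exponent is raised from n to 2^n, where the norm
  formula for self-adjoint elements forces y to vanish.\<close>

lemma monomial_nonzero:
  assumes "y \<noteq> \<zero>" shows "a [^] (n::nat) \<otimes> b\<^sup>\<star> [^] n \<noteq> \<zero>"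
proof
  assume N: "a [^] n \<otimes> b\<^sup>\<star> [^] n = \<zero>"
  let ?v = "replicate n La @ replicate n Lb'"
  let ?u = "replicate n La' @ replicate n Lb"
  have v: "word_val ?v = \<zero>" using N by simp
  have m: "mset (concat (replicate n w)) = repeat_mset n (mset w)" for w :: "letter list"
    by (induction n) simp_all
  have "mset (concat (replicate n [Lb', La', La, Lb])) = mset (?v @ ?u)"
    by (rule multiset_eqI, unfold m, case_tac x) auto
  then obtain z where "word_val (concat (replicate n [Lb', La', La, Lb])) = z \<odot> word_val (?v @ ?u)"
    using word_val_perm by blast
  also have "word_val (?v @ ?u) = \<zero> \<otimes> word_val ?u" unfolding word_val_append[of ?v ?u] v ..
  also have "z \<odot> (\<zero> \<otimes> word_val ?u) = \<zero>" by simp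
  finally have "word_val (concat (replicate n [Lb', La', La, Lb])) = \<zero>" .
  moreover have "word_val (concat (replicate n [Lb', La', La, Lb])) = (y\<^sup>\<star> \<otimes> y) [^] n"
  proof (induction n)
    case (Suc k)
    have "word_val (concat (replicate (Suc k) [Lb', La', La, Lb])) = (y\<^sup>\<star> \<otimes> y) \<otimes> word_val (concat (replicate k [Lb', La', La, Lb]))"
      by (simp add: y_def m_assoc)
    then show ?case unfolding Suc using nat_pow_Suc2[of "y\<^sup>\<star> \<otimes> y" k] by simp
  qed simp
  ultimately have 0: "(y\<^sup>\<star> \<otimes> y) [^] n = \<zero>" by simp
  have "(y\<^sup>\<star> \<otimes> y) [^] ((2::nat) ^ n) = (y\<^sup>\<star> \<otimes> y) [^] (n + (2 ^ n - n))"
    by (simp add: less_imp_le)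
  also have "\<dots> = (y\<^sup>\<star> \<otimes> y) [^] n \<otimes> (y\<^sup>\<star> \<otimes> y) [^] (2 ^ n - n)"
    by (rule nat_pow_mult[symmetric]) simp
  finally have "(y\<^sup>\<star> \<otimes> y) [^] ((2::nat) ^ n) = \<zero>" using 0 by simp
  then have "\<parallel>y\<^sup>\<star> \<otimes> y\<parallel> ^ (2 ^ n) = 0"
    using norm_selfadjoint_pow[of "y\<^sup>\<star> \<otimes> y" n] by simp
  then have "\<parallel>y\<parallel> = 0" using norm_star_mult[of y] by simp
  then show False using norm_zero_iff[of y] assms by simp
qed

end

context Uq2_haar
begin

lemma tens_pow: "u \<in> carrier A \<Longrightarrow> v \<in> carrier A \<Longrightarrow> tens u v [^]\<^bsub>T\<^esub> (n::nat) = tens (u [^] n) (v [^] n)"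
  by (induction n) (simp_all add: tens_one tens_mult)

lemma \<Delta>_pow: "x \<in> carrier A \<Longrightarrow> \<Delta> (x [^] (n::nat)) = \<Delta> x [^]\<^bsub>T\<^esub> n"
  using unital_star_homD[OF \<Delta>_hom] by (induction n) simp_all

lemma S_finsum:
  assumes S: "complex_linear T A S" and "finite K" "f \<in> K \<rightarrow> carrier T"
  shows "S (\<Oplus>\<^bsub>T\<^esub>i\<in>K. f i) = (\<Oplus>i\<in>K. S (f i))"
proof -
  note S_simps = S[unfolded complex_linear_def]
  show ?thesis
    using assms(2,3)
  proof induction
    case empty
    have "S (0 \<odot>\<^bsub>T\<^esub> \<zero>\<^bsub>T\<^esub>) = 0 \<odot> S \<zero>\<^bsub>T\<^esub>" using S_simps by blast
    moreover have "S \<zero>\<^bsub>T\<^esub> \<in> carrier A" using S_simps by blast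
    ultimately show ?case by simp
  next
    case (insert i K)
    have "(\<Oplus>\<^bsub>T\<^esub>j\<in>insert i K. f j) = f i \<oplus>\<^bsub>T\<^esub> (\<Oplus>\<^bsub>T\<^esub>j\<in>K. f j)"
      using insert by (intro T.finsum_insert) auto
    moreover have "(\<Oplus>j\<in>insert i K. S (f j)) = S (f i) \<oplus> (\<Oplus>j\<in>K. S (f j))"
      using insert S_simps by (intro finsum_insert) auto
    moreover have "f i \<in> carrier T" "(\<Oplus>\<^bsub>T\<^esub>j\<in>K. f j) \<in> carrier T"
      using insert by (auto intro!: T.finsum_closed)
    ultimately show ?case using insert S_simps by auto
  qed
qed

lemma \<Delta>_bs: "\<Delta> (b\<^sup>\<star>) = tens (a\<^sup>\<star>) (b\<^sup>\<star>) \<oplus>\<^bsub>T\<^esub> tens (b\<^sup>\<star>) (a \<otimes> D\<^sup>\<star>)"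
  using unital_star_homD(6)[OF \<Delta>_hom, of b] by (simp add: \<Delta>_b tens_star)

text \<open>The two summands of each comultiplied generator commute, so both n-th powers expand
  binomially. In the term (k, j) the left leg has degree (j - k, k - j, 0), and \<open>h\<close>
  leaves only j = k. There the right leg is a multiple of \<open>N\<close>. Invariance equates the
  total with \<open>h N\<close>, which is zero, and \<open>N\<close> itself is not.\<close>

lemma moment_relation:
  assumes y: "y \<noteq> \<zero>" and n: "n > 0"
  shows "(\<Sum>k\<le>n. (-1) ^ k * of_nat ((n choose k)\<^sup>2) * h ((\<one> \<ominus> c) [^] (n - k) \<otimes> c [^] k)) = 0"
proof -
  obtain S where S: "complex_linear T A S"
    and S_tens: "\<And>x y. x \<in> carrier A \<Longrightarrow> y \<in> carrier A \<Longrightarrow> S (tens x y) = h x \<odot> y"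
    and S_\<Delta>: "\<And>x. x \<in> carrier A \<Longrightarrow> S (\<Delta> x) = h x \<odot> \<one>" using left_slice by blast
  have S_smult: "S (z \<odot>\<^bsub>T\<^esub> t) = z \<odot> S t" if "t \<in> carrier T" for z t
    using S that unfolding complex_linear_def by blast
  define N where "N = a [^] n \<otimes> b\<^sup>\<star> [^] n"
  have N [simp]: "N \<in> carrier A" by (simp add: N_def)
  define X where "X = tens a a"
  define Y where "Y = (- cnj q) \<odot>\<^bsub>T\<^esub> tens b (D \<otimes> b\<^sup>\<star>)"
  define Z where "Z = tens (a\<^sup>\<star>) (b\<^sup>\<star>)"
  define W where "W = tens (b\<^sup>\<star>) (a \<otimes> D\<^sup>\<star>)"
  have cl [simp]: "X \<in> carrier T" "Y \<in> carrier T" "Z \<in> carrier T" "W \<in> carrier T"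
    by (simp_all add: X_def Y_def Z_def W_def)
  have XY: "X \<otimes>\<^bsub>T\<^esub> Y = Y \<otimes>\<^bsub>T\<^esub> X"
  proof -
    have "tens b (D \<otimes> b\<^sup>\<star>) \<otimes>\<^bsub>T\<^esub> tens a a = tens (b \<otimes> a) ((D \<otimes> b\<^sup>\<star>) \<otimes> a)" by (simp add: tens_mult)
    also have "(D \<otimes> b\<^sup>\<star>) \<otimes> a = inverse q \<odot> (a \<otimes> (D \<otimes> b\<^sup>\<star>))"
      using word_val_commute[of "[LD, Lb']" "[La]"] by (simp add: power_int_minus)
    also have "tens (b \<otimes> a) (inverse q \<odot> (a \<otimes> (D \<otimes> b\<^sup>\<star>))) = tens (a \<otimes> b) (a \<otimes> (D \<otimes> b\<^sup>\<star>))"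
      unfolding rel(1) by (simp flip: tens_smult)
    finally show ?thesis by (simp add: X_def Y_def tens_mult)
  qed
  have ZW: "Z \<otimes>\<^bsub>T\<^esub> W = W \<otimes>\<^bsub>T\<^esub> Z"
  proof -
    have "W \<otimes>\<^bsub>T\<^esub> Z = tens (b\<^sup>\<star> \<otimes> a\<^sup>\<star>) ((a \<otimes> D\<^sup>\<star>) \<otimes> b\<^sup>\<star>)" by (simp add: W_def Z_def tens_mult)
    also have "(a \<otimes> D\<^sup>\<star>) \<otimes> b\<^sup>\<star> = inverse q \<odot> (b\<^sup>\<star> \<otimes> (a \<otimes> D\<^sup>\<star>))"
      using word_val_commute[of "[La, LD']" "[Lb']"] by (simp add: power_int_minus)
    also have "b\<^sup>\<star> \<otimes> a\<^sup>\<star> = q \<odot> (a\<^sup>\<star> \<otimes> b\<^sup>\<star>)"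
      using word_val_commute[of "[Lb']" "[La']"] by simp
    also have "tens (q \<odot> (a\<^sup>\<star> \<otimes> b\<^sup>\<star>)) (inverse q \<odot> (b\<^sup>\<star> \<otimes> (a \<otimes> D\<^sup>\<star>))) = tens (a\<^sup>\<star> \<otimes> b\<^sup>\<star>) (b\<^sup>\<star> \<otimes> (a \<otimes> D\<^sup>\<star>))"
      by (simp flip: tens_smult)
    finally show ?thesis by (simp add: W_def Z_def tens_mult)
  qed
  define t where "t = (\<lambda>k j. (of_nat (n choose k) \<odot>\<^bsub>T\<^esub> (X [^]\<^bsub>T\<^esub> (n - k) \<otimes>\<^bsub>T\<^esub> Y [^]\<^bsub>T\<^esub> k))
      \<otimes>\<^bsub>T\<^esub> (of_nat (n choose j) \<odot>\<^bsub>T\<^esub> (Z [^]\<^bsub>T\<^esub> (n - j) \<otimes>\<^bsub>T\<^esub> W [^]\<^bsub>T\<^esub> j)))"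
  have t [simp]: "t k j \<in> carrier T" for k j by (simp add: t_def)
  have "\<Delta> N = \<Delta> a [^]\<^bsub>T\<^esub> n \<otimes>\<^bsub>T\<^esub> \<Delta> (b\<^sup>\<star>) [^]\<^bsub>T\<^esub> n"
    using unital_star_homD(2)[OF \<Delta>_hom] by (simp add: N_def \<Delta>_pow)
  also have "\<Delta> a = X \<oplus>\<^bsub>T\<^esub> Y" by (simp add: \<Delta>_a X_def Y_def tens_smult(1))
  also have "\<Delta> (b\<^sup>\<star>) = Z \<oplus>\<^bsub>T\<^esub> W" by (simp add: \<Delta>_bs Z_def W_def)
  also have "(X \<oplus>\<^bsub>T\<^esub> Y) [^]\<^bsub>T\<^esub> n \<otimes>\<^bsub>T\<^esub> (Z \<oplus>\<^bsub>T\<^esub> W) [^]\<^bsub>T\<^esub> n = (\<Oplus>\<^bsub>T\<^esub>k\<in>{..n}. \<Oplus>\<^bsub>T\<^esub>j\<in>{..n}. t k j)"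
    unfolding T.binomial_expansion[OF cl(1,2) XY] T.binomial_expansion[OF cl(3,4) ZW]
    by (subst T.finsum_ldistr)
       (auto simp: t_def T.finsum_rdistr Pi_def intro!: T.finsum_closed T.finsum_cong')
  finally have \<Delta>N: "\<Delta> N = (\<Oplus>\<^bsub>T\<^esub>k\<in>{..n}. \<Oplus>\<^bsub>T\<^esub>j\<in>{..n}. t k j)" .
  define r where "r = (\<lambda>k. (-1) ^ k * of_nat ((n choose k)\<^sup>2) * h ((\<one> \<ominus> c) [^] (n - k) \<otimes> c [^] k))"
  have S_t: "S (t k j) = (if j = k then r k else 0) \<odot> N" if k: "k \<le> n" and j: "j \<le> n" for k j
  proof -
    let ?l = "(a [^] (n - k) \<otimes> b [^] k) \<otimes> (a\<^sup>\<star> [^] (n - j) \<otimes> b\<^sup>\<star> [^] j)"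
    let ?r = "(a [^] (n - k) \<otimes> (D \<otimes> b\<^sup>\<star>) [^] k) \<otimes> (b\<^sup>\<star> [^] (n - j) \<otimes> (a \<otimes> D\<^sup>\<star>) [^] j)"
    have "t k j = (of_nat (n choose j) * (of_nat (n choose k) * (- cnj q) ^ k)) \<odot>\<^bsub>T\<^esub> tens ?l ?r"
      by (simp add: t_def X_def Y_def Z_def W_def tens_pow T.smult_pow tens_mult)
    then have St: "S (t k j) = (of_nat (n choose j) * (of_nat (n choose k) * (- cnj q) ^ k) * h ?l) \<odot> ?r"
      by (simp add: S_smult S_tens)
    show ?thesis
    proof (cases "j = k")
      case False
      have "?l = word_val ((replicate (n - k) La @ replicate k Lb) @ (replicate (n - j) La' @ replicate j Lb'))"
        by (simp only: word_val_append word_val_replicate letter_val.simps)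
      moreover have "word_deg ((replicate (n - k) La @ replicate k Lb) @ (replicate (n - j) La' @ replicate j Lb')) \<noteq> 0"
        using False by (simp add: word_deg_replicate zero_prod_def)
      ultimately have "h ?l = 0" by (metis h_word)
      then show ?thesis using False by (simp add: St)
    next
      case True
      define m where "m = n - k"
      have m: "n = m + k" using k by (simp add: m_def)
      have "?r = a [^] m \<otimes> ((D \<otimes> b\<^sup>\<star>) [^] k \<otimes> b\<^sup>\<star> [^] m \<otimes> (a \<otimes> D\<^sup>\<star>) [^] k)"
        using True by (simp add: m_def m_assoc)
      also have "\<dots> = q powi (int k * (int m + 1)) \<odot> N"
        unfolding right_leg by (simp add: N_def m nat_pow_mult[symmetric] m_assoc)
      finally have r_eq: "?r = q powi (int k * (int m + 1)) \<odot> N" .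
      have l_eq: "h ?l = q powi (- (int m * int k)) * h ((\<one> \<ominus> c) [^] m \<otimes> c [^] k)"
        using True left_leg[of m k] by (simp add: m_def)
      \<comment> \<open>Both legs together leave q^k, and |q| = 1 reduces its product with (- cnj
        q)^k to a sign.\<close>
      have phase: "(- cnj q) ^ k * (q powi (- (int m * int k)) * q powi (int k * (int m + 1))) = (-1) ^ k"
      proof -
        have "- (int m * int k) + int k * (int m + 1) = int k" by (simp add: algebra_simps)
        then have "q powi (- (int m * int k)) * q powi (int k * (int m + 1)) = q ^ k"
          by (simp flip: power_int_add)
        moreover have "(- cnj q) ^ k * q ^ k = (-1) ^ k"
          by (simp add: cnj_q flip: power_mult_distrib)
        ultimately show ?thesis by simp
      qed
      have S_eq: "S (t k j) = ((of_nat (n choose k) * of_nat (n choose k)) *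
        ((- cnj q) ^ k * (q powi (- (int m * int k)) * q powi (int k * (int m + 1)))) *
        h ((\<one> \<ominus> c) [^] m \<otimes> c [^] k)) \<odot> N"
        unfolding St l_eq unfolding r_eq using True by (simp add: mult_ac)
      show ?thesis using True unfolding S_eq phase by (simp add: r_def m_def power2_eq_square mult_ac)
    qed
  qed
  have "S (\<Delta> N) = (\<Oplus>k\<in>{..n}. S (\<Oplus>\<^bsub>T\<^esub>j\<in>{..n}. t k j))"
    unfolding \<Delta>N by (rule S_finsum[OF S]) (auto intro!: T.finsum_closed)
  also have "\<dots> = (\<Oplus>k\<in>{..n}. r k \<odot> N)"
  proof (rule finsum_cong')
    fix k assume k: "k \<in> {..n}"
    have "S (\<Oplus>\<^bsub>T\<^esub>j\<in>{..n}. t k j) = (\<Oplus>j\<in>{..n}. S (t k j))"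
      by (rule S_finsum[OF S]) auto
    also have "\<dots> = (\<Oplus>j\<in>{..n}. (if j = k then r k else 0) \<odot> N)"
      by (rule finsum_cong') (use k S_t in auto)
    also have "\<dots> = (\<Sum>j\<in>{..n}. if j = k then r k else 0) \<odot> N"
      by (rule finsum_smult_const) auto
    also have "(\<Sum>j\<in>{..n}. if j = k then r k else 0) = r k" using k by simp
    finally show "S (\<Oplus>\<^bsub>T\<^esub>j\<in>{..n}. t k j) = r k \<odot> N" .
  qed auto
  also have "\<dots> = (\<Sum>k\<in>{..n}. r k) \<odot> N" by (rule finsum_smult_const) auto
  finally have "h N \<odot> \<one> = (\<Sum>k\<in>{..n}. r k) \<odot> N" by (simp add: S_\<Delta>)
  moreover have "h N = 0"
    using h_word[of "replicate n La @ replicate n Lb'"] n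
    by (simp add: N_def word_deg_replicate zero_prod_def)
  ultimately have "(\<Sum>k\<in>{..n}. r k) \<odot> N = \<zero>" by simp
  then have "cmod (\<Sum>k\<in>{..n}. r k) * \<parallel>N\<parallel> = 0" by (metis N norm_smult norm_zero')
  moreover have "\<parallel>N\<parallel> \<noteq> 0" using monomial_nonzero[OF y, of n] norm_zero_iff[OF N] by (simp add: N_def)
  ultimately show ?thesis by (simp add: r_def)
qed

end

section \<open>Rapid decay of the Haar state\<close>

context Uq2_haar
begin

text \<open>The Lebesgue part of each summand is an alternating binomial coefficient, with total
  zero. The error \<delta> of the n-th moment appears with the same sign (-1)^n everywhere, so its
  coefficient is a sum of squares.\<close>

lemma sum_alternating_eq_0:
  fixes \<delta> :: complex
  assumes "(\<Sum>k\<le>n. (-1) ^ k * of_nat ((n choose k)\<^sup>2) * (1 / (of_nat (n + 1) * of_nat (n choose k)) + (-1) ^ (n - k) * \<delta>)) = 0"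
    and "n > 0"
  shows "\<delta> = 0"
proof -
  have summand: "(-1) ^ k * of_nat ((n choose k)\<^sup>2) * (1 / (of_nat (n + 1) * of_nat (n choose k)) + (-1) ^ (n - k) * \<delta>)
      = ((-1) ^ k * of_nat (n choose k)) / of_nat (n + 1) + of_nat ((n choose k)\<^sup>2) * ((-1) ^ n * \<delta>)"
    if "k \<le> n" for k
  proof -
    have "(-1) ^ k * (-1 :: complex) ^ (n - k) = (-1) ^ n" using that by (simp flip: power_add)
    moreover have "complex_of_nat (n choose k) \<noteq> 0" using that by (simp add: binomial_eq_0_iff)
    ultimately show ?thesis
      by (simp add: ring_distribs power2_eq_square mult_ac del: of_nat_Suc)
  qed
  have "(\<Sum>k\<le>n. (-1) ^ k * of_nat ((n choose k)\<^sup>2) * (1 / (of_nat (n + 1) * of_nat (n choose k)) + (-1) ^ (n - k) * \<delta>))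
      = (\<Sum>k\<le>n. (-1) ^ k * of_nat (n choose k)) / of_nat (n + 1) + of_nat (\<Sum>k\<le>n. (n choose k)\<^sup>2) * ((-1) ^ n * \<delta>)"
    unfolding of_nat_sum sum_distrib_right sum_divide_distrib sum.distrib[symmetric]
    by (rule sum.cong) (simp_all only: summand atMost_iff)
  also have "(\<Sum>k\<le>n. (-1) ^ k * complex_of_nat (n choose k)) = 0"
    using choose_alternating_sum[OF assms(2)] by blast
  finally have "of_nat (\<Sum>k\<le>n. (n choose k)\<^sup>2) * ((-1) ^ n * \<delta>) = 0" using assms(1) by simp
  moreover have "(\<Sum>k\<le>n. (n choose k)\<^sup>2) \<noteq> 0" by (simp add: choose_square_sum)
  ultimately show ?thesis by (simp only: mult_eq_0_iff of_nat_eq_0_iff) simp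
qed

text \<open>By strong induction only the n-th moment is unknown. Each polynomial (1 - t)^(n-k) t^k
  sees its deviation \<delta> from the Lebesgue value through the leading coefficient alone.\<close>

lemma h_c_pow:
  assumes y: "y \<noteq> \<zero>"
  shows "h (c [^] (n::nat)) = 1 / (of_nat n + 1)"
proof (induction n rule: less_induct)
  case (less n)
  show ?case
  proof (cases "n = 0")
    case True
    then show ?thesis by simp
  next
    case False
    define \<delta> where "\<delta> = h (c [^] n) - 1 / (of_nat n + 1)"
    have h_k: "h ((\<one> \<ominus> c) [^] (n - k) \<otimes> c [^] k) = 1 / (of_nat (n + 1) * of_nat (n choose k)) + (-1) ^ (n - k) * \<delta>"
      if k: "k \<le> n" for k
    proof -
      define f :: "real poly" where "f = [:1, -1:] ^ (n - k) * [:0, 1:] ^ k"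
      have deg: "degree f = n" using k
        by (simp add: f_def degree_mult_eq degree_power_eq)
      have "lead_coeff f = (-1) ^ (n - k)"
        unfolding f_def lead_coeff_mult lead_coeff_power by simp
      then have lead: "coeff f n = (-1) ^ (n - k)" unfolding deg .
      have "h (peval c f) = (\<Sum>i\<le>n. of_real (coeff f i) * h (c [^] i))"
        by (rule h_peval) (simp_all add: deg)
      also have "\<dots> = (\<Sum>i<n. of_real (coeff f i) * h (c [^] i)) + of_real (coeff f n) * h (c [^] n)"
        by (simp add: lessThan_Suc_atMost[symmetric])
      also have "(\<Sum>i<n. of_real (coeff f i) * h (c [^] i)) = (\<Sum>i<n. of_real (coeff f i / (real i + 1)))"
        by (rule sum.cong) (simp_all add: less)
      also have "(\<Sum>i<n. of_real (coeff f i / (real i + 1))) + of_real (coeff f n) * h (c [^] n)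
          = (\<Sum>i\<le>n. of_real (coeff f i / (real i + 1))) + of_real (coeff f n) * \<delta>"
        by (simp add: \<delta>_def lessThan_Suc_atMost[symmetric] right_diff_distrib)
      also have "(\<Sum>i\<le>n. of_real (coeff f i / (real i + 1))) = complex_of_real (integral {0..1} (poly f))"
        unfolding of_real_sum[symmetric] by (subst integral_poly[of f n]) (simp_all add: deg)
      also have "poly f = (\<lambda>t. (1 - t) ^ (n - k) * t ^ k)" by (auto simp: f_def)
      also have "integral {0..1} (\<lambda>t::real. (1 - t) ^ (n - k) * t ^ k) = 1 / (real (n + 1) * real (n choose k))"
        using integral_power_power[of "n - k" k] k by simp
      also have "peval c f = (\<one> \<ominus> c) [^] (n - k) \<otimes> c [^] k"
        by (simp add: f_def diff_smult)
      finally show ?thesis unfolding lead by simp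
    qed
    have n: "n > 0" using False by simp
    have "(\<Sum>k\<le>n. (-1) ^ k * of_nat ((n choose k)\<^sup>2) * (1 / (of_nat (n + 1) * of_nat (n choose k)) + (-1) ^ (n - k) * \<delta>))
        = (\<Sum>k\<le>n. (-1) ^ k * of_nat ((n choose k)\<^sup>2) * h ((\<one> \<ominus> c) [^] (n - k) \<otimes> c [^] k))"
      by (rule sum.cong) (simp_all only: h_k atMost_iff)
    also have "\<dots> = 0" by (rule moment_relation[OF y n])
    finally have "\<delta> = 0" using n by (rule sum_alternating_eq_0)
    then show ?thesis by (simp add: \<delta>_def)
  qed
qed

lemma h_peval_integral:
  assumes y: "y \<noteq> \<zero>"
  shows "h (peval c f) = of_real (integral {0..1} (poly f))"
  by (simp add: h_peval[OF c_closed order_refl] integral_poly[OF order_refl] h_c_pow[OF y])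

lemma h_c_degenerate: "c = \<zero> \<or> h c = 1 / 2"
proof -
  obtain S where S: "complex_linear T A S"
    and S_tens: "\<And>x y. x \<in> carrier A \<Longrightarrow> y \<in> carrier A \<Longrightarrow> S (tens x y) = h x \<odot> y"
    and S_\<Delta>: "\<And>x. x \<in> carrier A \<Longrightarrow> S (\<Delta> x) = h x \<odot> \<one>" using left_slice by blast
  have S_add: "S (t \<oplus>\<^bsub>T\<^esub> t') = S t \<oplus> S t'" if "t \<in> carrier T" "t' \<in> carrier T" for t t'
    using S that unfolding complex_linear_def by blast
  have "\<Delta> c = (tens a b \<oplus>\<^bsub>T\<^esub> tens b (D \<otimes> a\<^sup>\<star>)) \<otimes>\<^bsub>T\<^esub> (tens (a\<^sup>\<star>) (b\<^sup>\<star>) \<oplus>\<^bsub>T\<^esub> tens (b\<^sup>\<star>) (a \<otimes> D\<^sup>\<star>))"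
    using unital_star_homD(2)[OF \<Delta>_hom] by (simp add: c_def \<Delta>_b \<Delta>_bs)
  also have "\<dots> = (tens (a \<otimes> a\<^sup>\<star>) (b \<otimes> b\<^sup>\<star>) \<oplus>\<^bsub>T\<^esub> tens (b \<otimes> a\<^sup>\<star>) (D \<otimes> a\<^sup>\<star> \<otimes> b\<^sup>\<star>)) \<oplus>\<^bsub>T\<^esub>
      (tens (a \<otimes> b\<^sup>\<star>) (b \<otimes> (a \<otimes> D\<^sup>\<star>)) \<oplus>\<^bsub>T\<^esub> tens (b \<otimes> b\<^sup>\<star>) (D \<otimes> a\<^sup>\<star> \<otimes> (a \<otimes> D\<^sup>\<star>)))"
    by (simp add: T.l_distr T.r_distr tens_mult)
  finally have "h c \<odot> \<one> = (h (a \<otimes> a\<^sup>\<star>) \<odot> c \<oplus> h (b \<otimes> a\<^sup>\<star>) \<odot> (D \<otimes> a\<^sup>\<star> \<otimes> b\<^sup>\<star>)) \<oplus>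
      (h (a \<otimes> b\<^sup>\<star>) \<odot> (b \<otimes> (a \<otimes> D\<^sup>\<star>)) \<oplus> h c \<odot> (D \<otimes> a\<^sup>\<star> \<otimes> (a \<otimes> D\<^sup>\<star>)))"
    using S_\<Delta>[of c] by (simp add: S_add S_tens c_def)
  also have "h (b \<otimes> a\<^sup>\<star>) = 0" using h_word[of "[Lb, La']"] by (simp add: zero_prod_def)
  also have "h (a \<otimes> b\<^sup>\<star>) = 0" using h_word[of "[La, Lb']"] by (simp add: zero_prod_def)
  also have "h (a \<otimes> a\<^sup>\<star>) = 1 - h c" by (simp add: aa_star)
  also have "D \<otimes> a\<^sup>\<star> \<otimes> (a \<otimes> D\<^sup>\<star>) = D \<otimes> (a\<^sup>\<star> \<otimes> a) \<otimes> D\<^sup>\<star>" by (simp add: m_assoc)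
  also have "\<dots> = D \<otimes> D\<^sup>\<star> \<ominus> D \<otimes> c \<otimes> D\<^sup>\<star>"
    unfolding aa_star by (simp add: a_minus_def r_distr l_distr r_minus l_minus)
  also have "D \<otimes> c \<otimes> D\<^sup>\<star> = c"
    unfolding c_commute_gens(3)[symmetric] by (simp add: m_assoc rel)
  finally have "h c \<odot> \<one> = (1 - h c) \<odot> c \<oplus> h c \<odot> (\<one> \<ominus> c)"
    by (simp add: rel)
  also have "\<dots> = ((1 - h c) \<odot> c \<oplus> (- h c) \<odot> c) \<oplus> h c \<odot> \<one>"
    by (simp add: diff_smult smult_add_right a_ac)
  also have "(1 - h c) \<odot> c \<oplus> (- h c) \<odot> c = (1 - 2 * h c) \<odot> c"
    by (simp flip: smult_add_left)
  finally have "(1 - 2 * h c) \<odot> c \<oplus> h c \<odot> \<one> = \<zero> \<oplus> h c \<odot> \<one>" by simp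
  then have "(1 - 2 * h c) \<odot> c = \<zero>" 
    using add_eq_imp_diff[of "(1 - 2 * h c) \<odot> c" "h c \<odot> \<one>"] by (simp add: a_minus_def r_neg)
  then have "cmod (1 - 2 * h c) * \<parallel>c\<parallel> = 0" by (metis c_closed norm_smult norm_zero')
  then have "1 - 2 * h c = 0 \<or> c = \<zero>" using norm_zero_iff[of c] by simp
  then show ?thesis by (auto simp: field_simps)
qed

text \<open>For \<open>y = \<zero>\<close> the element c is a projection and f(c) = f(0) (1 - c) +
  f(1) c. If c is not zero, \<open>h\<close> gives both projections weight 1/2; then (|u| + |v|)^2
  \<le> 2 (u^2 + v^2) is four times the value of \<open>h\<close>. This is the origin of the
  constant 4; the Lebesgue case needs only 2.\<close>

lemma norm_peval_le_h:
  assumes "degree f \<le> N"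
  shows "\<parallel>peval c f\<parallel>\<^sup>2 \<le> 4 * (1 + real N) ^ 3 * Re (h (peval c (f * f)))"
proof (cases "y = \<zero>")
  case False
  have "\<parallel>peval c f\<parallel>\<^sup>2 \<le> 2 * (1 + real N) ^ 3 * integral {0..1} (poly (f * f))"
    by (rule norm_peval_le[OF c_closed c_star y_closed y_normal(2) y_c y_normal(1) assms])
  also have "\<dots> \<le> 4 * (1 + real N) ^ 3 * integral {0..1} (poly (f * f))"
  proof (rule mult_right_mono)
    show "0 \<le> integral {0..1} (poly (f * f))"
      by (intro integral_nonneg integrable_continuous_interval continuous_intros) simp
  qed simp
  finally show ?thesis by (simp only: h_peval_integral[OF False] Re_complex_of_real)
next
  case True
  have cc: "c \<otimes> c = c"
  proof -
    have "c \<otimes> (\<one> \<ominus> c) = \<zero>" using y_normal(1) True by simp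
    then have "c \<ominus> c \<otimes> c = \<zero>" by (simp add: a_minus_def r_distr r_minus)
    then show ?thesis by (simp add: diff_zero_iff)
  qed
  have pe: "peval c f = of_real (poly f 0) \<odot> (\<one> \<ominus> c) \<oplus> of_real (poly f 1) \<odot> c" for f
  proof (induction f)
    case (pCons r f)
    have "peval c (pCons r f) = of_real r \<odot> \<one> \<oplus> of_real (poly f 1) \<odot> c"
      unfolding peval_pCons[OF c_closed] pCons.IH by (simp add: diff_smult r_distr cc smult_add_right flip: smult_add_left)
    also have "\<dots> = of_real r \<odot> (\<one> \<ominus> c) \<oplus> (of_real r \<odot> c \<oplus> of_real (poly f 1) \<odot> c)"
    proof -
      have "of_real r \<odot> \<one> = of_real r \<odot> (\<one> \<ominus> c) \<oplus> of_real r \<odot> c"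
        by (simp add: diff_smult smult_add_right a_assoc flip: smult_add_left)
      then show ?thesis by (simp add: a_assoc)
    qed
    finally show ?case by (simp add: smult_add_left)
  qed simp
  define u where "u = poly f 0"
  define v where "v = poly f 1"
  have h_eq: "Re (h (peval c (f * f))) = u\<^sup>2 * (1 - Re (h c)) + v\<^sup>2 * Re (h c)"
    unfolding pe u_def v_def by (simp add: power2_eq_square)
  have proj: "\<parallel>p\<parallel> \<le> 1" if "p \<in> carrier A" "p\<^sup>\<star> = p" "p \<otimes> p = p" for p
  proof -
    have "\<parallel>p\<parallel> = \<parallel>p\<parallel>\<^sup>2" using norm_selfadjoint_square[OF that(1,2)] that(3) by simp
    then have "\<parallel>p\<parallel> = 0 \<or> \<parallel>p\<parallel> = 1" by (simp add: power2_eq_square)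
    then show ?thesis by auto
  qed
  have "\<parallel>peval c f\<parallel>\<^sup>2 \<le> 4 * Re (h (peval c (f * f)))"
  proof (cases "c = \<zero>")
    case True
    then have "peval c f = of_real u \<odot> \<one>" unfolding pe u_def by (simp add: a_minus_def)
    then have "\<parallel>peval c f\<parallel>\<^sup>2 = u\<^sup>2" by simp
    then show ?thesis unfolding h_eq using True by simp
  next
    case False
    then have "h c = 1 / 2" using h_c_degenerate by blast
    then have "Re (h c) = Re (1 / 2)" by (rule arg_cong)
    then have hc: "Re (h c) = 1 / 2" by simp
    have "\<parallel>peval c f\<parallel> \<le> \<bar>u\<bar> * \<parallel>\<one> \<ominus> c\<parallel> + \<bar>v\<bar> * \<parallel>c\<parallel>"
      unfolding pe u_def[symmetric] v_def[symmetric]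
      using norm_triangle[of "of_real u \<odot> (\<one> \<ominus> c)" "of_real v \<odot> c"] by simp
    also have "\<dots> \<le> \<bar>u\<bar> * 1 + \<bar>v\<bar> * 1"
    proof (intro add_mono mult_left_mono)
      show "\<parallel>c\<parallel> \<le> 1" by (rule proj) (simp_all add: cc)
      have "(\<one> \<ominus> c) \<otimes> (\<one> \<ominus> c) = \<one> \<ominus> c"
      proof -
        have "(\<one> \<ominus> c) \<otimes> c = \<zero>" using cc by (simp add: a_minus_def l_distr l_minus r_neg)
        moreover have "p \<otimes> (\<one> \<ominus> c) = p \<ominus> p \<otimes> c" if "p \<in> carrier A" for p
          using that by (simp add: a_minus_def r_distr r_minus)
        ultimately show ?thesis by (simp add: a_minus_def)
      qed
      then show "\<parallel>\<one> \<ominus> c\<parallel> \<le> 1" by (intro proj) simp_all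
    qed simp_all
    finally have "\<parallel>peval c f\<parallel>\<^sup>2 \<le> (\<bar>u\<bar> + \<bar>v\<bar>)\<^sup>2" by (intro power_mono) simp_all
    also have "\<dots> \<le> 2 * u\<^sup>2 + 2 * v\<^sup>2"
      using sum_squares_bound[of "\<bar>u\<bar>" "\<bar>v\<bar>"] by (simp add: power2_sum)
    finally show ?thesis unfolding h_eq hc by simp
  qed
  also have "4 * Re (h (peval c (f * f))) \<le> 4 * Re (h (peval c (f * f))) * (1 + real N) ^ 3"
  proof -
    have "0 \<le> Re (h (peval c (f * f)))"
      using h_pos[of "peval c f"] by (simp add: peval_star)
    moreover have "1 \<le> (1 + real N) ^ 3" by (rule one_le_power) simp
    ultimately show ?thesis using mult_left_mono[of 1 "(1 + real N) ^ 3" "4 * Re (h (peval c (f * f)))"] by simp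
  qed
  finally show ?thesis by (simp only: mult_ac)
qed

text \<open>The polynomial estimate is applied to f(c) = \<open>u\<^sup>\<star>u\<close>: the fourth
  power of the norm is at most K times \<open>h\<close> of f(c)^2, which \<open>h_conj_le\<close>
  bounds by the squared norm times \<open>h (u\<^sup>\<star> \<otimes> u)\<close>. One squared norm
  cancels.\<close>

lemma norm_hom_words_le:
  assumes u: "u \<in> hom_words d M"
  shows "\<parallel>u\<parallel>\<^sup>2 \<le> 4 * (1 + real (2 * M)) ^ 3 * Re (h (u\<^sup>\<star> \<otimes> u))"
proof -
  let ?K = "4 * (1 + real (2 * M)) ^ 3" and ?H = "Re (h (u\<^sup>\<star> \<otimes> u))"
  have uc [simp]: "u \<in> carrier A" using u hom_words_carrier by blast
  obtain f where f: "u\<^sup>\<star> \<otimes> u = peval c f" "degree f \<le> 2 * M"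
    using hom_words_star_mult[OF u] by blast
  have "(\<parallel>u\<parallel>\<^sup>2)\<^sup>2 = \<parallel>peval c f\<parallel>\<^sup>2" using norm_star_mult[of u] f by simp
  also have "\<dots> \<le> ?K * Re (h (peval c (f * f)))" by (rule norm_peval_le_h[OF f(2)])
  also have "peval c (f * f) = u\<^sup>\<star> \<otimes> ((u\<^sup>\<star>)\<^sup>\<star> \<otimes> u\<^sup>\<star>) \<otimes> u"
    unfolding peval_mult[OF c_closed] f(1)[symmetric] by (simp add: m_assoc)
  also have "Re (h (u\<^sup>\<star> \<otimes> ((u\<^sup>\<star>)\<^sup>\<star> \<otimes> u\<^sup>\<star>) \<otimes> u)) \<le> \<parallel>u\<parallel>\<^sup>2 * ?H"
    using h_conj_le[of "u\<^sup>\<star>" u] by simp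
  finally have le: "(\<parallel>u\<parallel>\<^sup>2)\<^sup>2 \<le> ?K * (\<parallel>u\<parallel>\<^sup>2 * ?H)" by (simp add: mult_left_mono)
  show ?thesis
  proof (cases "\<parallel>u\<parallel> = 0")
    case True
    then show ?thesis using h_pos[of u] by simp
  next
    case False
    then have "\<parallel>u\<parallel>\<^sup>2 > 0" by simp
    moreover have "\<parallel>u\<parallel>\<^sup>2 * \<parallel>u\<parallel>\<^sup>2 \<le> \<parallel>u\<parallel>\<^sup>2 * (?K * ?H)"
      using le by (simp only: power2_eq_square[of "\<parallel>u\<parallel>\<^sup>2"] mult_ac)
    ultimately show ?thesis by (simp only: mult_le_cancel_left_pos)
  qed
qed

lemma hom_words_orthogonal:
  assumes u: "u \<in> hom_words d M" and v: "v \<in> hom_words d' N" and d: "d \<noteq> d'"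
  shows "h (u\<^sup>\<star> \<otimes> v) = 0"
proof -
  have X: "csubspace {x \<in> carrier A. h x = 0}" by (auto simp: csubspace_def)
  let ?G = "{word_val w | w. word_deg w = d \<and> length w \<le> M}"
  let ?G' = "{word_val w | w. word_deg w = d' \<and> length w \<le> N}"
  let ?X = "{x \<in> carrier A. h (x\<^sup>\<star> \<otimes> v) = 0}"
  have vc: "v \<in> carrier A" using v hom_words_carrier by blast
  have X': "csubspace ?X" using vc by (auto simp: csubspace_def l_distr)
  have "?G \<subseteq> ?X"
  proof
    fix g assume "g \<in> ?G"
    then obtain w where w: "g = word_val w" "word_deg w = d" by blast
    have "g\<^sup>\<star> \<otimes> v \<in> {x \<in> carrier A. h x = 0}"
    proof (rule cspan_mult[OF X, of "{g\<^sup>\<star>}" ?G'])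
      show "g\<^sup>\<star> \<in> cspan {g\<^sup>\<star>}" by (rule cspan_base) (auto simp: w)
      show "v \<in> cspan ?G'" using v by (simp add: hom_words_def)
      fix x x' assume "x \<in> {g\<^sup>\<star>}" "x' \<in> ?G'"
      then obtain w' where w': "x = word_val (word_star w)" "x' = word_val w'" "word_deg w' = d'"
        by (auto simp: w word_val_star)
      have "word_deg (word_star w @ w') \<noteq> 0" using w w' d by simp
      then have "h (word_val (word_star w @ w')) = 0" by (rule h_word)
      then show "x \<otimes> x' \<in> {x \<in> carrier A. h x = 0}" by (simp add: w')
    qed (auto simp: w)
    then show "g \<in> ?X" by (simp add: w)
  qed
  then have "u \<in> ?X" using cspan_least[OF X'] u unfolding hom_words_def by blast
  then show ?thesis by simp
qed

lemma h_star_mult_finsum: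
  assumes F: "finite F" and u: "\<And>d. u d \<in> hom_words d M"
  shows "h ((\<Oplus>d\<in>F. u d)\<^sup>\<star> \<otimes> (\<Oplus>d\<in>F. u d)) = (\<Sum>d\<in>F. h ((u d)\<^sup>\<star> \<otimes> u d))"
proof -
  have uc [simp]: "u d \<in> carrier A" for d using u hom_words_carrier by blast
  have fc [simp]: "(\<Oplus>d\<in>F. u d) \<in> carrier A" for F by (rule finsum_closed) auto
  have ins: "(\<Oplus>d\<in>insert d F. u d) = u d \<oplus> (\<Oplus>d\<in>F. u d)" if "finite F" "d \<notin> F" for d F
    using that by (intro finsum_insert) auto
  have cross: "h ((u d)\<^sup>\<star> \<otimes> (\<Oplus>d\<in>F. u d)) = 0" if "finite F" "d \<notin> F" for d F
    using that
  proof (induction F)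
    case (insert d' F)
    then have "h ((u d)\<^sup>\<star> \<otimes> u d') = 0" by (intro hom_words_orthogonal[OF u u]) auto
    then show ?case using insert by (simp add: ins r_distr)
  qed simp
  have cross': "h ((\<Oplus>d\<in>F. u d)\<^sup>\<star> \<otimes> u d) = 0" if "finite F" "d \<notin> F" for d F
    using cross[OF that] h_star[of "(u d)\<^sup>\<star> \<otimes> (\<Oplus>d\<in>F. u d)"] by simp
  show ?thesis
    using F
  proof induction
    case (insert d F)
    then show ?case using cross[of F d] cross'[of F d] by (simp add: ins r_distr l_distr)
  qed simp
qed

text \<open>Contains the degrees of all words of length at most M. Its size (2 M + 1)^3 is
  polynomial, so adding up the homogeneous components preserves a polynomial bound.\<close>

definition degree_box :: "nat \<Rightarrow> (int \<times> int \<times> int) set" where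
  "degree_box M = {- int M..int M} \<times> {- int M..int M} \<times> {- int M..int M}"

lemma word_deg_in_box: "length w \<le> M \<Longrightarrow> word_deg w \<in> degree_box M"
proof -
  have "word_deg w \<in> degree_box (length w)"
  proof (induction w)
    case (Cons x w)
    then show ?case by (cases x; cases "word_deg w") (auto simp: degree_box_def)
  qed (simp add: degree_box_def zero_prod_def)
  then show "length w \<le> M \<Longrightarrow> word_deg w \<in> degree_box M" by (auto simp: degree_box_def)
qed

lemma words_span_decompose:
  assumes "z \<in> words_span M"
  obtains u where "\<And>d. u d \<in> hom_words d M" "z = (\<Oplus>d\<in>degree_box M. u d)"
proof -
  have "\<exists>u. (\<forall>d. u d \<in> hom_words d M) \<and> z = (\<Oplus>d\<in>degree_box M. u d)"
    using assms unfolding words_span_def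
  proof induction
    case zero
    have "\<zero> \<in> hom_words d M" for d using csubspaceD(2)[OF csubspace_hom_words] .
    moreover have "(\<Oplus>d\<in>degree_box M. \<zero>) = \<zero>" by simp
    ultimately show ?case by (intro exI[of _ "\<lambda>_. \<zero>"]) simp
  next
    case (step x g k)
    then obtain u where u: "\<And>d. u d \<in> hom_words d M" "x = (\<Oplus>d\<in>degree_box M. u d)" by blast
    obtain w where w: "g = word_val w" "length w \<le> M" using step(2) by blast
    \<comment> \<open>The new word contributes to the component of its own degree only.\<close>
    define v where "v = (\<lambda>d. if word_deg w = d then k \<odot> g else \<zero>)"
    have uc: "u d \<in> carrier A" for d using u(1) hom_words_carrier by blast
    have "word_val w \<in> hom_words (word_deg w) M"
      unfolding hom_words_def by (rule cspan_base) (use w in auto)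
    then have "k \<odot> word_val w \<in> hom_words (word_deg w) M"
      by (rule csubspaceD(4)[OF csubspace_hom_words])
    then have "v d \<in> hom_words d M" for d
      using csubspaceD(2)[OF csubspace_hom_words, of d M]
      by (auto simp: v_def w)
    then have "u d \<oplus> v d \<in> hom_words d M" for d
      using csubspaceD(3)[OF csubspace_hom_words] u(1) by blast
    moreover have "(\<Oplus>d\<in>degree_box M. u d \<oplus> v d) = (\<Oplus>d\<in>degree_box M. u d) \<oplus> (\<Oplus>d\<in>degree_box M. v d)"
      by (rule finsum_addf) (auto simp: uc v_def w)
    moreover have "(\<Oplus>d\<in>degree_box M. v d) = k \<odot> g"
      unfolding v_def using word_deg_in_box[OF w(2)]
      by (intro finsum_singleton) (auto simp: degree_box_def w)
    ultimately show ?case using u(2) by (intro exI[of _ "\<lambda>d. u d \<oplus> v d"]) simp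
  qed
  then show ?thesis using that by blast
qed

text \<open>Orthogonality makes \<open>h (z\<^sup>\<star> \<otimes> z)\<close> the sum over the
  components, and Cauchy-Schwarz over the box costs a second factor (2 M + 1)^3. With 1 + 2 M \<le>
  2 (1 + M) the constant becomes 4 * 2^6 = 256.\<close>

lemma words_decay:
  assumes "z \<in> words_span M"
  shows "\<parallel>z\<parallel>\<^sup>2 \<le> 256 * (1 + real M) ^ 6 * Re (h (z\<^sup>\<star> \<otimes> z))"
proof -
  obtain u where u: "\<And>d. u d \<in> hom_words d M" and z: "z = (\<Oplus>d\<in>degree_box M. u d)"
    using words_span_decompose[OF assms] by blast
  let ?B = "degree_box M"
  have fin: "finite ?B" by (simp add: degree_box_def)
  have uc: "u d \<in> carrier A" for d using u hom_words_carrier by blast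
  have zc: "z \<in> carrier A" using assms words_span_carrier by blast
  have Hz: "Re (h (z\<^sup>\<star> \<otimes> z)) = (\<Sum>d\<in>?B. Re (h ((u d)\<^sup>\<star> \<otimes> u d)))"
    unfolding z using h_star_mult_finsum[OF fin u] by simp
  have "\<parallel>z\<parallel> \<le> (\<Sum>d\<in>?B. \<parallel>u d\<parallel>)" unfolding z by (rule norm_finsum_le[OF fin]) (simp add: uc)
  then have "\<parallel>z\<parallel>\<^sup>2 \<le> (\<Sum>d\<in>?B. \<parallel>u d\<parallel>)\<^sup>2" using zc by (intro power_mono) simp_all
  also have "\<dots> = (\<Sum>d\<in>?B. \<parallel>u d\<parallel> * 1)\<^sup>2" by simp
  also have "\<dots> \<le> (\<Sum>d\<in>?B. \<parallel>u d\<parallel>\<^sup>2) * (\<Sum>d\<in>?B. 1\<^sup>2)" by (rule Cauchy_Schwarz_ineq_sum)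
  also have "\<dots> \<le> (4 * (1 + real (2 * M)) ^ 3 * Re (h (z\<^sup>\<star> \<otimes> z))) * (1 + real (2 * M)) ^ 3"
  proof (rule mult_mono)
    show "(\<Sum>d\<in>?B. \<parallel>u d\<parallel>\<^sup>2) \<le> 4 * (1 + real (2 * M)) ^ 3 * Re (h (z\<^sup>\<star> \<otimes> z))"
      unfolding Hz sum_distrib_left by (intro sum_mono norm_hom_words_le[OF u])
    have "real (card ?B) = (1 + real (2 * M)) ^ 3"
      by (simp add: degree_box_def card_cartesian_product power3_eq_cube nat_add_distrib algebra_simps)
    then show "(\<Sum>d\<in>?B. 1\<^sup>2) \<le> (1 + real (2 * M)) ^ 3" by simp
    show "0 \<le> 4 * (1 + real (2 * M)) ^ 3 * Re (h (z\<^sup>\<star> \<otimes> z))" using h_pos[OF zc] by simp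
  qed (simp add: sum_nonneg)
  also have "\<dots> = 4 * (1 + real (2 * M)) ^ 6 * Re (h (z\<^sup>\<star> \<otimes> z))"
    by (simp add: power_numeral_reduce)
  also have "\<dots> \<le> 4 * (2 * (1 + real M)) ^ 6 * Re (h (z\<^sup>\<star> \<otimes> z))"
    using h_pos[OF zc] by (intro mult_right_mono mult_left_mono power_mono) simp_all
  also have "\<dots> = 256 * (1 + real M) ^ 6 * Re (h (z\<^sup>\<star> \<otimes> z))"
    by (simp only: power_mult_distrib) simp
  finally show ?thesis .
qed

lemma rapid_decay: "rapid_decay_state A h words_span 256 6"
proof
  show "words_span M \<subseteq> carrier A" for M using words_span_carrier by blast
  show "\<one> \<in> words_span 0" using word_val_in_words_span[of "[]" 0] by simp
  show "(0::real) \<le> 256" by simp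
qed (rule words_span_mult words_span_star words_dense h_trace words_decay; assumption)+

lemmas haar_faithful = rapid_decay_state.faithful[OF rapid_decay]

end

theorem theorem6p4:
  fixes q :: complex
    and A :: "'a cstar_algebra" and a b D :: 'a
    and T :: "'t cstar_algebra" and tens :: "'a \<Rightarrow> 'a \<Rightarrow> 't"
    and \<Delta> :: "'a \<Rightarrow> 't" and h :: "'a \<Rightarrow> complex"
  assumes "cmod q = 1"
    and "\<forall>n::nat. n > 0 \<longrightarrow> q ^ n \<noteq> 1"
    and "is_C_Uq2 q A a b D"
    and "min_tensor_product A A T tens"
    and "Uq2_comultiplication q A a b D T tens \<Delta>"
    and "haar_state A T tens \<Delta> h"
  shows "\<forall>x\<in>carrier A. h (x\<^sup>\<star>\<^bsub>A\<^esub> \<otimes>\<^bsub>A\<^esub> x) = 0 \<longrightarrow> x = \<zero>\<^bsub>A\<^esub>"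
proof -
  note isC = assms(3)[unfolded is_C_Uq2_def]
  have rel: "Uq2_relations q A a b D" by (rule isC[THEN conjunct2, THEN conjunct1])
  have st: "state A h" by (rule assms(6)[unfolded haar_state_def, THEN conjunct1])
  have not_root: "q ^ n \<noteq> 1" if "n > 0" for n :: nat using assms(2) that by simp
  have A: "unital_cstar_algebra A" by (rule isC[THEN conjunct1])
  have T: "unital_cstar_algebra T" by (rule min_tensor_product.axioms(3)[OF assms(4)])
  have "Uq2_algebra A q a b D"
    by (intro Uq2_algebra.intro Uq2_algebra_axioms.intro A assms(1) rel)
  moreover have "cstar_state A h" by (intro cstar_state.intro cstar_state_axioms.intro A st)
  moreover have "Uq2_haar_axioms A q a b D h T tens \<Delta>"
    by (intro Uq2_haar_axioms.intro not_root assms(3-6))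
  ultimately have haar: "Uq2_haar A q a b D h T tens \<Delta>" using T by (intro Uq2_haar.intro)
  show ?thesis by (intro ballI impI) (rule Uq2_haar.haar_faithful[OF haar])
qed

end
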